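(* In the setting described in the context, let $\theta_i\ne0$ ($i\in[n-1]$), $\zeta_j\neq0$ ($j\in[m]$) and define $\mathcal S:\mathcal H^{n-1}\times\prod_{j=1}^m\mathcal K_j\to\mathcal H$ by $$\mathcal S(z,s)=J_{A_0}^{\sum_{c\in\mathrm{ch}(0)}M_c}\Big(\sum_{c\in\mathrm{ch}(0)}M_cz_c-\sum_{j\in\mathcal J_0}L_j^*s_j+a\Big).$$ Then the pair $(\mathcal T_{zs,\theta,\zeta},\mathcal S)$: (i) forms a fixed point encoding for the problem (P); (ii) is a frugal primal-dual parametrized resolvent splitting for (P) with $(n-1,m)$-fold minimal lifting.
   Context: Notation: $[r]=\{1,\dots,r\}$. For $M$ bounded, self-adjoint, uniformly positive definite and $A$ maximally monotone, $J_A^M:=J_{M^{-1}A}\circ M^{-1}=(M+A)^{-1}$. Problem data: $n\ge2$ and $m,p\ge0$ are integers; $\mathcal H,\mathcal K_1,\dots,\mathcal K_m$ are real Hilbert spaces; $A_i:\mathcal H\to2^{\mathcal H}$ ($i=0,\dots,n-1$) and $B_j:\mathcal K_j\to2^{\mathcal K_j}$ ($j\in[m]$) are maximally monotone; $D_j:\mathcal K_j\to2^{\mathcal K_j}$ is maximally monotone and $\nu_j$-strongly monotone, $\nu_j>0$ (so $D_j^{-1}$ is single-valued and $\nu_j$-cocoercive; $D_j=\mathcal N_{\{0\}}$, the normal cone operator of $\{0\}$, is admitted, and then $D_j^{-1}=0$, $B_j\square D_j=B_j$); $C_l:\mathcal H\to\mathcal H$ ($l\in[p]$) is $\beta_l$-cocoercive,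 $\beta_l>0$; $L_j:\mathcal H\to\mathcal K_j$ is bounded linear; $a\in\mathcal H$, $b_j\in\mathcal K_j$. Problem (P): find $u\in\mathcal H$ with $a\in\sum_{i=0}^{n-1}A_iu+\sum_{j=1}^mL_j^*(B_j\square D_j)(L_ju-b_j)+\sum_{l=1}^pC_lu$, where $B\square D=(B^{-1}+D^{-1})^{-1}$. Tree data: an arbitrary rooted tree with node set $\{0,\dots,n-1\}$ and root $0$; $\mathrm{pa}(i)$ is the parent of $i\in[n-1]$, $\mathrm{ch}(i)$ the set of children of $i$. $(\mathcal J_i)_{i=0}^{n-1}$ is a partition of $[m]$ (empty cells allowed) with $\mathcal J_i=\varnothing$ for every leaf $i$. $(\mathcal P_i)_{i=0}^{n-1}$ is a partition of $[p]$ (empty cells allowed) with $\mathcal P_0=\varnothing$. For each non-leaf node $r$, $(\mathcal J_{c,i})_{i\in\mathrm{ch}(r)}$ is a partition (empty cells allowed) of $\mathcal J_r$ (here the subscript $c$ in $\mathcal J_{c,i}$ is just a label, standing for "correction"). Metrics: $M_i$ on $\mathcal H$ ($i\in[n-1]$) and $N_j$ on $\mathcal K_j$ ($j\in[m]$) are linear, bounded, self-adjoint, uniformly positive definite (hence with closed ranges). Map $\mathcal T_{zs,\theta,\zeta}$: given $(z,s)=((z_i)_{i\in[n-1]},(s_j)_{j\in[m]})$, compute from root to leaves (root) $0\in A_0u_0+\sum_{c\in\mathrm{ch}(0)}M_c(u_0-z_c)+\sum_{j\in\mathcal J_0}L_j^*s_j-a$; (duals, for each node $i$ and $j\in\mathcal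 J_i$) $0\in B_j^{-1}\tilde s_j+N_j(\tilde s_j-s_j)+D_j^{-1}s_j-L_ju_i+b_j$; (nodes $i\in[n-1]$) $0\in A_iu_i+M_i(u_i+z_i-2u_{\mathrm{pa}(i)})+\sum_{c\in\mathrm{ch}(i)}M_c(u_i-z_c)+\sum_{l\in\mathcal P_i}C_lu_{\mathrm{pa}(i)}+\sum_{j\in\mathcal J_i}L_j^*s_j+\sum_{j\in\mathcal J_{c,i}}L_j^*(\tilde s_j-s_j)$; $\tilde z_i=z_i+u_i-u_{\mathrm{pa}(i)}$. Then $\mathcal T_{zs,\theta,\zeta}(z,s)=(z^+,s^+)$ with $z_i^+=z_i+\theta_i(\tilde z_i-z_i)$, $s_j^+=s_j+\zeta_j(\tilde s_j-s_j)$. Definitions. A pair $(T,S)$ of maps $T:X\to X$, $S:X\to\mathcal H$ ($X$ a Hilbert space), depending on the problem instance, is a fixed point encoding for (P) if for every instance: $\mathrm{Fix}\,T\ne\varnothing$ if and only if (P) has a solution, and $x\in\mathrm{Fix}\,T$ implies that $S(x)$ solves (P). It is a frugal primal-dual parametrized resolvent splitting for (P) if it is a fixed point encoding for (P) and there is a finite procedure, the same for all instances of (P), evaluating $T$ and $S$ at any given point which uses only: vector additions, multiplications by fixed scalars, applications of fixed metrics and their inverses, addition of the constants $a,b_j$, evaluations of $L_j$, $L_j^*$, $C_l$, $D_j^{-1}$, and exactly one evaluation of a (parametrized) resolvent of each $A_i$ and of each $B_j$ (evaluating a parametrized resolvent of $B_j^{-1}$ counts as evaluating one of $B_j$, by Moreau's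 identity). It has $(d,f)$-fold lifting if $X$ is a product of $d$ copies of $\mathcal H$ and $f$ factors each of which is one of the spaces $\mathcal K_1,\dots,\mathcal K_m$ (for $\mathcal T_{zs,\theta,\zeta}$: $X=\mathcal H^{n-1}\times\prod_{j=1}^m\mathcal K_j$). The $(n-1,m)$-fold lifting is minimal if every frugal primal-dual parametrized resolvent splitting for all instances of (P) requires at least $(n-1,m)$-fold lifting, i.e. if it has $(d,f)$-fold lifting then $d\ge n-1$ and $f\ge m$. *)

theory Defs
  imports "HOL-Analysis.Analysis" "HOL-Library.Set_Algebras" "HOL-Library.FuncSet"
begin

text \<open>
  A problem instance involves a varying finite number of real Hilbert spaces, and being a splitting
  is a property quantified over all instances, the spaces included. Hilbert spaces are therefore
  rendered as closed linear subspaces of an ambient Hilbert space, a type \<open>'u\<close> of class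
  \<open>{real_inner, complete_space}\<close>; finitely many given Hilbert spaces always embed isometrically
  in such an ambient space, namely their direct sum. (For the ambient space \<open>{0}\<close> all spaces are
  trivial and no lower bound on the lifting can hold.) Maps between these spaces are functions on
  \<open>'u\<close> of which only the values on the respective subspace matter.

  On sets of vectors, \<open>+\<close> and \<open>\<Sum>\<close> are the Minkowski operations of \<^theory>\<open>HOL-Library.Set_Algebras\<close>.
\<close>

section \<open>Operators on Hilbert spaces\<close>

text \<open>Set-valued operators on the space \<open>V\<close> have empty values outside \<open>V\<close>.\<close>

definition operator_on :: "'u set \<Rightarrow> ('u \<Rightarrow> 'u set) \<Rightarrow> bool" where
  "operator_on V A \<longleftrightarrow> (\<forall>x. A x \<subseteq> V) \<and> (\<forall>x. x \<notin> V \<longrightarrow> A x = {})"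

definition monotone_op :: "('u::real_inner \<Rightarrow> 'u set) \<Rightarrow> bool" where
  "monotone_op A \<longleftrightarrow> (\<forall>x y. \<forall>v\<in>A x. \<forall>w\<in>A y. 0 \<le> inner (x - y) (v - w))"

definition maximally_monotone_on :: "'u::real_inner set \<Rightarrow> ('u \<Rightarrow> 'u set) \<Rightarrow> bool" where
  "maximally_monotone_on V A \<longleftrightarrow> operator_on V A \<and> monotone_op A \<and>
     (\<forall>A'. operator_on V A' \<and> monotone_op A' \<and> (\<forall>x. A x \<subseteq> A' x) \<longrightarrow> A' = A)"

definition strongly_monotone_op :: "real \<Rightarrow> ('u::real_inner \<Rightarrow> 'u set) \<Rightarrow> bool" where
  "strongly_monotone_op \<nu> A \<longleftrightarrow>
     (\<forall>x y. \<forall>v\<in>A x. \<forall>w\<in>A y. \<nu> * (norm (x - y))\<^sup>2 \<le> inner (x - y) (v - w))"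

definition cocoercive_on :: "'u::real_inner set \<Rightarrow> real \<Rightarrow> ('u \<Rightarrow> 'u) \<Rightarrow> bool" where
  "cocoercive_on V \<beta> C \<longleftrightarrow> (\<forall>x\<in>V. C x \<in> V) \<and>
     (\<forall>x\<in>V. \<forall>y\<in>V. \<beta> * (norm (C x - C y))\<^sup>2 \<le> inner (x - y) (C x - C y))"

definition bounded_linear_on :: "'u::real_normed_vector set \<Rightarrow> 'u set \<Rightarrow> ('u \<Rightarrow> 'u) \<Rightarrow> bool" where
  "bounded_linear_on V W f \<longleftrightarrow> (\<forall>x\<in>V. f x \<in> W) \<and>
     (\<forall>x\<in>V. \<forall>y\<in>V. f (x + y) = f x + f y) \<and>
     (\<forall>r. \<forall>x\<in>V. f (r *\<^sub>R x) = r *\<^sub>R f x) \<and>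
     (\<exists>c. \<forall>x\<in>V. norm (f x) \<le> c * norm x)"

definition adjoint_on :: "'u::real_inner set \<Rightarrow> ('u \<Rightarrow> 'u) \<Rightarrow> 'u \<Rightarrow> 'u" where
  "adjoint_on V f y = (THE x. x \<in> V \<and> (\<forall>v\<in>V. inner (f v) y = inner v x))"

definition metric_on :: "'u::real_inner set \<Rightarrow> ('u \<Rightarrow> 'u) \<Rightarrow> bool" where
  "metric_on V M \<longleftrightarrow> bounded_linear_on V V M \<and>
     (\<forall>x\<in>V. \<forall>y\<in>V. inner (M x) y = inner x (M y)) \<and>
     (\<exists>c>0. \<forall>x\<in>V. c * (norm x)\<^sup>2 \<le> inner (M x) x)"

definition inverse_op :: "('u \<Rightarrow> 'u set) \<Rightarrow> 'u \<Rightarrow> 'u set" where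
  "inverse_op A v = {x. v \<in> A x}"

definition parallel_sum :: "('u::plus \<Rightarrow> 'u set) \<Rightarrow> ('u \<Rightarrow> 'u set) \<Rightarrow> 'u \<Rightarrow> 'u set" where
  "parallel_sum B D = inverse_op (\<lambda>v. inverse_op B v + inverse_op D v)"

text \<open>The parametrized resolvent \<open>(M + A)\<^sup>-\<^sup>1\<close>, a single-valued map when \<open>M\<close> is a metric and \<open>A\<close> is
  maximally monotone.\<close>

definition param_resolvent :: "('u::plus \<Rightarrow> 'u) \<Rightarrow> ('u \<Rightarrow> 'u set) \<Rightarrow> 'u \<Rightarrow> 'u" where
  "param_resolvent M A y = the_elem (inverse_op (\<lambda>x. {M x} + A x) y)"


section \<open>Problem instances\<close>

type_synonym 'u spaces = "'u set \<times> (nat \<Rightarrow> 'u set)"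

definition hilbert_spaces :: "nat \<Rightarrow> 'u::{real_inner,complete_space} spaces \<Rightarrow> bool" where
  "hilbert_spaces m V \<longleftrightarrow> subspace (fst V) \<and> closed (fst V) \<and>
     (\<forall>j\<in>{1..m}. subspace (snd V j) \<and> closed (snd V j))"

record 'u problem =
  spH :: "'u set"
  spK :: "nat \<Rightarrow> 'u set"
  opA :: "nat \<Rightarrow> 'u \<Rightarrow> 'u set"
  opB :: "nat \<Rightarrow> 'u \<Rightarrow> 'u set"
  opD :: "nat \<Rightarrow> 'u \<Rightarrow> 'u set"
  nu :: "nat \<Rightarrow> real"
  opC :: "nat \<Rightarrow> 'u \<Rightarrow> 'u"
  beta :: "nat \<Rightarrow> real"
  opL :: "nat \<Rightarrow> 'u \<Rightarrow> 'u"
  vec_a :: "'u"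
  vec_b :: "nat \<Rightarrow> 'u"

definition spaces_of :: "'u problem \<Rightarrow> 'u spaces" where
  "spaces_of P = (spH P, spK P)"

definition problem_instance ::
    "nat \<Rightarrow> nat \<Rightarrow> nat \<Rightarrow> 'u::{real_inner,complete_space} problem \<Rightarrow> bool" where
  "problem_instance n m p P \<longleftrightarrow>
     hilbert_spaces m (spaces_of P) \<and>
     (\<forall>i<n. maximally_monotone_on (spH P) (opA P i)) \<and>
     (\<forall>j\<in>{1..m}. maximally_monotone_on (spK P j) (opB P j) \<and>
        maximally_monotone_on (spK P j) (opD P j) \<and>
        nu P j > 0 \<and> strongly_monotone_op (nu P j) (opD P j) \<and>
        bounded_linear_on (spH P) (spK P j) (opL P j) \<and>
        vec_b P j \<in> spK P j) \<and>
     (\<forall>l\<in>{1..p}. beta P l > 0 \<and> cocoercive_on (spH P) (beta P l) (opC P l)) \<and>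
     vec_a P \<in> spH P"

definition Ladj :: "'u::real_inner problem \<Rightarrow> nat \<Rightarrow> 'u \<Rightarrow> 'u" where
  "Ladj P j = adjoint_on (spH P) (opL P j)"

text \<open>\<open>D\<^sub>j\<^sup>-\<^sup>1\<close> as a map; it is single-valued on the dual space by strong monotonicity.\<close>

definition Dinv :: "'u problem \<Rightarrow> nat \<Rightarrow> 'u \<Rightarrow> 'u" where
  "Dinv P j y = the_elem (inverse_op (opD P j) y)"

definition solves :: "nat \<Rightarrow> nat \<Rightarrow> nat \<Rightarrow> 'u::real_inner problem \<Rightarrow> 'u \<Rightarrow> bool" where
  "solves n m p P u \<longleftrightarrow> u \<in> spH P \<and>
     vec_a P \<in> (\<Sum>i<n. opA P i u)
       + (\<Sum>j=1..m. Ladj P j ` parallel_sum (opB P j) (opD P j) (opL P j u - vec_b P j))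
       + {\<Sum>l=1..p. opC P l u}"


section \<open>Fixed point encodings and frugal splittings\<close>

definition fixed_point_encoding ::
    "nat \<Rightarrow> nat \<Rightarrow> nat \<Rightarrow> ('u::{real_inner,complete_space} problem \<Rightarrow> 'x set) \<Rightarrow>
     ('u problem \<Rightarrow> 'x \<Rightarrow> 'x) \<Rightarrow> ('u problem \<Rightarrow> 'x \<Rightarrow> 'u) \<Rightarrow> bool" where
  "fixed_point_encoding n m p X T S \<longleftrightarrow>
     (\<forall>P. problem_instance n m p P \<longrightarrow>
        T P \<in> X P \<rightarrow> X P \<and> S P \<in> X P \<rightarrow> spH P \<and>
        ((\<exists>x\<in>X P. T P x = x) \<longleftrightarrow> (\<exists>u. solves n m p P u)) \<and>
        (\<forall>x\<in>X P. T P x = x \<longrightarrow> solves n m p P (S P x)))"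

text \<open>The space with \<open>d\<close> factors \<open>H\<close> and \<open>f\<close> factors \<open>K\<^sub>\<sigma>\<^sub>1, \<dots>, K\<^sub>\<sigma>\<^sub>f\<close>.\<close>

type_synonym 'u point = "(nat \<Rightarrow> 'u) \<times> (nat \<Rightarrow> 'u)"

definition lifted_space :: "nat \<Rightarrow> nat \<Rightarrow> (nat \<Rightarrow> nat) \<Rightarrow> 'u problem \<Rightarrow> 'u point set" where
  "lifted_space d f \<sigma> P = ({1..d} \<rightarrow>\<^sub>E spH P) \<times> (\<Pi>\<^sub>E k\<in>{1..f}. spK P (\<sigma> k))"

text \<open>
  The finite procedures are straight-line programs: every instruction computes one new value from
  the values computed before it, addressed by their position. Each value has a sort, which tells
  the space it lives in, so that for instance vectors of \<open>H\<close> and of some \<open>K\<^sub>j\<close> are never added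
  even if these spaces happen to coincide in some instance.

  A program must not depend on the instance, while a metric lives on a space of the instance. A
  fixed metric is accordingly a family of metrics indexed by the spaces alone: it must not depend on
  the operators and vectors of the instance. Given metrics on given spaces always extend to such a
  family, by identities on all other spaces.
\<close>

datatype space_sort = SortH | SortK nat

primrec space_of :: "'u spaces \<Rightarrow> space_sort \<Rightarrow> 'u set" where
  "space_of V SortH = fst V"
| "space_of V (SortK j) = snd V j"

type_synonym 'u metric = "'u spaces \<Rightarrow> 'u \<Rightarrow> 'u"

definition metric_family ::
    "nat \<Rightarrow> space_sort \<Rightarrow> 'u::{real_inner,complete_space} metric \<Rightarrow> bool" where
  "metric_family m \<tau> G \<longleftrightarrow> (\<forall>V. hilbert_spaces m V \<longrightarrow> metric_on (space_of V \<tau>) (G V))"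

datatype 'u instr =
    InputH nat
  | InputK nat
  | ConstA
  | ConstB nat
  | Add nat nat
  | Scale real nat
  | Metric space_sort "'u metric" nat
  | MetricInv space_sort "'u metric" nat
  | ApplyL nat nat
  | ApplyLadj nat nat
  | ApplyC nat nat
  | ApplyDinv nat nat
  | ResolventA nat "'u metric" nat
  | ResolventB nat "'u metric" nat
  | ResolventBinv nat "'u metric" nat

primrec exec_instr :: "'u::real_inner problem \<Rightarrow> 'u point \<Rightarrow> 'u list \<Rightarrow> 'u instr \<Rightarrow> 'u" where
  "exec_instr P x vs (InputH k) = fst x k"
| "exec_instr P x vs (InputK k) = snd x k"
| "exec_instr P x vs ConstA = vec_a P"
| "exec_instr P x vs (ConstB j) = vec_b P j"
| "exec_instr P x vs (Add q r) = vs ! q + vs ! r"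
| "exec_instr P x vs (Scale c r) = c *\<^sub>R (vs ! r)"
| "exec_instr P x vs (Metric \<tau> G r) = G (spaces_of P) (vs ! r)"
| "exec_instr P x vs (MetricInv \<tau> G r) =
     inv_into (space_of (spaces_of P) \<tau>) (G (spaces_of P)) (vs ! r)"
| "exec_instr P x vs (ApplyL j r) = opL P j (vs ! r)"
| "exec_instr P x vs (ApplyLadj j r) = Ladj P j (vs ! r)"
| "exec_instr P x vs (ApplyC l r) = opC P l (vs ! r)"
| "exec_instr P x vs (ApplyDinv j r) = Dinv P j (vs ! r)"
| "exec_instr P x vs (ResolventA i G r) = param_resolvent (G (spaces_of P)) (opA P i) (vs ! r)"
| "exec_instr P x vs (ResolventB j G r) = param_resolvent (G (spaces_of P)) (opB P j) (vs ! r)"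
| "exec_instr P x vs (ResolventBinv j G r) =
     param_resolvent (G (spaces_of P)) (inverse_op (opB P j)) (vs ! r)"

primrec run :: "'u::real_inner problem \<Rightarrow> 'u point \<Rightarrow> 'u list \<Rightarrow> 'u instr list \<Rightarrow> 'u list" where
  "run P x vs [] = vs"
| "run P x vs (c # cs) = run P x (vs @ [exec_instr P x vs c]) cs"

definition at_sort :: "space_sort list \<Rightarrow> nat \<Rightarrow> space_sort \<Rightarrow> bool" where
  "at_sort ss r \<tau> \<longleftrightarrow> r < length ss \<and> ss ! r = \<tau>"

text \<open>\<open>instr_sort n m p d f \<sigma> ss c \<tau>\<close>: when the values computed so far have the sorts \<open>ss\<close>, the
  instruction \<open>c\<close> is admissible and its value has sort \<open>\<tau>\<close>.\<close>

primrec instr_sort ::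
    "nat \<Rightarrow> nat \<Rightarrow> nat \<Rightarrow> nat \<Rightarrow> nat \<Rightarrow> (nat \<Rightarrow> nat) \<Rightarrow> space_sort list \<Rightarrow>
     'u::{real_inner,complete_space} instr \<Rightarrow> space_sort \<Rightarrow> bool" where
  "instr_sort n m p d f \<sigma> ss (InputH k) \<tau> \<longleftrightarrow> k \<in> {1..d} \<and> \<tau> = SortH"
| "instr_sort n m p d f \<sigma> ss (InputK k) \<tau> \<longleftrightarrow> k \<in> {1..f} \<and> \<tau> = SortK (\<sigma> k)"
| "instr_sort n m p d f \<sigma> ss ConstA \<tau> \<longleftrightarrow> \<tau> = SortH"
| "instr_sort n m p d f \<sigma> ss (ConstB j) \<tau> \<longleftrightarrow> j \<in> {1..m} \<and> \<tau> = SortK j"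
| "instr_sort n m p d f \<sigma> ss (Add q r) \<tau> \<longleftrightarrow> at_sort ss q \<tau> \<and> at_sort ss r \<tau>"
| "instr_sort n m p d f \<sigma> ss (Scale c r) \<tau> \<longleftrightarrow> at_sort ss r \<tau>"
| "instr_sort n m p d f \<sigma> ss (Metric \<tau>' G r) \<tau> \<longleftrightarrow>
     \<tau> = \<tau>' \<and> at_sort ss r \<tau> \<and> metric_family m \<tau> G"
| "instr_sort n m p d f \<sigma> ss (MetricInv \<tau>' G r) \<tau> \<longleftrightarrow>
     \<tau> = \<tau>' \<and> at_sort ss r \<tau> \<and> metric_family m \<tau> G"
| "instr_sort n m p d f \<sigma> ss (ApplyL j r) \<tau> \<longleftrightarrow> j \<in> {1..m} \<and> at_sort ss r SortH \<and> \<tau> = SortK j"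
| "instr_sort n m p d f \<sigma> ss (ApplyLadj j r) \<tau> \<longleftrightarrow>
     j \<in> {1..m} \<and> at_sort ss r (SortK j) \<and> \<tau> = SortH"
| "instr_sort n m p d f \<sigma> ss (ApplyC l r) \<tau> \<longleftrightarrow> l \<in> {1..p} \<and> at_sort ss r SortH \<and> \<tau> = SortH"
| "instr_sort n m p d f \<sigma> ss (ApplyDinv j r) \<tau> \<longleftrightarrow>
     j \<in> {1..m} \<and> at_sort ss r (SortK j) \<and> \<tau> = SortK j"
| "instr_sort n m p d f \<sigma> ss (ResolventA i G r) \<tau> \<longleftrightarrow>
     i < n \<and> at_sort ss r SortH \<and> \<tau> = SortH \<and> metric_family m SortH G"
| "instr_sort n m p d f \<sigma> ss (ResolventB j G r) \<tau> \<longleftrightarrow>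
     j \<in> {1..m} \<and> at_sort ss r (SortK j) \<and> \<tau> = SortK j \<and> metric_family m (SortK j) G"
| "instr_sort n m p d f \<sigma> ss (ResolventBinv j G r) \<tau> \<longleftrightarrow>
     j \<in> {1..m} \<and> at_sort ss r (SortK j) \<and> \<tau> = SortK j \<and> metric_family m (SortK j) G"

primrec prog_sorts ::
    "nat \<Rightarrow> nat \<Rightarrow> nat \<Rightarrow> nat \<Rightarrow> nat \<Rightarrow> (nat \<Rightarrow> nat) \<Rightarrow> space_sort list \<Rightarrow>
     'u::{real_inner,complete_space} instr list \<Rightarrow> space_sort list \<Rightarrow> bool" where
  "prog_sorts n m p d f \<sigma> ss [] ss' \<longleftrightarrow> ss' = ss"
| "prog_sorts n m p d f \<sigma> ss (c # cs) ss' \<longleftrightarrow>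
     (\<exists>\<tau>. instr_sort n m p d f \<sigma> ss c \<tau> \<and> prog_sorts n m p d f \<sigma> (ss @ [\<tau>]) cs ss')"

definition evaluates_A :: "nat \<Rightarrow> 'u instr \<Rightarrow> bool" where
  "evaluates_A i c \<longleftrightarrow> (\<exists>G r. c = ResolventA i G r)"

definition evaluates_B :: "nat \<Rightarrow> 'u instr \<Rightarrow> bool" where
  "evaluates_B j c \<longleftrightarrow> (\<exists>G r. c = ResolventB j G r \<or> c = ResolventBinv j G r)"

text \<open>The program \<open>cs\<close> computes the components of \<open>T x\<close> at the positions \<open>oz\<close> and \<open>os\<close>, and \<open>S x\<close> at
  the position \<open>ou\<close>.\<close>

definition frugal_procedure ::
    "nat \<Rightarrow> nat \<Rightarrow> nat \<Rightarrow> nat \<Rightarrow> nat \<Rightarrow> (nat \<Rightarrow> nat) \<Rightarrow>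
     ('u::{real_inner,complete_space} problem \<Rightarrow> 'u point \<Rightarrow> 'u point) \<Rightarrow>
     ('u problem \<Rightarrow> 'u point \<Rightarrow> 'u) \<Rightarrow>
     'u instr list \<Rightarrow> (nat \<Rightarrow> nat) \<Rightarrow> (nat \<Rightarrow> nat) \<Rightarrow> nat \<Rightarrow> bool" where
  "frugal_procedure n m p d f \<sigma> T S cs oz os ou \<longleftrightarrow>
     (\<exists>ss. prog_sorts n m p d f \<sigma> [] cs ss \<and>
        (\<forall>k\<in>{1..d}. at_sort ss (oz k) SortH) \<and>
        (\<forall>k\<in>{1..f}. at_sort ss (os k) (SortK (\<sigma> k))) \<and>
        at_sort ss ou SortH) \<and>
     (\<forall>i<n. length (filter (evaluates_A i) cs) = 1) \<and>
     (\<forall>j\<in>{1..m}. length (filter (evaluates_B j) cs) = 1) \<and>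
     (\<forall>P. problem_instance n m p P \<longrightarrow> (\<forall>x\<in>lifted_space d f \<sigma> P.
        T P x = (\<lambda>k\<in>{1..d}. run P x [] cs ! oz k, \<lambda>k\<in>{1..f}. run P x [] cs ! os k) \<and>
        S P x = run P x [] cs ! ou))"

definition frugal_splitting ::
    "nat \<Rightarrow> nat \<Rightarrow> nat \<Rightarrow> nat \<Rightarrow> nat \<Rightarrow> (nat \<Rightarrow> nat) \<Rightarrow>
     ('u::{real_inner,complete_space} problem \<Rightarrow> 'u point \<Rightarrow> 'u point) \<Rightarrow>
     ('u problem \<Rightarrow> 'u point \<Rightarrow> 'u) \<Rightarrow> bool" where
  "frugal_splitting n m p d f \<sigma> T S \<longleftrightarrow>
     \<sigma> \<in> {1..f} \<rightarrow> {1..m} \<and>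
     fixed_point_encoding n m p (lifted_space d f \<sigma>) T S \<and>
     (\<exists>cs oz os ou. frugal_procedure n m p d f \<sigma> T S cs oz os ou)"

definition minimal_lifting ::
    "'u::{real_inner,complete_space} itself \<Rightarrow> nat \<Rightarrow> nat \<Rightarrow> nat \<Rightarrow> nat \<Rightarrow> nat \<Rightarrow> bool" where
  "minimal_lifting _ n m p d f \<longleftrightarrow>
     (\<forall>d' f' \<sigma>' (T' :: 'u problem \<Rightarrow> 'u point \<Rightarrow> 'u point) S'.
        frugal_splitting n m p d' f' \<sigma>' T' S' \<longrightarrow> d \<le> d' \<and> f \<le> f')"


section \<open>The splitting associated with a rooted tree\<close>

text \<open>A rooted tree on \<open>{..<n}\<close> with root \<open>0\<close>, given by its parent map (whose value at \<open>0\<close> is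
  irrelevant).\<close>

definition rooted_tree :: "nat \<Rightarrow> (nat \<Rightarrow> nat) \<Rightarrow> bool" where
  "rooted_tree n pa \<longleftrightarrow> (\<forall>i\<in>{1..n-1}. pa i < n \<and> (\<exists>k. (pa ^^ k) i = 0))"

definition ch :: "nat \<Rightarrow> (nat \<Rightarrow> nat) \<Rightarrow> nat \<Rightarrow> nat set" where
  "ch n pa i = {c \<in> {1..n-1}. pa c = i}"

definition indexed_partition :: "'i set \<Rightarrow> ('i \<Rightarrow> 'b set) \<Rightarrow> 'b set \<Rightarrow> bool" where
  "indexed_partition I F X \<longleftrightarrow> disjoint_family_on F I \<and> (\<Union>i\<in>I. F i) = X"

definition tree_data ::
    "nat \<Rightarrow> nat \<Rightarrow> nat \<Rightarrow> (nat \<Rightarrow> nat) \<Rightarrow> (nat \<Rightarrow> nat set) \<Rightarrow> (nat \<Rightarrow> nat set) \<Rightarrow> (nat \<Rightarrow> nat set) \<Rightarrow> bool" where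
  "tree_data n m p pa J Jc Q \<longleftrightarrow>
     rooted_tree n pa \<and>
     indexed_partition {..<n} J {1..m} \<and> (\<forall>i<n. ch n pa i = {} \<longrightarrow> J i = {}) \<and>
     indexed_partition {..<n} Q {1..p} \<and> Q 0 = {} \<and>
     (\<forall>r<n. ch n pa r \<noteq> {} \<longrightarrow> indexed_partition (ch n pa r) Jc (J r))"

text \<open>\<open>st\<close> stands for s-tilde, and \<open>Q\<close> for the partition P of the index set of the \<open>C\<^sub>l\<close>.\<close>

definition tree_sweep ::
    "nat \<Rightarrow> (nat \<Rightarrow> nat) \<Rightarrow> (nat \<Rightarrow> nat set) \<Rightarrow> (nat \<Rightarrow> nat set) \<Rightarrow> (nat \<Rightarrow> nat set) \<Rightarrow>
     (nat \<Rightarrow> 'u::real_inner metric) \<Rightarrow> (nat \<Rightarrow> 'u metric) \<Rightarrow> 'u problem \<Rightarrow>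
     'u point \<Rightarrow> (nat \<Rightarrow> 'u) \<Rightarrow> (nat \<Rightarrow> 'u) \<Rightarrow> bool" where
  "tree_sweep n pa J Jc Q Mf Nf P = (\<lambda>(z, s) u st.
     let M = (\<lambda>i. Mf i (spaces_of P)); N = (\<lambda>j. Nf j (spaces_of P)) in
     0 \<in> opA P 0 (u 0)
          + {(\<Sum>c\<in>ch n pa 0. M c (u 0 - z c)) + (\<Sum>j\<in>J 0. Ladj P j (s j)) - vec_a P} \<and>
     (\<forall>i<n. \<forall>j\<in>J i.
        0 \<in> inverse_op (opB P j) (st j)
             + {N j (st j - s j) + Dinv P j (s j) - opL P j (u i) + vec_b P j}) \<and>
     (\<forall>i\<in>{1..n-1}.
        0 \<in> opA P i (u i)
             + {M i (u i + z i - 2 *\<^sub>R u (pa i)) + (\<Sum>c\<in>ch n pa i. M c (u i - z c))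
                + (\<Sum>l\<in>Q i. opC P l (u (pa i)))
                + (\<Sum>j\<in>J i. Ladj P j (s j)) + (\<Sum>j\<in>Jc i. Ladj P j (st j - s j))}))"

text \<open>The inclusions determine the result uniquely although \<open>u\<close> and \<open>st\<close> are arbitrary outside their
  index ranges; this is why \<open>THE\<close> is applied to the result.\<close>

definition tree_T ::
    "nat \<Rightarrow> nat \<Rightarrow> (nat \<Rightarrow> nat) \<Rightarrow> (nat \<Rightarrow> nat set) \<Rightarrow> (nat \<Rightarrow> nat set) \<Rightarrow> (nat \<Rightarrow> nat set) \<Rightarrow>
     (nat \<Rightarrow> 'u::real_inner metric) \<Rightarrow> (nat \<Rightarrow> 'u metric) \<Rightarrow> (nat \<Rightarrow> real) \<Rightarrow> (nat \<Rightarrow> real) \<Rightarrow>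
     'u problem \<Rightarrow> 'u point \<Rightarrow> 'u point" where
  "tree_T n m pa J Jc Q Mf Nf \<theta> \<zeta> P = (\<lambda>(z, s). THE x'. \<exists>u st.
     tree_sweep n pa J Jc Q Mf Nf P (z, s) u st \<and>
     (let zt = (\<lambda>i. z i + u i - u (pa i)) in
      x' = (\<lambda>i\<in>{1..n-1}. z i + \<theta> i *\<^sub>R (zt i - z i),
            \<lambda>j\<in>{1..m}. s j + \<zeta> j *\<^sub>R (st j - s j))))"

definition tree_S ::
    "nat \<Rightarrow> (nat \<Rightarrow> nat) \<Rightarrow> (nat \<Rightarrow> nat set) \<Rightarrow> (nat \<Rightarrow> 'u::real_inner metric) \<Rightarrow>
     'u problem \<Rightarrow> 'u point \<Rightarrow> 'u" where
  "tree_S n pa J Mf P = (\<lambda>(z, s).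
     let M = (\<lambda>i. Mf i (spaces_of P)) in
     param_resolvent (\<lambda>x. \<Sum>c\<in>ch n pa 0. M c x) (opA P 0)
       ((\<Sum>c\<in>ch n pa 0. M c (z c)) - (\<Sum>j\<in>J 0. Ladj P j (s j)) + vec_a P))"

end

theory Submission
  imports Defs
begin

text \<open>
  Encoding. A fixed point has \<open>u i = u (pa i)\<close> for all nodes, hence a common value \<open>u\<close>, and
  \<open>st = s\<close>; adding the inclusions over the tree, the metric terms of each edge cancel and the sum is
  the inclusion of the problem. Conversely the \<open>z i\<close> are recovered from a solution edge by edge, from
  the leaves to the root. That the sweep is well defined rests on Minty's theorem.

  Minimality. With \<open>H = {0}\<close> and \<open>K j\<close> the only nontrivial dual space, a splitting without a factor
  \<open>K j\<close> acts on a single point, so it always has a fixed point; but some of these instances have no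
  solution. For the primal bound let \<open>H\<close> be a line, all \<open>K j = {0}\<close>, and \<open>A i x = x + w i\<close> with
  \<open>\<Sum>i. w i = 0\<close>, whose only solution is \<open>0\<close>. Replacing each \<open>A i\<close> by the normal cone operator of
  the value \<open>u i\<close> that its resolvent returns at a fixed point does not change the run, and this
  instance can only be solved by a common value of all \<open>u i\<close>. So all resolvents return \<open>0\<close>, their
  arguments are linear in the point of \<open>H\<^sup>d\<close>, and these arguments are the \<open>w i\<close>, which range over a
  space of dimension \<open>n - 1\<close>.
\<close>

section \<open>Minimisation and the Riesz representation\<close>

text \<open>The obstacle in the primal bound is that a competing program is arbitrary: resolvents in
  unrelated metrics sit between its other instructions. Since each \<open>A i\<close> is evaluated
  once, the run at one point sees a single value \<open>u i\<close> per operator, and a resolvent of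
  the normal cone of \<open>{u i}\<close> is the constant \<open>u i\<close> in every metric. Once
  all \<open>u i\<close> vanish, the modified instance no longer depends on \<open>w\<close>, so the
  linear coefficients of the resolvent arguments can be fixed first and \<open>w\<close> chosen
  against them. On a line every metric is a nonzero scalar, which makes these coefficients real
  numbers. The summand \<open>x\<close> in \<open>A i x = x + w i\<close> makes the solution unique
  and so forces the output of \<open>S\<close>; as a metric maps \<open>0\<close> to
  \<open>0\<close>, a resolvent of \<open>A i\<close> with value \<open>0\<close> has argument
  exactly \<open>w i\<close>. Minty's theorem is needed in infinite dimension, where bounded closed
  sets need not be compact. Uniform convexity replaces compactness: it makes minimising sequences
  Cauchy.\<close>

lemma uniformly_convex_minimizer:
  fixes F :: "'i \<Rightarrow> 'a::{real_inner,complete_space} \<Rightarrow> real"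
  assumes W: "closed W" "\<And>w w'. w \<in> W \<Longrightarrow> w' \<in> W \<Longrightarrow> (1/2) *\<^sub>R (w + w') \<in> W"
    and cont: "\<And>i. i \<in> I \<Longrightarrow> continuous_on W (F i)"
    and mid: "\<And>i w w' t. i \<in> I \<Longrightarrow> w \<in> W \<Longrightarrow> w' \<in> W \<Longrightarrow> F i w \<le> t \<Longrightarrow> F i w' \<le> t \<Longrightarrow>
      F i ((1/2) *\<^sub>R (w + w')) + \<kappa> * (norm (w - w'))\<^sup>2 \<le> t"
    and \<kappa>: "\<kappa> > 0"
    and feasible: "w1 \<in> W" "\<And>i. i \<in> I \<Longrightarrow> F i w1 \<le> t1"
    and lower: "\<And>w t. w \<in> W \<Longrightarrow> (\<And>i. i \<in> I \<Longrightarrow> F i w \<le> t) \<Longrightarrow> b \<le> t"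
  obtains w t where "w \<in> W" "\<And>i. i \<in> I \<Longrightarrow> F i w \<le> t"
    "\<And>w' t'. w' \<in> W \<Longrightarrow> (\<And>i. i \<in> I \<Longrightarrow> F i w' \<le> t') \<Longrightarrow> t \<le> t'"
proof -
  \<comment> \<open>\<open>T\<close> holds the levels that bound the whole family at some point of
    \<open>W\<close>, so the objective is the supremum of the \<open>F i\<close>. A family is used
    because the Fitzpatrick function is a supremum of affine functions with possibly infinite
    values; inequalities \<open>F i w \<le> t\<close> avoid extended reals.\<close>
  define T where "T = {t. \<exists>w\<in>W. \<forall>i\<in>I. F i w \<le> t}"
  define t0 where "t0 = Inf T"
  have T1: "T \<noteq> {}" using feasible by (auto simp: T_def)
  have bdd: "bdd_below T" by (rule bdd_belowI[of _ b]) (use lower in \<open>auto simp: T_def\<close>)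
  have t0_le: "t0 \<le> t" if "t \<in> T" for t
    unfolding t0_def using that bdd by (rule cInf_lower)
  have "\<exists>w\<in>W. \<forall>i\<in>I. F i w \<le> t0 + 1 / Suc k" for k
  proof -
    have "Inf T < t0 + 1 / Suc k" by (simp add: t0_def)
    then obtain t where "t \<in> T" "t < t0 + 1 / Suc k"
      using cInf_lessD[OF T1] by blast
    then show ?thesis unfolding T_def by force
  qed
  then obtain s where s: "\<And>k. s k \<in> W" "\<And>k i. i \<in> I \<Longrightarrow> F i (s k) \<le> t0 + 1 / Suc k"
    by metis
  \<comment> \<open>The midpoint of two points of level at most \<open>t0 + 1 / Suc N\<close> has a
    level lower by \<open>\<kappa> * (norm (s k - s l))\<^sup>2\<close>, and no level lies below
    \<open>t0\<close>.\<close>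
  have diff: "\<kappa> * (norm (s k - s l))\<^sup>2 \<le> 1 / Suc N" if "N \<le> k" "N \<le> l" for k l N
  proof -
    have "1 / real (Suc k) \<le> 1 / Suc N" "1 / real (Suc l) \<le> 1 / Suc N"
      using that by (auto intro!: divide_left_mono)
    then have le: "F i (s k) \<le> t0 + 1 / Suc N" "F i (s l) \<le> t0 + 1 / Suc N" if "i \<in> I" for i
      using s(2)[OF that, of k] s(2)[OF that, of l] by linarith+
    have "t0 + 1 / Suc N - \<kappa> * (norm (s k - s l))\<^sup>2 \<in> T"
      unfolding T_def using W(2)[OF s(1)[of k] s(1)[of l]] mid[OF _ s(1)[of k] s(1)[of l] le]
      by (force simp: algebra_simps)
    from t0_le[OF this] show ?thesis by simp
  qed
  have "Cauchy s"
  proof (rule metric_CauchyI)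
    fix e :: real assume "e > 0"
    then have "\<kappa> * e\<^sup>2 > 0" using \<kappa> by simp
    then obtain N where N: "1 / real (Suc N) < \<kappa> * e\<^sup>2"
      using nat_approx_posE by blast
    have "dist (s k) (s l) < e" if "N \<le> k" "N \<le> l" for k l
    proof -
      have "\<kappa> * (norm (s k - s l))\<^sup>2 < \<kappa> * e\<^sup>2" using diff[OF that] N by linarith
      then have "(norm (s k - s l))\<^sup>2 < e\<^sup>2" using \<kappa> by simp
      then show ?thesis using \<open>e > 0\<close> by (simp add: dist_norm power2_less_imp_less)
    qed
    then show "\<exists>M. \<forall>m\<ge>M. \<forall>n\<ge>M. dist (s m) (s n) < e" by blast
  qed
  then obtain w where w: "s \<longlonglongrightarrow> w"
    using Cauchy_convergent_iff convergent_def by blast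
  have wW: "w \<in> W" using closed_sequentially[OF W(1) _ w] s(1) by blast
  have "F i w \<le> t0" if "i \<in> I" for i
  proof (rule LIMSEQ_le)
    show "(\<lambda>k. F i (s k)) \<longlonglongrightarrow> F i w"
      using continuous_on_tendsto_compose[OF cont[OF that] w wW] s(1) by simp
    show "(\<lambda>k. t0 + 1 / Suc k) \<longlonglongrightarrow> t0"
      using tendsto_add[OF tendsto_const[of t0] LIMSEQ_inverse_real_of_nat]
      by (simp add: inverse_eq_divide)
    show "\<exists>N. \<forall>n\<ge>N. F i (s n) \<le> t0 + 1 / Suc n" using s(2)[OF that] by blast
  qed
  moreover have "t0 \<le> t'" if "w' \<in> W" "\<And>i. i \<in> I \<Longrightarrow> F i w' \<le> t'" for w' t'
    using that by (intro t0_le) (auto simp: T_def)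
  ultimately show thesis using that wW by blast
qed

lemma norm_midpoint:
  fixes w w' :: "'a::real_inner"
  shows "(norm ((1/2) *\<^sub>R (w + w')))\<^sup>2 = (norm w)\<^sup>2 / 2 + (norm w')\<^sup>2 / 2 - (norm (w - w'))\<^sup>2 / 4"
  by (simp add: power2_norm_eq_inner inner_simps field_simps inner_commute)

lemma norm_add_scaleR_sq:
  fixes x v :: "'a::real_inner"
  shows "(norm (x + s *\<^sub>R v))\<^sup>2 = (norm x)\<^sup>2 + 2 * s * inner x v + s\<^sup>2 * (norm v)\<^sup>2"
  unfolding power2_norm_eq_inner by (simp add: inner_simps inner_commute power2_eq_square)

text \<open>First-order optimality without derivatives: divide by \<open>s\<close> and let
  \<open>s\<close> tend to \<open>0\<close>. The range \<open>s \<le> 1\<close> suits variations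
  along a segment.\<close>

lemma linear_term_nonneg:
  fixes a b :: real
  assumes "\<And>s. 0 < s \<Longrightarrow> s \<le> 1 \<Longrightarrow> 0 \<le> s * a + s\<^sup>2 * b"
  shows "0 \<le> a"
proof (rule ccontr)
  assume "\<not> 0 \<le> a"
  \<comment> \<open>Small enough for \<open>s * b \<le> - a / 2\<close>, whence
    \<open>a + s * b < 0\<close>; the \<open>+ 1\<close> avoids a zero denominator.\<close>
  define s where "s = min 1 (- a / (2 * (\<bar>b\<bar> + 1)))"
  have s: "0 < s" "s \<le> 1" using \<open>\<not> 0 \<le> a\<close> by (auto simp: s_def field_simps)
  have "s * b \<le> s * (\<bar>b\<bar> + 1)" using s by (simp add: mult_left_mono)
  also have "\<dots> \<le> - a / (2 * (\<bar>b\<bar> + 1)) * (\<bar>b\<bar> + 1)"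
    by (rule mult_right_mono) (auto simp: s_def)
  also have "\<dots> = - a / 2" by (simp add: field_simps)
  finally have "a + s * b < 0" using \<open>\<not> 0 \<le> a\<close> by simp
  then have "s * (a + s * b) < 0" using s by (simp add: mult_pos_neg)
  then show False using assms[OF s] by (simp add: algebra_simps power2_eq_square)
qed

text \<open>The representing vector minimises \<open>|x|^2 / 2 - f x\<close> over \<open>V\<close>:
  the first variations in the directions \<open>v\<close> and \<open>- v\<close> give the two
  inequalities of \<open>f v = inner v x\<close>. The index type \<open>unit\<close> makes the
  minimised family a single function.\<close>

lemma riesz_representation_on:
  fixes V :: "'u::{real_inner,complete_space} set"
  assumes V: "subspace V" "closed V"
    and add: "\<And>x y. x \<in> V \<Longrightarrow> y \<in> V \<Longrightarrow> f (x + y) = f x + f y"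
    and scale: "\<And>r x. x \<in> V \<Longrightarrow> f (r *\<^sub>R x) = r * f x"
    and bound: "\<And>x. x \<in> V \<Longrightarrow> \<bar>f x\<bar> \<le> c * norm x"
  obtains x where "x \<in> V" "\<And>v. v \<in> V \<Longrightarrow> f v = inner v x"
proof -
  define F where "F = (\<lambda>(_::unit) x. (norm x)\<^sup>2 / 2 - f x)"
  have diff: "f (x - y) = f x - f y" if "x \<in> V" "y \<in> V" for x y
    using add[of "x - y" y] that V(1) by (simp add: subspace_diff)
  have lip: "(\<bar>c\<bar> + 1)-lipschitz_on V f"
  proof (rule lipschitz_onI)
    fix x y assume "x \<in> V" "y \<in> V"
    then have "dist (f x) (f y) \<le> c * norm (x - y)"
      using bound[of "x - y"] diff V(1) by (simp add: subspace_diff dist_real_def)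
    also have "\<dots> \<le> (\<bar>c\<bar> + 1) * dist x y" by (simp add: dist_norm mult_right_mono)
    finally show "dist (f x) (f y) \<le> (\<bar>c\<bar> + 1) * dist x y" .
  qed auto
  have f_cont: "continuous_on V f" by (rule lipschitz_on_continuous_on[OF lip])
  have f0: "f 0 = 0" using scale[of 0 0] V(1) by (simp add: subspace_0)
  obtain x t where x: "x \<in> V" "\<And>i. i \<in> UNIV \<Longrightarrow> F i x \<le> t"
    and min: "\<And>y s. y \<in> V \<Longrightarrow> (\<And>i. i \<in> UNIV \<Longrightarrow> F i y \<le> s) \<Longrightarrow> t \<le> s"
  \<comment> \<open>\<open>1/8\<close> is half of the \<open>1/4\<close> in the parallelogram
    identity, and \<open>- c\<^sup>2 / 2\<close> is the minimum of
    \<open>r\<^sup>2 / 2 - c * r\<close> over real \<open>r\<close>.\<close>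
  proof (rule uniformly_convex_minimizer[of V UNIV F "1/8" 0 0 "- c\<^sup>2 / 2"])
    show "closed V" by (rule V)
    show "(1/2) *\<^sub>R (w + w') \<in> V" if "w \<in> V" "w' \<in> V" for w w'
      using that V(1) by (simp add: subspace_add subspace_scale)
    show "continuous_on V (F i)" for i
      unfolding F_def by (auto intro!: continuous_intros f_cont)
    show "F i ((1/2) *\<^sub>R (w + w')) + 1/8 * (norm (w - w'))\<^sup>2 \<le> t"
      if "w \<in> V" "w' \<in> V" "F i w \<le> t" "F i w' \<le> t" for i w w' t
    proof -
      have "f ((1/2) *\<^sub>R (w + w')) = 1/2 * (f w + f w')"
        using that scale[of "w + w'" "1/2"] add[of w w'] V(1) by (simp add: subspace_add)
      moreover have "(a / 2 + b / 2 - e / 4) / 2 - 1/2 * (q + r) + 1/8 * e \<le> t"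
        if "a / 2 - q \<le> t" "b / 2 - r \<le> t" for a b e q r :: real
        using that by (simp add: field_simps)
      ultimately show ?thesis using that(3,4) unfolding F_def norm_midpoint by metis
    qed
    show "0 \<in> V" using V(1) by (rule subspace_0)
    show "F i 0 \<le> 0" for i by (simp add: F_def f0)
    show "- c\<^sup>2 / 2 \<le> t" if "w \<in> V" "\<And>i. i \<in> UNIV \<Longrightarrow> F i w \<le> t" for w t
    proof -
      have "0 \<le> (norm w - c)\<^sup>2" by simp
      then have "- c\<^sup>2 / 2 \<le> (norm w)\<^sup>2 / 2 - c * norm w"
        by (simp add: power2_diff field_simps)
      also have "\<dots> \<le> t" using that(2)[of "()"] bound[OF that(1)] by (simp add: F_def)
      finally show ?thesis .
    qed
  qed auto
  have ge: "0 \<le> inner x v - f v" if "v \<in> V" for v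
  proof (rule linear_term_nonneg)
    fix s :: real
    have sv: "x + s *\<^sub>R v \<in> V" using that x(1) V(1) by (simp add: subspace_add subspace_scale)
    have "F () x \<le> F () (x + s *\<^sub>R v)"
      using min[OF sv, of "F () (x + s *\<^sub>R v)"] x(2)[of "()"] by (auto intro: order_trans)
    moreover have "f (x + s *\<^sub>R v) = f x + s * f v"
      using add[of x "s *\<^sub>R v"] scale[OF that] x(1) that V(1) by (simp add: subspace_scale)
    ultimately show "0 \<le> s * (inner x v - f v) + s\<^sup>2 * ((norm v)\<^sup>2 / 2)"
      using norm_add_scaleR_sq[of x s v] by (simp add: F_def algebra_simps)
  qed
  have "f v = inner v x" if "v \<in> V" for v
    using ge[OF that] ge[of "- v"] scale[OF that, of "-1"] that V(1)
    by (simp add: subspace_neg inner_commute)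
  with x(1) that show thesis by blast
qed

lemma adjoint_on_works:
  fixes V :: "'u::{real_inner,complete_space} set"
  assumes V: "subspace V" "closed V" and f: "bounded_linear_on V W f"
  shows "adjoint_on V f y \<in> V" "\<And>v. v \<in> V \<Longrightarrow> inner (f v) y = inner v (adjoint_on V f y)"
proof -
  obtain c where c: "\<And>x. x \<in> V \<Longrightarrow> norm (f x) \<le> c * norm x"
    using f unfolding bounded_linear_on_def by blast
  obtain x where x: "x \<in> V" "\<And>v. v \<in> V \<Longrightarrow> inner (f v) y = inner v x"
  proof (rule riesz_representation_on[OF V, of "\<lambda>v. inner (f v) y" "c * norm y"])
    show "\<bar>inner (f v) y\<bar> \<le> c * norm y * norm v" if "v \<in> V" for v
    proof -
      have "\<bar>inner (f v) y\<bar> \<le> norm (f v) * norm y" by (rule Cauchy_Schwarz_ineq2)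
      also have "\<dots> \<le> (c * norm v) * norm y" by (rule mult_right_mono[OF c[OF that] norm_ge_zero])
      finally show ?thesis by (simp add: mult_ac)
    qed
  qed (use f in \<open>auto simp: bounded_linear_on_def inner_simps\<close>)
  have "x' = x" if "x' \<in> V" "\<forall>v\<in>V. inner (f v) y = inner v x'" for x'
  proof -
    have "x' - x \<in> V" using that(1) x(1) V(1) by (simp add: subspace_diff)
    then have "inner (x' - x) x' = inner (x' - x) x" using that(2) x(2) by metis
    then have "inner (x' - x) (x' - x) = 0" by (simp add: inner_diff_right)
    then show ?thesis by simp
  qed
  then have "adjoint_on V f y = x" unfolding adjoint_on_def using x by (intro the_equality) auto
  with x show "adjoint_on V f y \<in> V" "\<And>v. v \<in> V \<Longrightarrow> inner (f v) y = inner v (adjoint_on V f y)"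
    by auto
qed

section \<open>Resolvents of maximally monotone operators\<close>

text \<open>Adding to the graph one pair that is monotonically related to it keeps the operator
  monotone, so maximality under inclusion means that such a pair is already there. The maximality
  proofs below go through this form.\<close>

lemma maximally_monotone_on_iff:
  "maximally_monotone_on V A \<longleftrightarrow> operator_on V A \<and> monotone_op A \<and>
     (\<forall>x\<in>V. \<forall>v\<in>V. (\<forall>y. \<forall>w\<in>A y. 0 \<le> inner (x - y) (v - w)) \<longrightarrow> v \<in> A x)"
  (is "?L \<longleftrightarrow> ?R")
proof
  assume L: ?L
  have "v \<in> A x" if "x \<in> V" "v \<in> V" and rel: "\<forall>y. \<forall>w\<in>A y. 0 \<le> inner (x - y) (v - w)" for x v
  proof -
    define A' where "A' = A(x := insert v (A x))"
    have "operator_on V A'" using L that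
      by (auto simp: A'_def maximally_monotone_on_def operator_on_def)
    moreover have "monotone_op A'"
      unfolding monotone_op_def
    proof (intro allI ballI)
      fix y z w w' assume w: "w \<in> A' y" "w' \<in> A' z"
      have mono: "\<And>y z w w'. w \<in> A y \<Longrightarrow> w' \<in> A z \<Longrightarrow> 0 \<le> inner (y - z) (w - w')"
        using L by (auto simp: maximally_monotone_on_def monotone_op_def)
      have flip: "0 \<le> inner (y - x) (w - v)" if "w \<in> A y" for y w
        using rel that by (metis inner_minus_left inner_minus_right minus_diff_eq minus_minus)
      show "0 \<le> inner (y - z) (w - w')"
        using w rel flip mono by (auto simp: A'_def split: if_splits)
    qed
    moreover have "\<forall>x. A x \<subseteq> A' x" by (auto simp: A'_def)
    ultimately have "A' = A" using L unfolding maximally_monotone_on_def by blast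
    then have "A' x = A x" by simp
    then show ?thesis by (auto simp: A'_def)
  qed
  then show ?R using L by (auto simp: maximally_monotone_on_def)
next
  assume R: ?R
  have "A' = A" if A': "operator_on V A'" "monotone_op A'" "\<forall>x. A x \<subseteq> A' x" for A'
  proof (intro ext subset_antisym subsetI)
    fix x v assume "v \<in> A' x"
    then have "x \<in> V" "v \<in> V" using A'(1) by (auto simp: operator_on_def)
    moreover have "\<forall>y. \<forall>w\<in>A y. 0 \<le> inner (x - y) (v - w)"
      using \<open>v \<in> A' x\<close> A'(2,3) unfolding monotone_op_def by blast
    ultimately show "v \<in> A x" using R by blast
  qed (use A'(3) in blast)
  then show ?L using R by (auto simp: maximally_monotone_on_def)
qed

lemma maximally_monotone_onI:
  assumes "\<And>x v. v \<in> A x \<Longrightarrow> x \<in> V \<and> v \<in> V"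
    and "\<And>x y v w. v \<in> A x \<Longrightarrow> w \<in> A y \<Longrightarrow> 0 \<le> inner (x - y) (v - w)"
    and "\<And>x v. x \<in> V \<Longrightarrow> v \<in> V \<Longrightarrow> \<forall>y. \<forall>w\<in>A y. 0 \<le> inner (x - y) (v - w) \<Longrightarrow> v \<in> A x"
  shows "maximally_monotone_on V A"
  unfolding maximally_monotone_on_iff operator_on_def monotone_op_def
  using assms by blast

lemma maximally_monotone_onD:
  assumes "maximally_monotone_on V A"
  shows "v \<in> A x \<Longrightarrow> x \<in> V \<and> v \<in> V"
    and "v \<in> A x \<Longrightarrow> w \<in> A y \<Longrightarrow> 0 \<le> inner (x - y) (v - w)"
    and "x \<in> V \<Longrightarrow> v \<in> V \<Longrightarrow> \<forall>y. \<forall>w\<in>A y. 0 \<le> inner (x - y) (v - w) \<Longrightarrow> v \<in> A x"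
proof -
  have *: "operator_on V A" "monotone_op A"
    "\<forall>x\<in>V. \<forall>v\<in>V. (\<forall>y. \<forall>w\<in>A y. 0 \<le> inner (x - y) (v - w)) \<longrightarrow> v \<in> A x"
    using assms unfolding maximally_monotone_on_iff by auto
  show "v \<in> A x \<Longrightarrow> x \<in> V \<and> v \<in> V" using *(1) unfolding operator_on_def by blast
  show "v \<in> A x \<Longrightarrow> w \<in> A y \<Longrightarrow> 0 \<le> inner (x - y) (v - w)"
    using *(2) unfolding monotone_op_def by blast
  show "x \<in> V \<Longrightarrow> v \<in> V \<Longrightarrow> \<forall>y. \<forall>w\<in>A y. 0 \<le> inner (x - y) (v - w) \<Longrightarrow> v \<in> A x"
    using *(3) by blast
qed

lemma maximally_monotone_on_inverse_op:
  assumes "maximally_monotone_on V A"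
  shows "maximally_monotone_on V (inverse_op A)"
proof (rule maximally_monotone_onI)
  note D = maximally_monotone_onD[OF assms]
  show "x \<in> V \<and> v \<in> V" if "v \<in> inverse_op A x" for x v
    using that D(1)[of x v] by (simp add: inverse_op_def)
  show "0 \<le> inner (x - y) (v - w)" if "v \<in> inverse_op A x" "w \<in> inverse_op A y" for x y v w
    using that D(2)[of x v y w] by (simp add: inverse_op_def inner_commute)
  show "v \<in> inverse_op A x" if "x \<in> V" "v \<in> V"
    and rel: "\<forall>y. \<forall>w\<in>inverse_op A y. 0 \<le> inner (x - y) (v - w)" for x v
  proof -
    have "\<forall>y. \<forall>w\<in>A y. 0 \<le> inner (v - y) (x - w)"
      using rel by (simp add: inverse_op_def inner_commute)
    then show ?thesis using D(3)[OF that(2,1)] by (simp add: inverse_op_def)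
  qed
qed

lemma maximally_monotone_on_affine_image:
  assumes A: "maximally_monotone_on V A" and V: "subspace V" and c: "c > 0" and w: "w \<in> V"
  shows "maximally_monotone_on V (\<lambda>x. (\<lambda>v. c *\<^sub>R v + w) ` A x)"
proof (rule maximally_monotone_onI)
  note AD = maximally_monotone_onD[OF A]
  show "x \<in> V \<and> v \<in> V" if "v \<in> (\<lambda>v. c *\<^sub>R v + w) ` A x" for x v
    using that AD(1)[of _ x] V w by (auto simp: subspace_add subspace_scale)
  show "0 \<le> inner (x - y) (v - v')"
    if v: "v \<in> (\<lambda>v. c *\<^sub>R v + w) ` A x" "v' \<in> (\<lambda>v. c *\<^sub>R v + w) ` A y" for x y v v'
  proof -
    obtain u u' where u: "u \<in> A x" "u' \<in> A y" "v = c *\<^sub>R u + w" "v' = c *\<^sub>R u' + w"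
      using v by blast
    have "inner (x - y) (v - v') = c * inner (x - y) (u - u')"
      unfolding u(3,4) by (simp flip: scaleR_diff_right)
    with AD(2)[OF u(1,2)] c show ?thesis by simp
  qed
  show "v \<in> (\<lambda>v. c *\<^sub>R v + w) ` A x" if "x \<in> V" "v \<in> V"
    and rel: "\<forall>y. \<forall>u\<in>(\<lambda>v. c *\<^sub>R v + w) ` A y. 0 \<le> inner (x - y) (v - u)" for x v
  proof (rule image_eqI)
    show "v = c *\<^sub>R ((1 / c) *\<^sub>R (v - w)) + w" using c by simp
    show "(1 / c) *\<^sub>R (v - w) \<in> A x"
    proof (rule AD(3); (intro allI ballI)?)
      show "(1 / c) *\<^sub>R (v - w) \<in> V" using that(2) w V by (simp add: subspace_scale subspace_diff)
      fix y u assume "u \<in> A y"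
      then have "0 \<le> inner (x - y) (v - (c *\<^sub>R u + w))" using rel by blast
      also have "v - (c *\<^sub>R u + w) = c *\<^sub>R ((1 / c) *\<^sub>R (v - w) - u)"
        using c by (simp add: scaleR_diff_right)
      finally show "0 \<le> inner (x - y) ((1 / c) *\<^sub>R (v - w) - u)"
        using c by (simp add: zero_le_mult_iff)
    qed (use that in auto)
  qed
qed

text \<open>Maximality survives because a pair monotonically related to \<open>A - \<nu> Id\<close>
  becomes, after adding \<open>\<nu> x\<close> back, one related to \<open>A\<close>. The point is
  that inverting a strongly monotone operator turns into evaluating a resolvent of this part with
  the metric \<open>\<nu> Id\<close>.\<close>

lemma maximally_monotone_on_strong_part:
  assumes A: "maximally_monotone_on V A" and V: "subspace V"
    and s: "strongly_monotone_op \<nu> A" and \<nu>: "\<nu> \<ge> 0"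
  shows "maximally_monotone_on V (\<lambda>x. (\<lambda>v. v - \<nu> *\<^sub>R x) ` A x)"
proof (rule maximally_monotone_onI)
  note AD = maximally_monotone_onD[OF A]
  have eq: "inner (x - y) (v - \<nu> *\<^sub>R x - (w - \<nu> *\<^sub>R y))
      = inner (x - y) (v - w) - \<nu> * (norm (x - y))\<^sup>2" for x y v w :: 'a
    by (simp add: power2_norm_eq_inner inner_simps inner_commute algebra_simps)
  show "x \<in> V \<and> v \<in> V" if "v \<in> (\<lambda>v. v - \<nu> *\<^sub>R x) ` A x" for x v
    using that AD(1)[of _ x] V by (auto simp: subspace_diff subspace_scale)
  show "0 \<le> inner (x - y) (v - w)"
    if v: "v \<in> (\<lambda>v. v - \<nu> *\<^sub>R x) ` A x" "w \<in> (\<lambda>v. v - \<nu> *\<^sub>R y) ` A y" for x y v w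
    using that s by (auto simp: strongly_monotone_op_def eq)
  show "v \<in> (\<lambda>v. v - \<nu> *\<^sub>R x) ` A x" if "x \<in> V" "v \<in> V"
    and rel: "\<forall>y. \<forall>u\<in>(\<lambda>v. v - \<nu> *\<^sub>R y) ` A y. 0 \<le> inner (x - y) (v - u)" for x v
  proof (rule image_eqI)
    show "v = v + \<nu> *\<^sub>R x - \<nu> *\<^sub>R x" by simp
    show "v + \<nu> *\<^sub>R x \<in> A x"
    proof (rule AD(3); (intro allI ballI)?)
      show "v + \<nu> *\<^sub>R x \<in> V" using \<open>x \<in> V\<close> \<open>v \<in> V\<close> V by (simp add: subspace_scale subspace_add)
      fix y w assume "w \<in> A y"
      then have "0 \<le> inner (x - y) (v - (w - \<nu> *\<^sub>R y))" using rel by blast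
      then have "\<nu> * (norm (x - y))\<^sup>2 \<le> inner (x - y) (v + \<nu> *\<^sub>R x - w)"
        using eq[of x y "v + \<nu> *\<^sub>R x" w] by simp
      moreover have "0 \<le> \<nu> * (norm (x - y))\<^sup>2" using \<nu> by simp
      ultimately show "0 \<le> inner (x - y) (v + \<nu> *\<^sub>R x - w)" by linarith
    qed (use \<open>x \<in> V\<close> in auto)
  qed
qed

text \<open>
  Simons and Zalinescu's proof of Minty's theorem: the sum of the Fitzpatrick function of \<open>A\<close> and
  half the squared norm attains its minimum, and the optimality condition at the minimiser
  \<open>(x0, u0)\<close> says that \<open>(- u0, - x0)\<close> is monotonically related to \<open>A\<close>.
\<close>

lemma minty_zero:
  fixes V :: "'u::{real_inner,complete_space} set"
  assumes V: "subspace V" "closed V" and A: "maximally_monotone_on V A"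
  obtains x where "- x \<in> A x"
proof -
  note AD = maximally_monotone_onD[OF A]
  define I where "I = {(y, v). v \<in> A y}"
  \<comment> \<open>Affine functions indexed by the graph \<open>I\<close>; their supremum is the
    Fitzpatrick function of \<open>A\<close>.\<close>
  define a where "a = (\<lambda>(y, v) (x, u). inner x v + inner y u - inner y (v::'u))"
  define F where "F = (\<lambda>i w. a i w + (norm w)\<^sup>2 / 2)"
  \<comment> \<open>Uses \<open>inner x u - a (y, v) (x, u) = inner (x - y) (u - v)\<close>. If some
    \<open>q < inner x u\<close> bounded all \<open>a i (x, u)\<close>, then \<open>(x, u)\<close>
    would be related to the graph, hence in it, but its own affine function has the value
    \<open>inner x u\<close> there.\<close>
  have fitz: "inner x u \<le> q" if "x \<in> V" "u \<in> V" "\<And>i. i \<in> I \<Longrightarrow> a i (x, u) \<le> q" for x u q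
  proof (rule ccontr)
    assume q: "\<not> inner x u \<le> q"
    have "\<forall>y. \<forall>v\<in>A y. 0 \<le> inner (x - y) (u - v)"
    proof (intro allI ballI)
      fix y v assume "v \<in> A y"
      then have "a (y, v) (x, u) \<le> q" using that(3) by (simp add: I_def)
      then show "0 \<le> inner (x - y) (u - v)" using q by (simp add: a_def inner_simps)
    qed
    then have "u \<in> A x" using AD(3) that by blast
    then have "a (x, u) (x, u) \<le> q" using that(3) by (simp add: I_def)
    then show False using q by (simp add: a_def)
  qed
  \<comment> \<open>On the graph the lower bound \<open>fitz\<close> is attained. So the objective
    is finite at every graph point, and the minimisation is feasible.\<close>
  have a_self: "a i p \<le> inner (fst p) (snd p)" if "i \<in> I" "p \<in> I" for i p
    using AD(2)[of "snd p" "fst p" "snd i" "fst i"] that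
    by (auto simp: a_def I_def inner_simps inner_commute split: prod.splits)
  have "A \<noteq> (\<lambda>_. {})"
  proof
    assume "A = (\<lambda>_. {})"
    then show False using AD(3)[of 0 0] V(1) by (auto simp: subspace_0)
  qed
  then obtain p where p: "p \<in> I" by (auto simp: I_def fun_eq_iff)
  have norm_prod: "(norm (x, u))\<^sup>2 = (norm x)\<^sup>2 + (norm u)\<^sup>2" for x u :: 'u
    by (simp add: norm_Pair)
  have a_affine: "a i (w + s *\<^sub>R (w' - w)) = (1 - s) * a i w + s * a i w'" for i w w' s
    by (cases i; cases w; cases w') (simp add: a_def inner_simps algebra_simps)
  obtain w t where w: "w \<in> V \<times> V" "\<And>i. i \<in> I \<Longrightarrow> F i w \<le> t"
    and min: "\<And>w' t'. w' \<in> V \<times> V \<Longrightarrow> (\<And>i. i \<in> I \<Longrightarrow> F i w' \<le> t') \<Longrightarrow> t \<le> t'"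
  proof (rule uniformly_convex_minimizer
      [of "V \<times> V" I F "1/8" p "inner (fst p) (snd p) + (norm p)\<^sup>2 / 2" 0])
    show "closed (V \<times> V)" by (intro closed_Times V)
    show "(1/2) *\<^sub>R (w + w') \<in> V \<times> V" if "w \<in> V \<times> V" "w' \<in> V \<times> V" for w w'
      using that V(1) by (auto simp: subspace_add subspace_scale)
    show "continuous_on (V \<times> V) (F i)" for i
      unfolding F_def a_def case_prod_beta by (intro continuous_intros) auto
    show "F i ((1/2) *\<^sub>R (w + w')) + 1/8 * (norm (w - w'))\<^sup>2 \<le> t"
      if "F i w \<le> t" "F i w' \<le> t" for i w w' t
    proof -
      have "(1/2) *\<^sub>R (w + w') = w + (1/2) *\<^sub>R (w' - w)"
        by (cases w; cases w') (simp add: algebra_simps flip: scaleR_add_left)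
      then have "a i ((1/2) *\<^sub>R (w + w')) = 1/2 * a i w + 1/2 * a i w'"
        using a_affine[of i w "1/2" w'] by simp
      then have eq: "F i ((1/2) *\<^sub>R (w + w')) = 1/2 * F i w + 1/2 * F i w' - 1/8 * (norm (w - w'))\<^sup>2"
        unfolding F_def norm_midpoint by (simp add: field_simps)
      show ?thesis unfolding eq using that by linarith
    qed
    show "p \<in> V \<times> V" using p AD(1) by (auto simp: I_def)
    show "F i p \<le> inner (fst p) (snd p) + (norm p)\<^sup>2 / 2" if "i \<in> I" for i
      using a_self[OF that p] by (simp add: F_def)
    show "0 \<le> t" if "w \<in> V \<times> V" "\<And>i. i \<in> I \<Longrightarrow> F i w \<le> t" for w t
    proof -
      obtain x u where w: "w = (x, u)" by (cases w)
      have "inner x u \<le> t - (norm w)\<^sup>2 / 2"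
        by (rule fitz) (use that in \<open>auto simp: F_def w algebra_simps\<close>)
      \<comment> \<open>\<open>inner x u + |x|^2 / 2 + |u|^2 / 2\<close> is half of this square, so
        no level is negative.\<close>
      moreover have "0 \<le> (norm (x + u))\<^sup>2" by simp
      ultimately show ?thesis
        by (simp add: w norm_prod power2_norm_eq_inner inner_simps inner_commute field_simps)
    qed
  qed (auto simp: F_def)
  obtain x0 u0 where w_eq: "w = (x0, u0)" by (cases w)
  have x0: "x0 \<in> V" "u0 \<in> V" using w(1) by (auto simp: w_eq)
  have "inner x0 u0 \<le> t - (norm w)\<^sup>2 / 2"
    by (rule fitz) (use w in \<open>auto simp: F_def w_eq algebra_simps\<close>)
  \<comment> \<open>Moves from the minimiser towards the graph point \<open>(y, v)\<close>. Each
    \<open>a i\<close> is affine, so on the segment it is at most the convex combination of its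
    bounds at the two ends; comparing the terms of first order in \<open>s\<close> gives the
    claim.\<close>
  moreover have opt: "t - (norm w)\<^sup>2 / 2 \<le> inner y v + inner w ((y, v) - w)" if "v \<in> A y" for y v
  proof -
    define q where "q = (y, v) - w"
    have "0 \<le> inner y v + inner w q - (t - (norm w)\<^sup>2 / 2)"
    proof (rule linear_term_nonneg)
      fix s :: real assume s: "0 < s" "s \<le> 1"
      have "t \<le> (1 - s) * (t - (norm w)\<^sup>2 / 2) + s * inner y v + (norm (w + s *\<^sub>R q))\<^sup>2 / 2"
      proof (rule min)
        show "w + s *\<^sub>R q \<in> V \<times> V"
          using w(1) AD(1)[OF that] V(1)
          by (auto simp: q_def w_eq subspace_add subspace_scale subspace_diff)
        fix i assume i: "i \<in> I"
        have "a i w \<le> t - (norm w)\<^sup>2 / 2" using w(2)[OF i] by (simp add: F_def)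
        moreover have "a i (y, v) \<le> inner y v" using a_self[OF i, of "(y, v)"] that by (simp add: I_def)
        ultimately have "a i (w + s *\<^sub>R q) \<le> (1 - s) * (t - (norm w)\<^sup>2 / 2) + s * inner y v"
          unfolding q_def a_affine using s by (intro add_mono mult_left_mono) auto
        then show "F i (w + s *\<^sub>R q)
            \<le> (1 - s) * (t - (norm w)\<^sup>2 / 2) + s * inner y v + (norm (w + s *\<^sub>R q))\<^sup>2 / 2"
          by (simp add: F_def)
      qed
      then show "0 \<le> s * (inner y v + inner w q - (t - (norm w)\<^sup>2 / 2)) + s\<^sup>2 * ((norm q)\<^sup>2 / 2)"
        unfolding norm_add_scaleR_sq by (simp add: field_simps)
    qed
    then show ?thesis by (simp add: q_def)
  qed
  ultimately have "inner x0 u0 \<le> inner y v + inner w ((y, v) - w)" if "v \<in> A y" for y v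
    using that by (meson order_trans)
  \<comment> \<open>Adding \<open>inner x0 u0 + |x0|^2 + |u0|^2\<close> to both sides completes the
    square on the left and the product on the right.\<close>
  then have rel: "(norm (x0 + u0))\<^sup>2 \<le> inner (- u0 - y) (- x0 - v)" if "v \<in> A y" for y v
    using that by (fastforce simp: w_eq power2_norm_eq_inner inner_simps inner_commute)
  have mem: "- x0 \<in> A (- u0)"
  proof (rule AD(3); (intro allI ballI)?)
    fix y v assume "v \<in> A y"
    then show "0 \<le> inner (- u0 - y) (- x0 - v)" using rel[of v y] zero_le_power2 order_trans by blast
  qed (use x0 V(1) in \<open>auto simp: subspace_neg\<close>)
  \<comment> \<open>At the graph point \<open>(- u0, - x0)\<close> itself the right-hand side
    vanishes.\<close>
  from rel[OF mem] have "x0 + u0 = 0" by simp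
  then have "u0 = - x0" by (simp add: eq_neg_iff_add_eq_0 add.commute)
  with mem that show thesis by simp
qed

text \<open>The affine image \<open>\<gamma> A - y\<close> is again maximally monotone, and
  \<open>- x\<close> in its value at \<open>x\<close> says \<open>y = x + \<gamma> v\<close> for
  some \<open>v \<in> A x\<close>.\<close>

lemma minty:
  fixes V :: "'u::{real_inner,complete_space} set"
  assumes V: "subspace V" "closed V" and A: "maximally_monotone_on V A" and "\<gamma> > 0" and y: "y \<in> V"
  obtains x v where "v \<in> A x" "y = x + \<gamma> *\<^sub>R v"
proof -
  obtain x where "- x \<in> (\<lambda>v. \<gamma> *\<^sub>R v + - y) ` A x"
    using minty_zero[OF V maximally_monotone_on_affine_image[OF A V(1), of \<gamma> "- y"]] assms
    by (metis subspace_neg)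
  then obtain v where "v \<in> A x" "- x = \<gamma> *\<^sub>R v + - y" by blast
  moreover have "y - (x + \<gamma> *\<^sub>R v) = - x - (\<gamma> *\<^sub>R v + - y)" by simp
  ultimately have "y = x + \<gamma> *\<^sub>R v" by simp
  then show thesis using that \<open>v \<in> A x\<close> by blast
qed

section \<open>Resolvents with respect to a metric\<close>

lemma metric_onD:
  assumes "metric_on V G"
  shows "x \<in> V \<Longrightarrow> G x \<in> V" "x \<in> V \<Longrightarrow> y \<in> V \<Longrightarrow> G (x + y) = G x + G y"
    "x \<in> V \<Longrightarrow> G (r *\<^sub>R x) = r *\<^sub>R G x"
    "subspace V \<Longrightarrow> G 0 = 0"
    "subspace V \<Longrightarrow> x \<in> V \<Longrightarrow> y \<in> V \<Longrightarrow> G (x - y) = G x - G y"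
proof -
  have G: "\<forall>x\<in>V. G x \<in> V" "\<forall>x\<in>V. \<forall>y\<in>V. G (x + y) = G x + G y" "\<forall>r. \<forall>x\<in>V. G (r *\<^sub>R x) = r *\<^sub>R G x"
    using assms by (auto simp: metric_on_def bounded_linear_on_def)
  then show "x \<in> V \<Longrightarrow> G x \<in> V" "x \<in> V \<Longrightarrow> y \<in> V \<Longrightarrow> G (x + y) = G x + G y"
    "x \<in> V \<Longrightarrow> G (r *\<^sub>R x) = r *\<^sub>R G x" by auto
  show "G 0 = 0" if "subspace V"
  proof -
    have "G (0 *\<^sub>R 0) = 0 *\<^sub>R G 0" using G(3) subspace_0[OF that] by blast
    then show ?thesis by simp
  qed
  show "G (x - y) = G x - G y" if "subspace V" "x \<in> V" "y \<in> V"
  proof -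
    have "G x = G (x - y + y)" by simp
    also have "\<dots> = G (x - y) + G y" using G(2) that subspace_diff by blast
    finally show ?thesis by simp
  qed
qed

text \<open>
  For small \<open>\<lambda> > 0\<close>, a solution of \<open>y \<in> G x + A x\<close> is a fixed point of the contraction
  \<open>x \<mapsto> (Id + \<lambda> A)\<^sup>-\<^sup>1 (x - \<lambda> (G x - y))\<close>.
\<close>

lemma resolvent_exists:
  fixes V :: "'u::{real_inner,complete_space} set"
  assumes V: "subspace V" "closed V" and A: "maximally_monotone_on V A"
    and G: "metric_on V G" and y: "y \<in> V"
  obtains x where "y - G x \<in> A x"
proof -
  note AD = maximally_monotone_onD[OF A] and GD = metric_onD[OF G]
  obtain c where c: "c > 0" "\<And>x. x \<in> V \<Longrightarrow> c * (norm x)\<^sup>2 \<le> inner (G x) x"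
    using G unfolding metric_on_def by blast
  obtain k where k: "\<And>x. x \<in> V \<Longrightarrow> norm (G x) \<le> k * norm x"
    using G unfolding metric_on_def bounded_linear_on_def by blast
  \<comment> \<open>The maximum with \<open>c\<close> keeps \<open>1 - c\<^sup>2 / K\<^sup>2\<close>
    nonnegative even if \<open>V = {0}\<close>, where \<open>k\<close> may be any number.\<close>
  define K where "K = max k c"
  have K: "K \<ge> c" "K > 0" using c by (auto simp: K_def)
  have K_bound: "norm (G x) \<le> K * norm x" if "x \<in> V" for x
    by (rule order_trans[OF k[OF that] mult_right_mono]) (simp_all add: K_def)
  \<comment> \<open>This step length minimises \<open>1 - 2 * l * c + l\<^sup>2 * K\<^sup>2\<close>,
    the bound for the squared contraction factor; the minimum is \<open>r\<^sup>2\<close>.\<close>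
  define l where "l = c / K\<^sup>2"
  have l: "l > 0" using c K by (simp add: l_def)
  define r where "r = sqrt (1 - c\<^sup>2 / K\<^sup>2)"
  have "c\<^sup>2 \<le> K\<^sup>2" using K(1) c(1) by (simp add: power_mono)
  then have ratio: "0 < c\<^sup>2 / K\<^sup>2" "c\<^sup>2 / K\<^sup>2 \<le> 1" using K c by (auto simp: field_simps)
  then have r: "0 \<le> r" "r < 1" by (auto simp: r_def)
  have step: "norm (x - l *\<^sub>R G x) \<le> r * norm x" if "x \<in> V" for x
  proof -
    have "(norm (x - l *\<^sub>R G x))\<^sup>2 = (norm x)\<^sup>2 - 2 * l * inner (G x) x + l\<^sup>2 * (norm (G x))\<^sup>2"
      using norm_add_scaleR_sq[of x "- l" "G x"] by (simp add: inner_commute)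
    also have "\<dots> \<le> (norm x)\<^sup>2 - 2 * l * (c * (norm x)\<^sup>2) + l\<^sup>2 * (K * norm x)\<^sup>2"
      using c(2)[OF that] K_bound[OF that] l
      by (intro add_mono diff_mono mult_left_mono power_mono) auto
    also have "\<dots> = (1 - c\<^sup>2 / K\<^sup>2) * (norm x)\<^sup>2"
      using K(2) by (simp add: l_def field_simps power2_eq_square)
    also have "\<dots> = (r * norm x)\<^sup>2" using ratio by (simp add: r_def power_mult_distrib)
    finally show ?thesis by (rule power2_le_imp_le) (use r in simp)
  qed
  have "\<forall>q\<in>V. \<exists>x. (1 / l) *\<^sub>R (q - x) \<in> A x"
  proof
    fix q assume "q \<in> V"
    then obtain x v where xv: "v \<in> A x" "q = x + l *\<^sub>R v" using minty[OF V A l] by blast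
    from xv(2) have "(1 / l) *\<^sub>R (q - x) = v" using l by simp
    with xv(1) show "\<exists>x. (1 / l) *\<^sub>R (q - x) \<in> A x" by auto
  qed
  from bchoice[OF this] obtain R where R1: "\<And>q. q \<in> V \<Longrightarrow> (1 / l) *\<^sub>R (q - R q) \<in> A (R q)"
    by blast
  define v where "v = (\<lambda>q. (1 / l) *\<^sub>R (q - R q))"
  have R: "\<And>q. q \<in> V \<Longrightarrow> v q \<in> A (R q)" "\<And>q. q \<in> V \<Longrightarrow> q = R q + l *\<^sub>R v q"
    using R1 l by (simp_all add: v_def)
  have nonexp: "dist (R q) (R q') \<le> dist q q'" if "q \<in> V" "q' \<in> V" for q q'
  proof -
    have eq: "q - q' = (R q - R q') + l *\<^sub>R (v q - v q')"
      using l by (simp add: v_def scaleR_diff_right)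
    have "(norm (R q - R q'))\<^sup>2 \<le> (norm (q - q'))\<^sup>2"
      unfolding eq norm_add_scaleR_sq using AD(2)[OF R(1)[OF that(1)] R(1)[OF that(2)]] l by simp
    then show ?thesis unfolding dist_norm by (rule power2_le_imp_le) simp
  qed
  define f where "f = (\<lambda>x. x - l *\<^sub>R (G x - y))"
  have fV: "f x \<in> V" if "x \<in> V" for x
    using that GD(1)[OF that] y V(1) by (simp add: f_def subspace_diff subspace_scale)
  have "\<exists>!x\<in>V. R (f x) = x"
  proof (rule Banach_fix[of V r])
    show "complete V" using V(2) by (simp add: complete_eq_closed)
    show "(\<lambda>x. R (f x)) ` V \<subseteq> V" using R(1) fV AD(1) by blast
    fix x x' assume x: "x \<in> V" "x' \<in> V"
    have "dist (R (f x)) (R (f x')) \<le> dist (f x) (f x')" using nonexp fV x by blast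
    also have "\<dots> = norm ((x - x') - l *\<^sub>R G (x - x'))"
      unfolding GD(5)[OF V(1) x] by (simp add: f_def dist_norm algebra_simps)
    also have "\<dots> \<le> r * dist x x'" using step[of "x - x'"] x V(1) by (simp add: subspace_diff dist_norm)
    finally show "dist (R (f x)) (R (f x')) \<le> r * dist x x'" .
  qed (use r y in auto)
  then obtain x where x: "x \<in> V" "R (f x) = x" by blast
  have "l *\<^sub>R v (f x) = l *\<^sub>R (y - G x)"
    using R(2)[OF fV[OF x(1)]] x(2) by (simp add: f_def algebra_simps)
  then have "v (f x) = y - G x" using l by simp
  then show thesis using R(1)[OF fV[OF x(1)]] x(2) that by metis
qed

lemma param_resolvent_eqI:
  assumes V: "subspace V" and A: "maximally_monotone_on V A" and G: "metric_on V G"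
    and x: "y - G x \<in> A x"
  shows "param_resolvent G A y = x"
proof -
  note AD = maximally_monotone_onD[OF A] and GD = metric_onD[OF G]
  obtain c where c: "c > 0" "\<And>x. x \<in> V \<Longrightarrow> c * (norm x)\<^sup>2 \<le> inner (G x) x"
    using G unfolding metric_on_def by blast
  have uniq: "x' = x" if "y - G x' \<in> A x'" for x'
  proof -
    have V': "x \<in> V" "x' \<in> V" using AD(1) x that by blast+
    have "0 \<le> inner (x - x') ((y - G x) - (y - G x'))" by (rule AD(2)[OF x that])
    also have "(y - G x) - (y - G x') = - G (x - x')" using GD(5)[OF V V'] by simp
    finally have "inner (G (x - x')) (x - x') \<le> 0" by (simp add: inner_commute)
    then have "c * (norm (x - x'))\<^sup>2 \<le> 0"
      using c(2)[of "x - x'"] V' V by (simp add: subspace_diff)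
    then show ?thesis using c(1) by (simp add: mult_le_0_iff)
  qed
  have *: "y \<in> {G x'} + A x' \<longleftrightarrow> y - G x' \<in> A x'" for x'
    by (auto simp: set_plus_def) (metis add_diff_cancel_left' add_diff_eq)
  have "inverse_op (\<lambda>x. {G x} + A x) y = {x}"
    unfolding inverse_op_def * using x uniq by blast
  then show ?thesis by (simp add: param_resolvent_def)
qed

lemma param_resolvent_iff:
  fixes V :: "'u::{real_inner,complete_space} set"
  assumes V: "subspace V" "closed V" and A: "maximally_monotone_on V A"
    and G: "metric_on V G" and y: "y \<in> V"
  shows "x = param_resolvent G A y \<longleftrightarrow> y - G x \<in> A x"
  using param_resolvent_eqI[OF V(1) A G] resolvent_exists[OF V A G y] by metis

lemma param_resolvent_in:
  fixes V :: "'u::{real_inner,complete_space} set"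
  assumes V: "subspace V" "closed V" and A: "maximally_monotone_on V A"
    and G: "metric_on V G" and y: "y \<in> V"
  shows "param_resolvent G A y \<in> V"
  using param_resolvent_iff[OF assms] maximally_monotone_onD(1)[OF A] by blast

section \<open>Sums of metrics, affine operators and normal cones of points\<close>

lemma metric_on_bounds:
  assumes "metric_on V G"
  obtains c k where "c > 0" "\<And>x. x \<in> V \<Longrightarrow> c * (norm x)\<^sup>2 \<le> inner (G x) x"
    "\<And>x. x \<in> V \<Longrightarrow> norm (G x) \<le> k * norm x"
proof -
  obtain c where "c > 0" "\<And>x. x \<in> V \<Longrightarrow> c * (norm x)\<^sup>2 \<le> inner (G x) x"
    using assms unfolding metric_on_def by blast
  moreover obtain k where "\<And>x. x \<in> V \<Longrightarrow> norm (G x) \<le> k * norm x"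
    using assms unfolding metric_on_def bounded_linear_on_def by blast
  ultimately show thesis using that by blast
qed

lemma metric_onI:
  assumes "\<And>x. x \<in> V \<Longrightarrow> G x \<in> V"
    and "\<And>x y. x \<in> V \<Longrightarrow> y \<in> V \<Longrightarrow> G (x + y) = G x + G y"
    and "\<And>r x. x \<in> V \<Longrightarrow> G (r *\<^sub>R x) = r *\<^sub>R G x"
    and "\<And>x. x \<in> V \<Longrightarrow> norm (G x) \<le> k * norm x"
    and "\<And>x y. x \<in> V \<Longrightarrow> y \<in> V \<Longrightarrow> inner (G x) y = inner x (G y)"
    and "c > 0" "\<And>x. x \<in> V \<Longrightarrow> c * (norm x)\<^sup>2 \<le> inner (G x) x"
  shows "metric_on V G"
  unfolding metric_on_def bounded_linear_on_def
  using assms by (intro conjI ballI allI exI[of _ k] exI[of _ c]) auto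

lemma metric_on_add:
  assumes V: "subspace V" and F: "metric_on V F" and G: "metric_on V G"
  shows "metric_on V (\<lambda>x. F x + G x)"
proof -
  obtain c k where c: "c > 0" "\<And>x. x \<in> V \<Longrightarrow> c * (norm x)\<^sup>2 \<le> inner (F x) x"
    and k: "\<And>x. x \<in> V \<Longrightarrow> norm (F x) \<le> k * norm x"
    using metric_on_bounds[OF F] by blast
  obtain d l where d: "d > 0" "\<And>x. x \<in> V \<Longrightarrow> d * (norm x)\<^sup>2 \<le> inner (G x) x"
    and l: "\<And>x. x \<in> V \<Longrightarrow> norm (G x) \<le> l * norm x"
    using metric_on_bounds[OF G] by blast
  note D = metric_onD[OF F] metric_onD[OF G]
  show ?thesis
  proof (rule metric_onI[of _ _ "k + l" "c + d"])
    show "norm (F x + G x) \<le> (k + l) * norm x" if "x \<in> V" for x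
      using k[OF that] l[OF that] norm_triangle_ineq[of "F x" "G x"] by (simp add: distrib_right)
    show "(c + d) * (norm x)\<^sup>2 \<le> inner (F x + G x) x" if "x \<in> V" for x
      using c(2)[OF that] d(2)[OF that] by (simp add: distrib_right inner_add_left)
    show "inner (F x + G x) y = inner x (F y + G y)" if "x \<in> V" "y \<in> V" for x y
      using F G that by (simp add: metric_on_def inner_add_left inner_add_right)
    show "c + d > 0" using c(1) d(1) by simp
    show "F x + G x \<in> V" if "x \<in> V" for x using D(1,6)[OF that] V by (simp add: subspace_add)
    show "F (x + y) + G (x + y) = F x + G x + (F y + G y)" if "x \<in> V" "y \<in> V" for x y
      using D(2,7)[OF that] by simp
    show "F (r *\<^sub>R x) + G (r *\<^sub>R x) = r *\<^sub>R (F x + G x)" if "x \<in> V" for r x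
      using D(3,8)[OF that] by (simp add: scaleR_add_right)
  qed
qed

lemma metric_on_scaleR:
  assumes "subspace V" "c > 0"
  shows "metric_on V (\<lambda>x. c *\<^sub>R x)"
  using assms
  by (intro metric_onI[of _ _ c c])
    (auto simp: subspace_scale scaleR_add_right power2_norm_eq_inner)

text \<open>Serves twice: \<open>c = 0\<close>, \<open>w = 0\<close> gives the zero operator, whose
  resolvents invert metrics, and \<open>c = 1\<close> gives the operators \<open>x + w i\<close> of
  the primal bound.\<close>

lemma maximally_monotone_on_affine:
  assumes V: "subspace V" and c: "c \<ge> 0" and w: "w \<in> V"
  shows "maximally_monotone_on V (\<lambda>x. if x \<in> V then {c *\<^sub>R x + w} else {})"
proof (rule maximally_monotone_onI)
  let ?A = "\<lambda>x. if x \<in> V then {c *\<^sub>R x + w} else {}"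
  show "x \<in> V \<and> v \<in> V" if "v \<in> ?A x" for x v
    using that V w by (auto simp: subspace_add subspace_scale split: if_splits)
  show "0 \<le> inner (x - y) (v - v')" if "v \<in> ?A x" "v' \<in> ?A y" for x y v v'
  proof -
    have "v - v' = c *\<^sub>R (x - y)" using that by (auto simp: scaleR_diff_right split: if_splits)
    then show ?thesis using c by simp
  qed
  show "v \<in> ?A x" if x: "x \<in> V" and v: "v \<in> V"
    and rel: "\<forall>y. \<forall>u\<in>?A y. 0 \<le> inner (x - y) (v - u)" for x v
  proof -
    define q where "q = v - (c *\<^sub>R x + w)"
    \<comment> \<open>Any \<open>t > 0\<close> with \<open>c * t < 1\<close> does: the defect
      \<open>q\<close> is tested at \<open>x + t q\<close>, where the inner product is
      \<open>- t (1 - c t) |q|^2\<close>.\<close>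
    define t where "t = 1 / (1 + c)"
    have t: "t > 0" "1 - c * t > 0" using c by (auto simp: t_def field_simps)
    have "x + t *\<^sub>R q \<in> V" using x v V w by (simp add: q_def subspace_add subspace_diff subspace_scale)
    then have "0 \<le> inner (x - (x + t *\<^sub>R q)) (v - (c *\<^sub>R (x + t *\<^sub>R q) + w))"
      using rel[rule_format, of "c *\<^sub>R (x + t *\<^sub>R q) + w" "x + t *\<^sub>R q"] by simp
    also have "v - (c *\<^sub>R (x + t *\<^sub>R q) + w) = (1 - c * t) *\<^sub>R q"
      by (simp add: q_def algebra_simps)
    also have "inner (x - (x + t *\<^sub>R q)) \<dots> = - (t * (1 - c * t) * inner q q)" by simp
    finally have "t * (1 - c * t) * inner q q \<le> 0" by simp
    moreover have "t * (1 - c * t) > 0" using t by simp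
    ultimately have "inner q q \<le> 0" by (meson mult_pos_pos not_le)
    then have "q = 0" by (meson inner_gt_zero_iff not_less)
    then show ?thesis using x by (simp add: q_def)
  qed
qed

text \<open>The normal cone operator of \<open>{u}\<close>.\<close>

definition point_cone :: "'u set \<Rightarrow> 'u \<Rightarrow> 'u \<Rightarrow> 'u set" where
  "point_cone V u x = (if x = u then V else {})"

lemma maximally_monotone_on_point_cone:
  assumes V: "subspace V" and u: "u \<in> V"
  shows "maximally_monotone_on V (point_cone V u)"
proof (rule maximally_monotone_onI)
  show "v \<in> point_cone V u x" if x: "x \<in> V" and v: "v \<in> V"
    and rel: "\<forall>y. \<forall>w\<in>point_cone V u y. 0 \<le> inner (x - y) (v - w)" for x v
  proof -
    \<comment> \<open>The normal cone at \<open>u\<close> is all of \<open>V\<close>, so this vector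
      is available; the inequality it is tested in becomes
      \<open>0 \<le> - |x - u|^2\<close>.\<close>
    have "v + (x - u) \<in> point_cone V u u"
      using x v u V by (simp add: point_cone_def subspace_add subspace_diff)
    then have "0 \<le> inner (x - u) (v - (v + (x - u)))" using rel by blast
    also have "inner (x - u) (v - (v + (x - u))) = - inner (x - u) (x - u)"
      by (simp add: inner_diff_right inner_add_right)
    finally have "inner (x - u) (x - u) \<le> 0" by simp
    then have "x - u = 0" by (meson inner_gt_zero_iff not_less)
    then have "x = u" by simp
    then show ?thesis using v by (simp add: point_cone_def)
  qed
qed (use u in \<open>auto simp: point_cone_def split: if_splits\<close>)

text \<open>The symmetric Lax-Milgram theorem, read off from the resolvent of the zero
  operator.\<close>

lemma metric_on_surj:
  fixes V :: "'u::{real_inner,complete_space} set"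
  assumes V: "subspace V" "closed V" and G: "metric_on V G" and y: "y \<in> V"
  obtains x where "x \<in> V" "G x = y"
proof -
  have "maximally_monotone_on V (\<lambda>x. if x \<in> V then {0 *\<^sub>R x + 0} else {})"
    using V(1) by (intro maximally_monotone_on_affine) (auto simp: subspace_0)
  from resolvent_exists[OF V this G y] obtain x
    where "y - G x \<in> (if x \<in> V then {0 *\<^sub>R x + 0} else {})" .
  then show thesis using that[of x] by (simp split: if_splits)
qed

lemma metric_on_inj:
  assumes V: "subspace V" and G: "metric_on V G"
  shows "inj_on G V"
proof (rule inj_onI)
  fix x y assume xy: "x \<in> V" "y \<in> V" "G x = G y"
  obtain c where c: "c > 0" "\<And>x. x \<in> V \<Longrightarrow> c * (norm x)\<^sup>2 \<le> inner (G x) x"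
    using G unfolding metric_on_def by blast
  have "c * (norm (x - y))\<^sup>2 \<le> inner (G (x - y)) (x - y)"
    by (rule c(2)[OF subspace_diff[OF V xy(1,2)]])
  moreover have "G (x - y) = 0" unfolding metric_onD(5)[OF G V xy(1,2)] xy(3) by simp
  ultimately have "c * (norm (x - y))\<^sup>2 \<le> 0" by simp
  then show "x = y" using c(1) by (simp add: mult_le_0_iff)
qed

section \<open>Problem instances\<close>

lemma space_of_subspace:
  assumes "hilbert_spaces m V" "\<tau> \<in> insert SortH (SortK ` {1..m})"
  shows "subspace (space_of V \<tau>)" "closed (space_of V \<tau>)"
  using assms by (auto simp: hilbert_spaces_def)

lemma metric_family_add:
  assumes "metric_family m \<tau> F" "metric_family m \<tau> G" "\<tau> \<in> insert SortH (SortK ` {1..m})"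
  shows "metric_family m \<tau> (\<lambda>V x. F V x + G V x)"
  using assms space_of_subspace(1) unfolding metric_family_def by (blast intro: metric_on_add)

lemma metric_family_sum:
  assumes "finite S" "S \<noteq> {}" "\<tau> \<in> insert SortH (SortK ` {1..m})"
    and "\<And>c. c \<in> S \<Longrightarrow> metric_family m \<tau> (F c)"
  shows "metric_family m \<tau> (\<lambda>V x. \<Sum>c\<in>S. F c V x)"
  using assms(1,2,4)
proof (induction S rule: finite_ne_induct)
  case (insert c S)
  then show ?case using metric_family_add[of m \<tau> "F c"] assms(3) by simp
qed simp

locale problem =
  fixes n m p :: nat and P :: "'u::{real_inner,complete_space} problem"
  assumes inst: "problem_instance n m p P"
begin

lemma hilbert: "hilbert_spaces m (spaces_of P)"
  using inst by (simp add: problem_instance_def)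

lemma H: "subspace (spH P)" "closed (spH P)"
  using hilbert by (auto simp: hilbert_spaces_def spaces_of_def)

lemma K:
  assumes "j \<in> {1..m}"
  shows "subspace (spK P j)" "closed (spK P j)"
  using hilbert assms by (auto simp: hilbert_spaces_def spaces_of_def)

lemma opA_max: "i < n \<Longrightarrow> maximally_monotone_on (spH P) (opA P i)"
  using inst by (simp add: problem_instance_def)

lemma opB_max: "j \<in> {1..m} \<Longrightarrow> maximally_monotone_on (spK P j) (opB P j)"
  using inst by (simp add: problem_instance_def)

lemma vec_a_in: "vec_a P \<in> spH P"
  using inst by (simp add: problem_instance_def)

lemma vec_b_in: "j \<in> {1..m} \<Longrightarrow> vec_b P j \<in> spK P j"
  using inst by (simp add: problem_instance_def)

lemma opL_in: "j \<in> {1..m} \<Longrightarrow> x \<in> spH P \<Longrightarrow> opL P j x \<in> spK P j"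
  using inst by (simp add: problem_instance_def bounded_linear_on_def)

lemma opC_in: "l \<in> {1..p} \<Longrightarrow> x \<in> spH P \<Longrightarrow> opC P l x \<in> spH P"
  using inst by (simp add: problem_instance_def cocoercive_on_def)

lemma Ladj_in:
  assumes "j \<in> {1..m}"
  shows "Ladj P j y \<in> spH P"
  unfolding Ladj_def using inst assms H
  by (intro adjoint_on_works(1)[of _ "spK P j"]) (auto simp: problem_instance_def)

lemma Ladj_zero:
  assumes "j \<in> {1..m}"
  shows "Ladj P j 0 = 0"
proof -
  have "bounded_linear_on (spH P) (spK P j) (opL P j)"
    using inst assms by (simp add: problem_instance_def)
  from adjoint_on_works(2)[OF H this Ladj_in[OF assms, of 0], of 0]
  show ?thesis by (simp add: Ladj_def)
qed

lemma metric_H: "metric_family m SortH G \<Longrightarrow> metric_on (spH P) (G (spaces_of P))"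
  using hilbert unfolding metric_family_def by (auto simp: spaces_of_def)

lemma metric_K: "metric_family m (SortK j) G \<Longrightarrow> metric_on (spK P j) (G (spaces_of P))"
  using hilbert unfolding metric_family_def by (auto simp: spaces_of_def)

text \<open>Existence: \<open>y \<in> D x\<close> means that \<open>y - \<nu> x\<close> belongs to
  the strong part of \<open>D\<close> at \<open>x\<close>, so \<open>x\<close> is a resolvent of
  that part with metric \<open>\<nu> Id\<close>. Strong monotonicity gives uniqueness.\<close>

lemma inverse_opD:
  assumes j: "j \<in> {1..m}" and y: "y \<in> spK P j"
  shows "inverse_op (opD P j) y = {Dinv P j y}"
proof -
  have D: "maximally_monotone_on (spK P j) (opD P j)" "nu P j > 0"
    "strongly_monotone_op (nu P j) (opD P j)"
    using inst j by (auto simp: problem_instance_def)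
  obtain x where x: "y - nu P j *\<^sub>R x \<in> (\<lambda>v. v - nu P j *\<^sub>R x) ` opD P j x"
    using resolvent_exists[OF K[OF j] maximally_monotone_on_strong_part[OF D(1) K(1)[OF j] D(3)]
        metric_on_scaleR[OF K(1)[OF j] D(2)] y] D(2) by auto
  have yx: "y \<in> opD P j x"
  proof -
    from x obtain v where "v \<in> opD P j x" "y - nu P j *\<^sub>R x = v - nu P j *\<^sub>R x" by blast
    then show ?thesis by simp
  qed
  have "x' = x" if "y \<in> opD P j x'" for x'
  proof -
    have "nu P j * (norm (x' - x))\<^sup>2 \<le> inner (x' - x) (y - y)"
      using D(3) that yx unfolding strongly_monotone_op_def by blast
    then show ?thesis using D(2) by (simp add: mult_le_0_iff)
  qed
  then have "inverse_op (opD P j) y = {x}" using yx unfolding inverse_op_def by blast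
  then show ?thesis by (simp add: Dinv_def)
qed

lemma Dinv_in:
  assumes j: "j \<in> {1..m}" and y: "y \<in> spK P j"
  shows "Dinv P j y \<in> spK P j"
proof -
  have "y \<in> opD P j (Dinv P j y)" using inverse_opD[OF assms] by (auto simp: inverse_op_def)
  moreover have "maximally_monotone_on (spK P j) (opD P j)"
    using inst j by (auto simp: problem_instance_def)
  ultimately show ?thesis using maximally_monotone_onD(1) by blast
qed

lemma mem_parallel_sum:
  assumes j: "j \<in> {1..m}"
  shows "s \<in> parallel_sum (opB P j) (opD P j) w \<longleftrightarrow>
     s \<in> spK P j \<and> w - Dinv P j s \<in> inverse_op (opB P j) s"
proof -
  have ps: "s \<in> parallel_sum (opB P j) (opD P j) w \<longleftrightarrow>
      (\<exists>x\<in>inverse_op (opB P j) s. \<exists>d\<in>inverse_op (opD P j) s. w = x + d)"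
    unfolding parallel_sum_def set_plus_def by (subst inverse_op_def) blast
  show ?thesis
  proof (cases "s \<in> spK P j")
    case True
    have eq: "w = x + d \<longleftrightarrow> x = w - d" for x d by (auto simp: algebra_simps)
    show ?thesis unfolding ps inverse_opD[OF j True] eq using True by simp
  next
    case False
    then have "inverse_op (opB P j) s = {}"
      using maximally_monotone_onD(1)[OF opB_max[OF j]] unfolding inverse_op_def by blast
    then show ?thesis unfolding ps using False by simp
  qed
qed

text \<open>Picks one element from every set in the inclusion. The selections
  \<open>\<alpha>\<close> and \<open>s\<close> are what a fixed point supplies and what a fixed
  point is rebuilt from.\<close>

lemma solves_iff:
  "solves n m p P u \<longleftrightarrow> u \<in> spH P \<and> (\<exists>\<alpha> s. (\<forall>i<n. \<alpha> i \<in> opA P i u) \<and>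
     (\<forall>j\<in>{1..m}. s j \<in> spK P j \<and>
        opL P j u - vec_b P j - Dinv P j (s j) \<in> inverse_op (opB P j) (s j)) \<and>
     vec_a P = (\<Sum>i<n. \<alpha> i) + (\<Sum>j=1..m. Ladj P j (s j)) + (\<Sum>l=1..p. opC P l u))"
  (is "_ \<longleftrightarrow> _ \<and> ?R")
proof -
  define S where "S = (\<lambda>j. parallel_sum (opB P j) (opD P j) (opL P j u - vec_b P j))"
  have "vec_a P \<in> (\<Sum>i<n. opA P i u) + (\<Sum>j=1..m. Ladj P j ` S j) + {\<Sum>l=1..p. opC P l u}
    \<longleftrightarrow> (\<exists>\<alpha> t. (\<forall>i<n. \<alpha> i \<in> opA P i u) \<and> (\<forall>j\<in>{1..m}. t j \<in> Ladj P j ` S j) \<and>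
       vec_a P = sum \<alpha> {..<n} + sum t {1..m} + (\<Sum>l=1..p. opC P l u))"
    unfolding set_sum_alt[OF finite_lessThan] set_sum_alt[OF finite_atLeastAtMost] set_plus_def
    by blast
  also have "\<dots> \<longleftrightarrow> (\<exists>\<alpha> s. (\<forall>i<n. \<alpha> i \<in> opA P i u) \<and> (\<forall>j\<in>{1..m}. s j \<in> S j) \<and>
       vec_a P = sum \<alpha> {..<n} + (\<Sum>j=1..m. Ladj P j (s j)) + (\<Sum>l=1..p. opC P l u))"
    (is "?L \<longleftrightarrow> ?M")
  proof
    assume ?L
    then obtain \<alpha> t where at: "\<forall>i<n. \<alpha> i \<in> opA P i u" "\<forall>j\<in>{1..m}. t j \<in> Ladj P j ` S j"
       "vec_a P = sum \<alpha> {..<n} + sum t {1..m} + (\<Sum>l=1..p. opC P l u)" by blast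
    from at(2) have "\<forall>j\<in>{1..m}. \<exists>s. s \<in> S j \<and> t j = Ladj P j s" by blast
    from bchoice[OF this] obtain s where s: "\<forall>j\<in>{1..m}. s j \<in> S j \<and> t j = Ladj P j (s j)" by blast
    then have "sum t {1..m} = (\<Sum>j=1..m. Ladj P j (s j))" by (intro sum.cong) auto
    with at s show ?M by (intro exI[of _ \<alpha>] exI[of _ s]) auto
  next
    assume ?M
    then obtain \<alpha> s where "\<forall>i<n. \<alpha> i \<in> opA P i u" "\<forall>j\<in>{1..m}. s j \<in> S j"
       "vec_a P = sum \<alpha> {..<n} + (\<Sum>j=1..m. Ladj P j (s j)) + (\<Sum>l=1..p. opC P l u)" by blast
    then show ?L by (intro exI[of _ \<alpha>] exI[of _ "\<lambda>j. Ladj P j (s j)"]) auto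
  qed
  also have "\<dots> \<longleftrightarrow> ?R"
    unfolding S_def using mem_parallel_sum by (intro ex_cong1 conj_cong refl ball_cong) blast
  finally show ?thesis unfolding solves_def S_def by simp
qed

end

section \<open>Tree combinatorics\<close>

lemma rooted_tree_depth:
  assumes "rooted_tree n pa"
  obtains h :: "nat \<Rightarrow> nat" where "\<And>i. i \<in> {1..n-1} \<Longrightarrow> h (pa i) < h i"
proof
  define h where "h = (\<lambda>i. LEAST k. (pa ^^ k) i = 0)"
  fix i assume i: "i \<in> {1..n-1}"
  then obtain k where "(pa ^^ k) i = 0" using assms unfolding rooted_tree_def by blast
  then have h: "(pa ^^ h i) i = 0" unfolding h_def by (rule LeastI)
  then obtain l where l: "h i = Suc l" using i by (cases "h i") auto
  with h have "(pa ^^ l) (pa i) = 0" by (simp add: funpow_swap1)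
  then have "h (pa i) \<le> l" unfolding h_def by (rule Least_le)
  with l show "h (pa i) < h i" by simp
qed

lemma zero_mem_plus_singleton:
  fixes q :: "'a::ab_group_add"
  shows "0 \<in> X + {q} \<longleftrightarrow> - q \<in> X"
proof -
  have "0 = a + q \<longleftrightarrow> a = - q" for a by (auto simp: eq_neg_iff_add_eq_0)
  then show ?thesis by (simp add: set_plus_def)
qed

locale tree =
  fixes n m p :: nat and pa :: "nat \<Rightarrow> nat" and J Jc Q :: "nat \<Rightarrow> nat set"
    and M N :: "nat \<Rightarrow> 'u::{real_inner,complete_space} metric"
    and \<theta> \<zeta> :: "nat \<Rightarrow> real"
  assumes n: "n \<ge> 2"
    and tree: "tree_data n m p pa J Jc Q"
    and M: "\<And>i. i \<in> {1..n-1} \<Longrightarrow> metric_family m SortH (M i)"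
    and N: "\<And>j. j \<in> {1..m} \<Longrightarrow> metric_family m (SortK j) (N j)"
    and \<theta>: "\<And>i. i \<in> {1..n-1} \<Longrightarrow> \<theta> i \<noteq> 0"
    and \<zeta>: "\<And>j. j \<in> {1..m} \<Longrightarrow> \<zeta> j \<noteq> 0"
begin

definition depth :: "nat \<Rightarrow> nat" where
  "depth = (SOME h. \<forall>i\<in>{1..n-1}. h (pa i) < h i)"

lemma depth_pa: "i \<in> {1..n-1} \<Longrightarrow> depth (pa i) < depth i"
proof -
  have "\<exists>h :: nat \<Rightarrow> nat. \<forall>i\<in>{1..n-1}. h (pa i) < h i"
    using rooted_tree_depth[of n pa] tree unfolding tree_data_def by metis
  from someI_ex[OF this] show "i \<in> {1..n-1} \<Longrightarrow> depth (pa i) < depth i"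
    unfolding depth_def by blast
qed

lemma node_induct [consumes 1, case_names root node]:
  assumes "i < n" "R 0" "\<And>i. i \<in> {1..n-1} \<Longrightarrow> R (pa i) \<Longrightarrow> R i"
  shows "R i"
  using assms(1)
proof (induction "depth i" arbitrary: i rule: less_induct)
  case less
  show ?case
  proof (cases "i = 0")
    case False
    then have i: "i \<in> {1..n-1}" using less.prems by auto
    then have "pa i < n" using tree by (auto simp: tree_data_def rooted_tree_def)
    then show ?thesis using less.hyps depth_pa[OF i] assms(3)[OF i] by blast
  qed (use assms(2) in simp)
qed

lemma pa_less: "i \<in> {1..n-1} \<Longrightarrow> pa i < n"
  using tree by (auto simp: tree_data_def rooted_tree_def)

abbreviation "children \<equiv> ch n pa"

lemma children: "children i \<subseteq> {1..n-1}" "finite (children i)"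
  by (auto simp: ch_def)

text \<open>The disjunction \<open>i = 0 \<or> children 0 \<noteq> {}\<close> passes from a parent
  to its child, since a nonroot node whose parent is \<open>0\<close> is itself a child of the root;
  it is applied to node \<open>1\<close>, which exists by \<open>n \<ge> 2\<close>.\<close>

lemma root_children: "children 0 \<noteq> {}"
proof -
  have "1 < n" using n by simp
  then have "1 = (0::nat) \<or> children 0 \<noteq> {}"
  proof (induction rule: node_induct)
    case (node i)
    then show ?case by (cases "pa i = 0") (auto simp: ch_def)
  qed simp
  then show ?thesis by simp
qed

lemma J_sub: "i < n \<Longrightarrow> J i \<subseteq> {1..m}"
  using tree by (auto simp: tree_data_def indexed_partition_def)

lemma Q_sub: "i < n \<Longrightarrow> Q i \<subseteq> {1..p}"
  using tree by (auto simp: tree_data_def indexed_partition_def)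

lemma Q_root: "Q 0 = {}"
  using tree by (auto simp: tree_data_def)

lemma Jc_sub:
  assumes "i \<in> {1..n-1}"
  shows "Jc i \<subseteq> J (pa i)"
proof -
  have "i \<in> children (pa i)" using assms by (simp add: ch_def)
  then have "indexed_partition (children (pa i)) Jc (J (pa i))"
    using tree pa_less[OF assms] unfolding tree_data_def by blast
  then show ?thesis using \<open>i \<in> children (pa i)\<close> unfolding indexed_partition_def by blast
qed

lemma J_owner:
  assumes "j \<in> {1..m}"
  shows "\<exists>!i. i < n \<and> j \<in> J i"
proof -
  have J: "(\<Union>i\<in>{..<n}. J i) = {1..m}" "disjoint_family_on J {..<n}"
    using tree by (simp_all add: tree_data_def indexed_partition_def)
  then obtain i where i: "i < n" "j \<in> J i" using assms by (metis UN_iff lessThan_iff)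
  have "k = i" if "k < n \<and> j \<in> J k" for k
    using disjoint_family_onD[OF J(2), of k i] that i by auto
  with i show ?thesis by blast
qed

lemma sum_J:
  fixes f :: "nat \<Rightarrow> 'b::comm_monoid_add"
  shows "(\<Sum>i<n. \<Sum>j\<in>J i. f j) = (\<Sum>j=1..m. f j)"
proof -
  have "(\<Sum>j\<in>(\<Union>i\<in>{..<n}. J i). f j) = (\<Sum>i<n. \<Sum>j\<in>J i. f j)"
    using tree J_sub finite_subset[OF J_sub]
    by (intro sum.UNION_disjoint) (auto simp: tree_data_def indexed_partition_def disjoint_family_on_def)
  then show ?thesis using tree by (simp add: tree_data_def indexed_partition_def)
qed

lemma sum_Q:
  fixes f :: "nat \<Rightarrow> 'b::comm_monoid_add"
  shows "(\<Sum>i<n. \<Sum>l\<in>Q i. f l) = (\<Sum>l=1..p. f l)"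
proof -
  have "(\<Sum>l\<in>(\<Union>i\<in>{..<n}. Q i). f l) = (\<Sum>i<n. \<Sum>l\<in>Q i. f l)"
    using tree Q_sub finite_subset[OF Q_sub]
    by (intro sum.UNION_disjoint) (auto simp: tree_data_def indexed_partition_def disjoint_family_on_def)
  then show ?thesis using tree by (simp add: tree_data_def indexed_partition_def)
qed

lemma sum_children:
  fixes f :: "nat \<Rightarrow> 'b::comm_monoid_add"
  shows "(\<Sum>i<n. \<Sum>c\<in>children i. f c) = (\<Sum>c=1..n-1. f c)"
proof -
  have "(\<Union>i\<in>{..<n}. children i) = {1..n-1}" using pa_less by (auto simp: ch_def)
  moreover have "(\<Sum>c\<in>(\<Union>i\<in>{..<n}. children i). f c) = (\<Sum>i<n. \<Sum>c\<in>children i. f c)"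
    by (intro sum.UNION_disjoint) (auto simp: ch_def)
  ultimately show ?thesis by simp
qed

text \<open>Children are deeper than their parent and the depths of the finitely many nodes are
  bounded. This licenses recursion from the leaves to the root.\<close>

lemma wf_children: "wf {(c, i). c \<in> children i}"
proof (rule wf_subset[OF wf_measure[of "\<lambda>i. Max (depth ` {..<n}) - depth i"]])
  have "Max (depth ` {..<n}) - depth c < Max (depth ` {..<n}) - depth i" if "c \<in> children i" for c i
  proof -
    have "depth i < depth c" "c < n" using that depth_pa[of c] by (auto simp: ch_def)
    moreover have "depth c \<le> Max (depth ` {..<n})" using \<open>c < n\<close> by (intro Max_ge) auto
    ultimately show ?thesis by linarith
  qed
  then show "{(c, i). c \<in> children i} \<subseteq> Wellfounded.measure (\<lambda>i. Max (depth ` {..<n}) - depth i)" by auto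
qed

lemmas upward_induct = wf_induct_rule[OF wf_children, simplified]

lemma upward_recursion:
  fixes r :: "nat \<Rightarrow> 'b::ab_group_add"
  shows "\<exists>g. \<forall>i. g i = r i + (\<Sum>c\<in>children i. g c)"
  using wf_children
proof (rule dependent_wf_choice)
  show "(y = r i + sum f (children i)) = (y = r i + sum g (children i))"
    if "\<And>c. (c, i) \<in> {(c, i). c \<in> children i} \<Longrightarrow> f c = g c" for f g i y
    using that sum.cong[of "children i" "children i" f g] by simp
qed auto

text \<open>Summing the node inclusions over the tree, the metric terms \<open>g\<close> of the edges cancel.\<close>

lemma sum_nodes:
  fixes g :: "nat \<Rightarrow> 'b::ab_group_add"
  shows "(\<Sum>i<n. (if i = 0 then - a else - g i) + (\<Sum>c\<in>children i. g c) + (\<Sum>l\<in>Q i. e l) + (\<Sum>j\<in>J i. d j))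
    = (\<Sum>l=1..p. e l) + (\<Sum>j=1..m. d j) - a"
proof -
  have "{..<n} = insert 0 {1..n-1}" using n by auto
  then have "(\<Sum>i<n. if i = 0 then - a else - g i) = - a - (\<Sum>i=1..n-1. g i)"
    by (simp add: sum_negf)
  then show ?thesis unfolding sum.distrib sum_J sum_Q sum_children by simp
qed

subsection \<open>The sweep as a composition of resolvents\<close>

text \<open>The part of the inclusion of node \<open>i\<close> that is linear in \<open>u i\<close>,
  so that the inclusion becomes a resolvent equation in this metric.\<close>

definition node_metric :: "nat \<Rightarrow> 'u metric" where
  "node_metric i V x = (\<Sum>c\<in>children i. M c V x) + (if i = 0 then 0 else M i V x)"

definition tree_dual :: "'u problem \<Rightarrow> 'u point \<Rightarrow> nat \<Rightarrow> 'u \<Rightarrow> 'u" where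
  "tree_dual P x j v = param_resolvent (N j (spaces_of P)) (inverse_op (opB P j))
     (N j (spaces_of P) (snd x j) - Dinv P j (snd x j) + opL P j v - vec_b P j)"

text \<open>\<open>v\<close> stands for the value at the parent and is ignored at the root. It is
  the only input from the rest of the tree: the correction terms have \<open>j \<in> Jc i\<close>,
  which is part of \<open>J (pa i)\<close>, so their s-tilde is \<open>tree_dual\<close> at the same
  \<open>v\<close>.\<close>

definition node_rhs :: "'u problem \<Rightarrow> 'u point \<Rightarrow> nat \<Rightarrow> 'u \<Rightarrow> 'u" where
  "node_rhs P x i v = (\<Sum>c\<in>children i. M c (spaces_of P) (fst x c)) - (\<Sum>j\<in>J i. Ladj P j (snd x j))
     + (if i = 0 then vec_a P
        else M i (spaces_of P) (2 *\<^sub>R v - fst x i) - (\<Sum>l\<in>Q i. opC P l v)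
          - (\<Sum>j\<in>Jc i. Ladj P j (tree_dual P x j v - snd x j)))"

definition tree_node :: "'u problem \<Rightarrow> 'u point \<Rightarrow> nat \<Rightarrow> 'u \<Rightarrow> 'u" where
  "tree_node P x i v = param_resolvent (node_metric i (spaces_of P)) (opA P i) (node_rhs P x i v)"

lemma tree_node_root: "tree_node P x 0 v = tree_node P x 0 w"
  by (simp add: tree_node_def node_rhs_def)

definition node_values :: "'u problem \<Rightarrow> 'u point \<Rightarrow> (nat \<Rightarrow> 'u) \<Rightarrow> bool" where
  "node_values P x u \<longleftrightarrow> (\<forall>i<n. u i = tree_node P x i (u (pa i)))"

text \<open>The choice concerns only indices outside \<open>{..<n}\<close>; on the nodes the values
  are determined.\<close>

definition tree_u :: "'u problem \<Rightarrow> 'u point \<Rightarrow> nat \<Rightarrow> 'u" where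
  "tree_u P x = (SOME u. node_values P x u)"

definition tree_st :: "'u problem \<Rightarrow> 'u point \<Rightarrow> nat \<Rightarrow> 'u" where
  "tree_st P x j = tree_dual P x j (tree_u P x (THE i. i < n \<and> j \<in> J i))"

lemma node_values_tree_u: "node_values P x (tree_u P x)"
proof -
  let ?P = "\<lambda>u i r. (i = 0 \<longrightarrow> r = tree_node P x 0 0) \<and> (i \<in> {1..n-1} \<longrightarrow> r = tree_node P x i (u (pa i)))"
  have "\<exists>u. \<forall>i. ?P u i (u i)"
  proof (rule dependent_wf_choice[of "{(pa i, i) |i. i \<in> {1..n-1}}"])
    show "wf {(pa i, i) |i. i \<in> {1..n-1}}"
      by (rule wf_subset[OF wf_measure[of depth]]) (use depth_pa in auto)
  qed auto
  then obtain u where u: "\<And>i. ?P u i (u i)" by blast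
  have "u i = tree_node P x i (u (pa i))" if "i < n" for i
  proof (cases "i = 0")
    case True
    then show ?thesis using u[of 0] tree_node_root by metis
  next
    case False
    then have "i \<in> {1..n-1}" using that by auto
    then show ?thesis using u by blast
  qed
  then have "node_values P x u" by (simp add: node_values_def)
  then show ?thesis unfolding tree_u_def using someI[of "node_values P x" u] by simp
qed

lemma node_values_unique:
  assumes "node_values P x u" "node_values P x u'" "i < n"
  shows "u i = u' i"
  using assms(3)
proof (induction rule: node_induct)
  case root
  have "u 0 = tree_node P x 0 (u (pa 0))" "u' 0 = tree_node P x 0 (u' (pa 0))"
    using assms n unfolding node_values_def by auto
  then show ?case using tree_node_root by metis
next
  case (node i)
  then have "i < n" by auto
  then show ?case using assms node unfolding node_values_def by metis
qed

lemma tree_st_eq: "i < n \<Longrightarrow> j \<in> J i \<Longrightarrow> tree_st P x j = tree_dual P x j (tree_u P x i)"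
proof -
  assume i: "i < n" "j \<in> J i"
  then have "j \<in> {1..m}" using J_sub by blast
  from the1_equality[OF J_owner[OF this], of i] i show ?thesis by (simp add: tree_st_def)
qed

text \<open>An empty sum is not positive definite, so at least one summand must be present: the root
  has children, and every other node contributes its own \<open>M i\<close>.\<close>

lemma node_metric:
  assumes "i < n"
  shows "metric_family m SortH (node_metric i)"
proof (cases "i = 0")
  case True
  have "metric_family m SortH (\<lambda>V x. \<Sum>c\<in>children 0. M c V x)"
    by (rule metric_family_sum) (use root_children children M in \<open>blast+\<close>)
  moreover have "node_metric 0 = (\<lambda>V x. \<Sum>c\<in>children 0. M c V x)"
    by (simp add: node_metric_def fun_eq_iff)
  ultimately show ?thesis using True by simp
next
  case i: False
  then have Mi: "metric_family m SortH (M i)" using M assms by auto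
  have eq: "node_metric i = (\<lambda>V x. (\<Sum>c\<in>children i. M c V x) + M i V x)"
    using i by (simp add: node_metric_def fun_eq_iff)
  show ?thesis
  proof (cases "children i = {}")
    case True
    then show ?thesis using Mi by (simp add: eq)
  next
    case False
    have "metric_family m SortH (\<lambda>V x. \<Sum>c\<in>children i. M c V x)"
      by (rule metric_family_sum) (use False children M in \<open>blast+\<close>)
    then show ?thesis unfolding eq using Mi by (intro metric_family_add) auto
  qed
qed

end

section \<open>The sweep on one problem instance\<close>

locale tree_problem = tree n m p pa J Jc Q M N \<theta> \<zeta> + problem n m p P
  for n m p :: nat and pa :: "nat \<Rightarrow> nat" and J Jc Q :: "nat \<Rightarrow> nat set"
    and M N :: "nat \<Rightarrow> 'u::{real_inner,complete_space} metric"
    and \<theta> \<zeta> :: "nat \<Rightarrow> real" and P :: "'u problem"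
begin

abbreviation "MP i \<equiv> M i (spaces_of P)"
abbreviation "NP j \<equiv> N j (spaces_of P)"
abbreviation "X \<equiv> lifted_space (n - 1) m id P"

lemma MP: "i \<in> {1..n-1} \<Longrightarrow> metric_on (spH P) (MP i)"
  using M metric_H by blast

lemma NP: "j \<in> {1..m} \<Longrightarrow> metric_on (spK P j) (NP j)"
  using N metric_K by blast

lemmas H_mem = subspace_add[OF H(1)] subspace_diff[OF H(1)] subspace_scale[OF H(1)]
  subspace_sum[OF H(1)] subspace_0[OF H(1)] subspace_neg[OF H(1)]

lemma X_z: "x \<in> X \<Longrightarrow> i \<in> {1..n-1} \<Longrightarrow> fst x i \<in> spH P"
  by (auto simp: lifted_space_def)

lemma X_s: "x \<in> X \<Longrightarrow> j \<in> {1..m} \<Longrightarrow> snd x j \<in> spK P j"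
  by (auto simp: lifted_space_def PiE_iff)

lemma dual_arg_in:
  assumes "x \<in> X" "j \<in> {1..m}" "v \<in> spH P"
  shows "NP j (snd x j) - Dinv P j (snd x j) + opL P j v - vec_b P j \<in> spK P j"
proof -
  have "NP j (snd x j) \<in> spK P j" "Dinv P j (snd x j) \<in> spK P j" "opL P j v \<in> spK P j" "vec_b P j \<in> spK P j"
    using assms X_s metric_onD(1)[OF NP] Dinv_in opL_in vec_b_in by blast+
  then show ?thesis using K(1)[OF assms(2)] by (intro subspace_diff subspace_add)
qed

lemma tree_dual_in:
  assumes "x \<in> X" "j \<in> {1..m}" "v \<in> spH P"
  shows "tree_dual P x j v \<in> spK P j"
  unfolding tree_dual_def
  using param_resolvent_in[OF K[OF assms(2)] maximally_monotone_on_inverse_op[OF opB_max[OF assms(2)]]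
      NP[OF assms(2)] dual_arg_in[OF assms]] .

lemma tree_dual_iff:
  assumes x: "x \<in> X" and j: "j \<in> {1..m}" and v: "v \<in> spH P"
  shows "r = tree_dual P x j v \<longleftrightarrow>
    0 \<in> inverse_op (opB P j) r + {NP j (r - snd x j) + Dinv P j (snd x j) - opL P j v + vec_b P j}"
    (is "_ \<longleftrightarrow> ?R")
proof -
  let ?y = "NP j (snd x j) - Dinv P j (snd x j) + opL P j v - vec_b P j"
  have "r = tree_dual P x j v \<longleftrightarrow> ?y - NP j r \<in> inverse_op (opB P j) r"
    unfolding tree_dual_def
    using param_resolvent_iff[OF K[OF j] maximally_monotone_on_inverse_op[OF opB_max[OF j]]
      NP[OF j] dual_arg_in[OF assms]] .
  also have "\<dots> \<longleftrightarrow> ?R"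
  proof (cases "r \<in> spK P j")
    case True
    then have "NP j (r - snd x j) = NP j r - NP j (snd x j)"
      using metric_onD(5)[OF NP[OF j] K(1)[OF j]] X_s[OF x j] by blast
    then have "?y - NP j r = - (NP j (r - snd x j) + Dinv P j (snd x j) - opL P j v + vec_b P j)"
      by simp
    then show ?thesis unfolding zero_mem_plus_singleton by (simp only:)
  next
    case False
    then have "inverse_op (opB P j) r = {}"
      using maximally_monotone_onD(1)[OF opB_max[OF j]] unfolding inverse_op_def by blast
    then show ?thesis by simp
  qed
  finally show ?thesis .
qed

lemma node_rhs_in:
  assumes x: "x \<in> X" and i: "i < n" and v: "i = 0 \<or> v \<in> spH P"
  shows "node_rhs P x i v \<in> spH P"
proof -
  have c: "MP c (fst x c) \<in> spH P" if "c \<in> children i" for c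
    using that children(1) metric_onD(1)[OF MP X_z[OF x]] by blast
  have j: "Ladj P j y \<in> spH P" if "j \<in> J i" for j y
    using that J_sub[OF i] Ladj_in by blast
  have rest: "MP i (2 *\<^sub>R v - fst x i) - (\<Sum>l\<in>Q i. opC P l v)
      - (\<Sum>j\<in>Jc i. Ladj P j (tree_dual P x j v - snd x j)) \<in> spH P" if "i \<noteq> 0"
  proof -
    have i': "i \<in> {1..n-1}" using that i by auto
    have "Ladj P j y \<in> spH P" if "j \<in> Jc i" for j y
      using that Jc_sub[OF i'] J_sub[OF pa_less[OF i']] Ladj_in by blast
    moreover have "opC P l v \<in> spH P" if "l \<in> Q i" for l
      using that Q_sub[OF i] opC_in v \<open>i \<noteq> 0\<close> by blast
    moreover have "MP i (2 *\<^sub>R v - fst x i) \<in> spH P"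
      using metric_onD(1)[OF MP[OF i']] v \<open>i \<noteq> 0\<close> X_z[OF x i'] by (simp add: H_mem)
    ultimately show ?thesis by (intro H_mem) auto
  qed
  show ?thesis unfolding node_rhs_def using c j rest vec_a_in by (intro H_mem) auto
qed

lemma tree_node_in:
  assumes "x \<in> X" "i < n" "i = 0 \<or> v \<in> spH P"
  shows "tree_node P x i v \<in> spH P"
  unfolding tree_node_def
  by (rule param_resolvent_in[OF H opA_max metric_H[OF node_metric] node_rhs_in]) (use assms in auto)

lemma node_values_in:
  assumes "x \<in> X" "node_values P x u" "i < n"
  shows "u i \<in> spH P"
  using assms(3)
proof (induction rule: node_induct)
  case root
  have "u 0 = tree_node P x 0 (u (pa 0))" using assms n by (simp add: node_values_def)
  then show ?case using tree_node_in[OF assms(1)] n by auto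
next
  case (node i)
  then have "i < n" by auto
  moreover from this have "u i = tree_node P x i (u (pa i))" using assms by (simp add: node_values_def)
  ultimately show ?case using tree_node_in[OF assms(1)] node by auto
qed

text \<open>The single-valued part of the inclusion of node \<open>i\<close>, with the root and the
  other nodes in one formula; \<open>v\<close> is the value at the parent and \<open>r\<close> the
  value at the node itself.\<close>

definition node_residual :: "'u point \<Rightarrow> (nat \<Rightarrow> 'u) \<Rightarrow> nat \<Rightarrow> 'u \<Rightarrow> 'u \<Rightarrow> 'u" where
  "node_residual x st i v r = (\<Sum>c\<in>children i. MP c (r - fst x c)) + (\<Sum>j\<in>J i. Ladj P j (snd x j))
     + (if i = 0 then - vec_a P
        else MP i (r + fst x i - 2 *\<^sub>R v) + (\<Sum>l\<in>Q i. opC P l v)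
          + (\<Sum>j\<in>Jc i. Ladj P j (st j - snd x j)))"

lemma tree_sweep_residual:
  "tree_sweep n pa J Jc Q M N P x u st \<longleftrightarrow>
     (\<forall>i<n. 0 \<in> opA P i (u i) + {node_residual x st i (u (pa i)) (u i)}) \<and>
     (\<forall>i<n. \<forall>j\<in>J i. 0 \<in> inverse_op (opB P j) (st j)
        + {NP j (st j - snd x j) + Dinv P j (snd x j) - opL P j (u i) + vec_b P j})"
proof -
  have all: "(\<forall>i<n. R i) \<longleftrightarrow> R 0 \<and> (\<forall>i\<in>{1..n-1}. R i)" for R
  proof -
    have "{..<n} = insert 0 {1..n-1}" using n by auto
    then show ?thesis by (metis insert_iff lessThan_iff)
  qed
  show ?thesis
    unfolding all[of "\<lambda>i. 0 \<in> opA P i (u i) + {node_residual x st i (u (pa i)) (u i)}"]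
    by (cases x) (auto simp: tree_sweep_def node_residual_def Let_def algebra_simps)
qed

lemma tree_node_iff:
  assumes x: "x \<in> X" and i: "i < n" and v: "i = 0 \<or> v \<in> spH P"
    and st: "i \<noteq> 0 \<Longrightarrow> \<forall>j\<in>Jc i. st j = tree_dual P x j v"
  shows "r = tree_node P x i v \<longleftrightarrow> 0 \<in> opA P i r + {node_residual x st i v r}"
proof -
  let ?y = "node_rhs P x i v" and ?G = "node_metric i (spaces_of P)"
  have "r = tree_node P x i v \<longleftrightarrow> ?y - ?G r \<in> opA P i r"
    unfolding tree_node_def
    by (rule param_resolvent_iff[OF H opA_max[OF i] metric_H[OF node_metric[OF i]]
          node_rhs_in[OF x i v]])
  also have "\<dots> \<longleftrightarrow> 0 \<in> opA P i r + {node_residual x st i v r}"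
  proof (cases "r \<in> spH P")
    case r: True
    have "(\<Sum>c\<in>children i. MP c (r - fst x c)) = (\<Sum>c\<in>children i. MP c r - MP c (fst x c))"
    proof (rule sum.cong)
      fix c assume "c \<in> children i"
      then have "c \<in> {1..n-1}" using children(1) by blast
      then show "MP c (r - fst x c) = MP c r - MP c (fst x c)"
        using metric_onD(5)[OF MP H(1) r X_z[OF x]] by blast
    qed simp
    then have c: "(\<Sum>c\<in>children i. MP c (r - fst x c))
        = (\<Sum>c\<in>children i. MP c r) - (\<Sum>c\<in>children i. MP c (fst x c))"
      by (simp add: sum_subtractf)
    have "MP i (r + fst x i - 2 *\<^sub>R v) = MP i r - MP i (2 *\<^sub>R v - fst x i)" if "i \<noteq> 0"
    proof -
      have i': "i \<in> {1..n-1}" using that i by auto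
      have "MP i (r - (2 *\<^sub>R v - fst x i)) = MP i r - MP i (2 *\<^sub>R v - fst x i)"
        using v that X_z[OF x i'] by (intro metric_onD(5)[OF MP[OF i'] H(1) r] H_mem) auto
      then show ?thesis by (simp add: algebra_simps)
    qed
    moreover have "(\<Sum>j\<in>Jc i. Ladj P j (st j - snd x j))
        = (\<Sum>j\<in>Jc i. Ladj P j (tree_dual P x j v - snd x j))" if "i \<noteq> 0"
      using st[OF that] by (intro sum.cong) auto
    ultimately have "?y - ?G r = - node_residual x st i v r"
      by (simp add: node_rhs_def node_metric_def node_residual_def c)
    then show ?thesis unfolding zero_mem_plus_singleton by simp
  next
    case False
    then have "opA P i r = {}" using maximally_monotone_onD(1)[OF opA_max[OF i]] by blast
    then show ?thesis by simp
  qed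
  finally show ?thesis .
qed

text \<open>Inclusions and resolvent equations agree once all \<open>u i\<close> lie in
  \<open>H\<close>. On the left this holds because the operators have empty values outside
  \<open>H\<close>, on the right because resolvents map into \<open>H\<close>.\<close>

lemma tree_sweep_iff:
  assumes x: "x \<in> X"
  shows "tree_sweep n pa J Jc Q M N P x u st \<longleftrightarrow>
    node_values P x u \<and> (\<forall>i<n. \<forall>j\<in>J i. st j = tree_dual P x j (u i))" (is "?L \<longleftrightarrow> ?R")
proof -
  have eqv: "?L \<longleftrightarrow> ?R" if u: "\<And>i. i < n \<Longrightarrow> u i \<in> spH P"
  proof -
    have dual: "(\<forall>i<n. \<forall>j\<in>J i. 0 \<in> inverse_op (opB P j) (st j)
        + {NP j (st j - snd x j) + Dinv P j (snd x j) - opL P j (u i) + vec_b P j}) \<longleftrightarrow>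
      (\<forall>i<n. \<forall>j\<in>J i. st j = tree_dual P x j (u i))"
      using tree_dual_iff[OF x _ u] J_sub by blast
    have "(\<forall>i<n. 0 \<in> opA P i (u i) + {node_residual x st i (u (pa i)) (u i)}) \<longleftrightarrow> node_values P x u"
      if st: "\<forall>i<n. \<forall>j\<in>J i. st j = tree_dual P x j (u i)"
    proof -
      have "u i = tree_node P x i (u (pa i)) \<longleftrightarrow>
          0 \<in> opA P i (u i) + {node_residual x st i (u (pa i)) (u i)}" if i: "i < n" for i
      proof (rule tree_node_iff[OF x i])
        have i': "i \<in> {1..n-1}" if "i \<noteq> 0" using i that by auto
        show "i = 0 \<or> u (pa i) \<in> spH P" using i' pa_less u by blast
        show "\<forall>j\<in>Jc i. st j = tree_dual P x j (u (pa i))" if "i \<noteq> 0"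
          using st Jc_sub[OF i'[OF that]] pa_less[OF i'[OF that]] by blast
      qed
      then show ?thesis by (auto simp: node_values_def)
    qed
    then show ?thesis unfolding tree_sweep_residual dual by blast
  qed
  show ?thesis
  proof
    assume L: ?L
    have "u i \<in> spH P" if "i < n" for i
    proof -
      have "opA P i (u i) \<noteq> {}" using L that unfolding tree_sweep_residual by force
      then show ?thesis using maximally_monotone_onD(1)[OF opA_max[OF that]] by blast
    qed
    then show ?R using L eqv by blast
  next
    assume ?R
    then show ?L using node_values_in[OF x] eqv by blast
  qed
qed

lemma tree_sweep_tree_u:
  assumes "x \<in> X"
  shows "tree_sweep n pa J Jc Q M N P x (tree_u P x) (tree_st P x)"
  unfolding tree_sweep_iff[OF assms] by (simp add: node_values_tree_u tree_st_eq)

lemma tree_sweep_unique: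
  assumes x: "x \<in> X" and sw: "tree_sweep n pa J Jc Q M N P x u st"
  shows "i < n \<Longrightarrow> u i = tree_u P x i" "j \<in> {1..m} \<Longrightarrow> st j = tree_st P x j"
proof -
  show u: "u i = tree_u P x i" if "i < n" for i
    using sw node_values_unique[OF _ node_values_tree_u _ ] that unfolding tree_sweep_iff[OF x] by blast
  show "st j = tree_st P x j" if j: "j \<in> {1..m}"
  proof -
    obtain i where i: "i < n" "j \<in> J i" using J_owner[OF j] by blast
    then show ?thesis using sw u[OF i(1)] tree_st_eq[OF i] unfolding tree_sweep_iff[OF x] by metis
  qed
qed

text \<open>A sweep determines \<open>u\<close> on the nodes and \<open>st\<close> on
  \<open>{1..m}\<close>. The result reads them only there, since \<open>pa i < n\<close>, so the
  description by THE is meaningful.\<close>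

lemma tree_T_eq:
  assumes x: "x \<in> X"
  shows "tree_T n m pa J Jc Q M N \<theta> \<zeta> P x =
    (\<lambda>i\<in>{1..n-1}. fst x i + \<theta> i *\<^sub>R (tree_u P x i - tree_u P x (pa i)),
     \<lambda>j\<in>{1..m}. snd x j + \<zeta> j *\<^sub>R (tree_st P x j - snd x j))" (is "_ = ?t")
proof -
  obtain z s where zs: "x = (z, s)" by (cases x)
  show ?thesis unfolding zs tree_T_def prod.case
  proof (rule the_equality)
    show "\<exists>u st. tree_sweep n pa J Jc Q M N P (z, s) u st \<and>
      (let zt = \<lambda>i. z i + u i - u (pa i)
       in (\<lambda>i\<in>{1..n - 1}. fst (z, s) i + \<theta> i *\<^sub>R (tree_u P (z, s) i - tree_u P (z, s) (pa i)),
           \<lambda>j\<in>{1..m}. snd (z, s) j + \<zeta> j *\<^sub>R (tree_st P (z, s) j - snd (z, s) j)) =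
          (\<lambda>i\<in>{1..n-1}. z i + \<theta> i *\<^sub>R (zt i - z i), \<lambda>j\<in>{1..m}. s j + \<zeta> j *\<^sub>R (st j - s j)))"
      using tree_sweep_tree_u[OF x] unfolding zs
      by (intro exI[of _ "tree_u P (z, s)"] exI[of _ "tree_st P (z, s)"]) (simp add: Let_def)
    fix x'
    assume "\<exists>u st. tree_sweep n pa J Jc Q M N P (z, s) u st \<and>
      (let zt = \<lambda>i. z i + u i - u (pa i)
       in x' = (\<lambda>i\<in>{1..n-1}. z i + \<theta> i *\<^sub>R (zt i - z i), \<lambda>j\<in>{1..m}. s j + \<zeta> j *\<^sub>R (st j - s j)))"
    then obtain u st where sw: "tree_sweep n pa J Jc Q M N P x u st"
      and x': "x' = (\<lambda>i\<in>{1..n-1}. z i + \<theta> i *\<^sub>R (u i - u (pa i)), \<lambda>j\<in>{1..m}. s j + \<zeta> j *\<^sub>R (st j - s j))"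
      by (auto simp: zs Let_def)
    note un = tree_sweep_unique[OF x sw]
    have "u i = tree_u P x i \<and> u (pa i) = tree_u P x (pa i)" if "i \<in> {1..n-1}" for i
      using un(1)[of i] un(1)[OF pa_less[OF that]] that by auto
    then show "x' = (\<lambda>i\<in>{1..n - 1}. fst (z, s) i + \<theta> i *\<^sub>R (tree_u P (z, s) i - tree_u P (z, s) (pa i)),
           \<lambda>j\<in>{1..m}. snd (z, s) j + \<zeta> j *\<^sub>R (tree_st P (z, s) j - snd (z, s) j))"
      unfolding x' using un(2) by (auto simp: zs intro!: restrict_ext)
  qed
qed

lemma tree_S_eq: "tree_S n pa J M P x = tree_u P x 0"
proof -
  have "tree_u P x 0 = tree_node P x 0 (tree_u P x (pa 0))"
    using node_values_tree_u n unfolding node_values_def by simp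
  moreover have "node_metric 0 (spaces_of P) = (\<lambda>y. \<Sum>c\<in>children 0. MP c y)"
    by (simp add: node_metric_def fun_eq_iff)
  ultimately show ?thesis
    by (simp add: tree_node_def node_rhs_def tree_S_def Let_def case_prod_beta)
qed

lemma tree_u_in: "x \<in> X \<Longrightarrow> i < n \<Longrightarrow> tree_u P x i \<in> spH P"
  by (rule node_values_in[OF _ node_values_tree_u])

lemma tree_st_in:
  assumes "x \<in> X" "j \<in> {1..m}"
  shows "tree_st P x j \<in> spK P j"
proof -
  obtain i where i: "i < n" "j \<in> J i" using J_owner[OF assms(2)] by blast
  show ?thesis unfolding tree_st_eq[OF i] using tree_dual_in[OF assms] tree_u_in[OF assms(1) i(1)] .
qed

lemma tree_T_in:
  assumes x: "x \<in> X"
  shows "tree_T n m pa J Jc Q M N \<theta> \<zeta> P x \<in> X"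
proof -
  have "fst x i + \<theta> i *\<^sub>R (tree_u P x i - tree_u P x (pa i)) \<in> spH P" if "i \<in> {1..n-1}" for i
    using X_z[OF x that] tree_u_in[OF x] that pa_less[OF that] by (intro H_mem) auto
  moreover have "snd x j + \<zeta> j *\<^sub>R (tree_st P x j - snd x j) \<in> spK P j" if "j \<in> {1..m}" for j
    using X_s[OF x that] tree_st_in[OF x that] K(1)[OF that]
    by (intro subspace_add subspace_scale subspace_diff) auto
  ultimately show ?thesis unfolding tree_T_eq[OF x] by (auto simp: lifted_space_def)
qed

section \<open>Fixed points and solutions\<close>

lemma tree_fixed_iff:
  assumes x: "x \<in> X"
  shows "tree_T n m pa J Jc Q M N \<theta> \<zeta> P x = x \<longleftrightarrow>
    (\<forall>i<n. tree_u P x i = tree_u P x 0) \<and> (\<forall>j\<in>{1..m}. tree_st P x j = snd x j)"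
proof -
  obtain z s where zs: "x = (z, s)" by (cases x)
  have ext: "z \<in> extensional {1..n-1}" "s \<in> extensional {1..m}"
    using x by (auto simp: zs lifted_space_def PiE_def)
  have "tree_T n m pa J Jc Q M N \<theta> \<zeta> P x = x \<longleftrightarrow>
    (\<forall>i\<in>{1..n-1}. tree_u P x i = tree_u P x (pa i)) \<and> (\<forall>j\<in>{1..m}. tree_st P x j = snd x j)"
    (is "?L \<longleftrightarrow> ?R")
  proof
    assume L: ?L
    have "fst x i + \<theta> i *\<^sub>R (tree_u P x i - tree_u P x (pa i)) = fst x i" if "i \<in> {1..n-1}" for i
      using arg_cong[OF L[unfolded tree_T_eq[OF x]], of "\<lambda>x. fst x i"] that by simp
    moreover have "snd x j + \<zeta> j *\<^sub>R (tree_st P x j - snd x j) = snd x j" if "j \<in> {1..m}" for j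
      using arg_cong[OF L[unfolded tree_T_eq[OF x]], of "\<lambda>x. snd x j"] that by simp
    ultimately show ?R using \<theta> \<zeta> by auto
  next
    assume ?R
    then have "tree_T n m pa J Jc Q M N \<theta> \<zeta> P x = (restrict z {1..n-1}, restrict s {1..m})"
      unfolding tree_T_eq[OF x] by (auto simp: zs intro!: restrict_ext)
    then show ?L using ext by (simp add: zs extensional_restrict)
  qed
  also have "(\<forall>i\<in>{1..n-1}. tree_u P x i = tree_u P x (pa i)) \<longleftrightarrow> (\<forall>i<n. tree_u P x i = tree_u P x 0)"
    (is "?A \<longleftrightarrow> ?B")
  proof
    assume A: ?A
    have "tree_u P x i = tree_u P x 0" if "i < n" for i
      using that by (induction rule: node_induct) (use A in auto)
    then show ?B by blast
  next
    assume B: ?B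
    show ?A
    proof
      fix i assume "i \<in> {1..n-1}"
      then have "i < n" "pa i < n" using pa_less by auto
      then show "tree_u P x i = tree_u P x (pa i)" using B by metis
    qed
  qed
  finally show ?thesis .
qed

text \<open>When parent and child share the value \<open>v\<close>, the edge term
  \<open>M i (v + z i - 2 v)\<close> at the child is \<open>- M i (v - z i)\<close>, the negative of
  the term that the same edge contributes at the parent. This sign makes the sum over all nodes
  collapse. At the root, \<open>Q 0 = {}\<close> allows the same formula.\<close>

lemma node_residual_const:
  assumes "x \<in> X" "v \<in> spH P" "i < n" and st: "\<And>j. j \<in> {1..m} \<Longrightarrow> st j = snd x j"
  shows "node_residual x st i v v = (if i = 0 then - vec_a P else - MP i (v - fst x i))
    + (\<Sum>c\<in>children i. MP c (v - fst x c)) + (\<Sum>l\<in>Q i. opC P l v) + (\<Sum>j\<in>J i. Ladj P j (snd x j))"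
proof (cases "i = 0")
  case True
  then show ?thesis by (simp add: node_residual_def Q_root)
next
  case False
  then have i': "i \<in> {1..n-1}" using assms(3) by auto
  have "Ladj P j (st j - snd x j) = 0" if "j \<in> Jc i" for j
  proof -
    have "j \<in> {1..m}" using that Jc_sub[OF i'] J_sub[OF pa_less[OF i']] by blast
    then show ?thesis by (simp only: st Ladj_zero diff_self)
  qed
  moreover have "MP i (v + fst x i - 2 *\<^sub>R v) = - MP i (v - fst x i)"
  proof -
    have eq: "v + fst x i - 2 *\<^sub>R v = (-1) *\<^sub>R (v - fst x i)" by (simp add: scaleR_2)
    have "v - fst x i \<in> spH P" using X_z[OF assms(1) i'] assms(2) by (rule H_mem(2)[rotated])
    from metric_onD(3)[OF MP[OF i'] this, of "-1"] show ?thesis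
      unfolding eq by (simp only: scaleR_minus1_left)
  qed
  ultimately show ?thesis using False by (simp add: node_residual_def)
qed

lemma fixed_point_solves:
  assumes x: "x \<in> X" and fp: "tree_T n m pa J Jc Q M N \<theta> \<zeta> P x = x"
  shows "solves n m p P (tree_u P x 0)"
proof -
  define v where "v = tree_u P x 0"
  have u: "tree_u P x i = v" if "i < n" for i using fp that unfolding tree_fixed_iff[OF x] v_def by blast
  have st: "tree_st P x j = snd x j" if "j \<in> {1..m}" for j
    using fp that unfolding tree_fixed_iff[OF x] by blast
  have v: "v \<in> spH P" unfolding v_def using tree_u_in[OF x] n by simp
  define q where "q = (\<lambda>i. node_residual x (tree_st P x) i v v)"
  have q_mem: "- q i \<in> opA P i v" if "i < n" for i
  proof -
    have "0 \<in> opA P i (tree_u P x i) + {node_residual x (tree_st P x) i (tree_u P x (pa i)) (tree_u P x i)}"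
      using tree_sweep_tree_u[OF x] that unfolding tree_sweep_residual by blast
    \<comment> \<open>\<open>pa 0\<close> is meaningless, so the value there cannot be replaced by
      \<open>v\<close> through \<open>u\<close>; the residual of the root ignores it.\<close>
    moreover have "node_residual x (tree_st P x) i (tree_u P x (pa i)) v = q i"
    proof (cases "i = 0")
      case True then show ?thesis by (simp add: q_def node_residual_def)
    next
      case False
      then show ?thesis using u pa_less[of i] that by (simp add: q_def)
    qed
    ultimately show ?thesis using u[OF that] by (simp add: zero_mem_plus_singleton)
  qed
  have "opL P j v - vec_b P j - Dinv P j (snd x j) \<in> inverse_op (opB P j) (snd x j)"
    if j: "j \<in> {1..m}" for j
  proof -
    obtain i where i: "i < n" "j \<in> J i" using J_owner[OF j] by blast
    have "0 \<in> inverse_op (opB P j) (tree_st P x j) + {NP j (tree_st P x j - snd x j)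
        + Dinv P j (snd x j) - opL P j (tree_u P x i) + vec_b P j}"
      using tree_sweep_tree_u[OF x] i unfolding tree_sweep_residual by blast
    then have "- (NP j 0 + Dinv P j (snd x j) - opL P j v + vec_b P j) \<in> inverse_op (opB P j) (snd x j)"
      using st[OF j] u[OF i(1)] by (simp add: zero_mem_plus_singleton)
    moreover have "NP j 0 = 0" using metric_onD(4)[OF NP[OF j] K(1)[OF j]] .
    ultimately show ?thesis by (simp add: algebra_simps)
  qed
  moreover have "(\<Sum>i<n. q i) = (\<Sum>l=1..p. opC P l v) + (\<Sum>j=1..m. Ladj P j (snd x j)) - vec_a P"
    unfolding sum_nodes[where g = "\<lambda>i. MP i (v - fst x i)", symmetric] q_def
    using node_residual_const[OF x v _ st] by (intro sum.cong) auto
  then have "vec_a P = (\<Sum>i<n. - q i) + (\<Sum>j=1..m. Ladj P j (snd x j)) + (\<Sum>l=1..p. opC P l v)"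
    by (simp add: sum_negf)
  ultimately have "solves n m p P v"
    unfolding solves_iff using v q_mem X_s[OF x]
    by (intro conjI exI[of _ "\<lambda>i. - q i"] exI[of _ "snd x"]) auto
  then show ?thesis by (simp add: v_def)
qed

text \<open>
  The edge terms \<open>g i = M i (v - z i)\<close> of a fixed point are determined by the inclusions from the
  leaves upwards; the root inclusion then holds because the inclusions add up to the problem.
\<close>

lemma solution_fixed_point:
  assumes sol: "solves n m p P v"
  obtains x where "x \<in> X" "tree_T n m pa J Jc Q M N \<theta> \<zeta> P x = x"
proof -
  obtain \<alpha> s where v: "v \<in> spH P" and \<alpha>: "\<And>i. i < n \<Longrightarrow> \<alpha> i \<in> opA P i v"
    and s: "\<And>j. j \<in> {1..m} \<Longrightarrow> s j \<in> spK P j"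
      "\<And>j. j \<in> {1..m} \<Longrightarrow> opL P j v - vec_b P j - Dinv P j (s j) \<in> inverse_op (opB P j) (s j)"
    and total: "vec_a P = (\<Sum>i<n. \<alpha> i) + (\<Sum>j=1..m. Ladj P j (s j)) + (\<Sum>l=1..p. opC P l v)"
    using sol unfolding solves_iff by blast
  \<comment> \<open>The terms of the inclusion of node \<open>i\<close> without metrics. For a
    nonroot node that inclusion then says that the edge term towards the parent is
    \<open>r i\<close> plus the edge terms of the children, which is the recursion for
    \<open>g\<close>.\<close>
  define r where "r = (\<lambda>i. \<alpha> i + (\<Sum>l\<in>Q i. opC P l v) + (\<Sum>j\<in>J i. Ladj P j (s j)))"
  have r_in: "r i \<in> spH P" if "i < n" for i
    using \<alpha>[OF that] maximally_monotone_onD(1)[OF opA_max[OF that]] J_sub[OF that] Q_sub[OF that]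
      Ladj_in opC_in[OF _ v] unfolding r_def by (intro H_mem) blast+
  obtain g where g: "\<And>i. g i = r i + (\<Sum>c\<in>children i. g c)"
    using upward_recursion[of r] by blast
  have g_in: "g i \<in> spH P" if "i < n" for i
    using that
  proof (induction i rule: upward_induct)
    case (1 i)
    have "g c \<in> spH P" if "c \<in> children i" for c
      using 1(1)[OF that] that by (auto simp: ch_def)
    then have "(\<Sum>c\<in>children i. g c) \<in> spH P" by (rule H_mem(4))
    then show ?case unfolding g[of i] by (rule H_mem(1)[OF r_in[OF 1(2)]])
  qed
  \<comment> \<open>\<open>y i\<close> plays the role of \<open>v - z i\<close>: since metrics are
    onto, \<open>M i (v - z i) = g i\<close> can be solved for \<open>z i\<close>.\<close>
  define y where "y = (\<lambda>i. inv_into (spH P) (MP i) (g i))"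
  have surj: "g i \<in> MP i ` spH P" if "i \<in> {1..n-1}" for i
  proof -
    have "g i \<in> spH P" using that by (intro g_in) auto
    from metric_on_surj[OF H MP[OF that] this] show ?thesis by (metis imageI)
  qed
  have y: "y i \<in> spH P" "MP i (y i) = g i" if "i \<in> {1..n-1}" for i
    unfolding y_def using inv_into_into[OF surj[OF that]] f_inv_into_f[OF surj[OF that]] by auto
  define x where "x = (\<lambda>i\<in>{1..n-1}. v - y i, \<lambda>j\<in>{1..m}. s j)"
  have x: "x \<in> X" using s(1) y(1) v by (auto simp: x_def lifted_space_def H_mem)
  have edge: "MP i (v - fst x i) = g i" if "i \<in> {1..n-1}" for i
    using that y(2) by (simp add: x_def)
  have snd_x: "s j = snd x j" if "j \<in> {1..m}" for j using that by (simp add: x_def)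
  define q where "q = (\<lambda>i. node_residual x s i v v)"
  have q: "q i = (if i = 0 then - vec_a P else - g i) + (\<Sum>c\<in>children i. g c)
      + (\<Sum>l\<in>Q i. opC P l v) + (\<Sum>j\<in>J i. Ladj P j (s j))" if i: "i < n" for i
  proof -
    have "(\<Sum>c\<in>children i. MP c (v - fst x c)) = (\<Sum>c\<in>children i. g c)"
      by (rule sum.cong[OF refl], rule edge) (use children(1) in blast)
    moreover have "Ladj P j (snd x j) = Ladj P j (s j)" if "j \<in> J i" for j
    proof -
      have "j \<in> {1..m}" using J_sub[OF i] that by blast
      from snd_x[OF this] show ?thesis by simp
    qed
    then have "(\<Sum>j\<in>J i. Ladj P j (snd x j)) = (\<Sum>j\<in>J i. Ladj P j (s j))"
      by (rule sum.cong[OF refl])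
    moreover have "(if i = 0 then - vec_a P else - MP i (v - fst x i)) = (if i = 0 then - vec_a P else - g i)"
      using edge[of i] i by auto
    ultimately show ?thesis
      unfolding q_def using node_residual_const[OF x v i, of s, OF snd_x] by (simp only:)
  qed
  have q_node: "q i = - \<alpha> i" if "i \<in> {1..n-1}" for i
  proof -
    have i: "i < n" "i \<noteq> 0" using that by auto
    show ?thesis using q[OF i(1)] g[of i] i(2) by (simp add: r_def)
  qed
  have "(\<Sum>i<n. q i) = (\<Sum>l=1..p. opC P l v) + (\<Sum>j=1..m. Ladj P j (s j)) - vec_a P"
    by (rule trans[OF sum.cong[OF refl q] sum_nodes]) simp
  then have "(\<Sum>i<n. q i) + (\<Sum>i<n. \<alpha> i) = 0" by (simp add: total)
  moreover have "{..<n} = insert 0 {1..n-1}" using n by auto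
  moreover have "(\<Sum>i=1..n-1. q i) = - (\<Sum>i=1..n-1. \<alpha> i)"
    unfolding sum_negf[symmetric] by (rule sum.cong[OF refl], rule q_node)
  ultimately have "q 0 + - (\<Sum>i=1..n-1. \<alpha> i) + (\<alpha> 0 + (\<Sum>i=1..n-1. \<alpha> i)) = 0" by simp
  then have "q 0 + \<alpha> 0 = 0" by (simp add: algebra_simps)
  then have q_all: "- q i = \<alpha> i" if "i < n" for i
    using q_node[of i] that by (cases "i = 0") (auto simp: neg_eq_iff_add_eq_0)
  have "tree_sweep n pa J Jc Q M N P x (\<lambda>_. v) s"
    unfolding tree_sweep_residual zero_mem_plus_singleton
  proof (intro conjI allI impI ballI)
    show "- node_residual x s i v v \<in> opA P i v" if "i < n" for i
      using q_all[OF that] \<alpha>[OF that] by (simp add: q_def)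
    show "- (NP j (s j - snd x j) + Dinv P j (snd x j) - opL P j v + vec_b P j) \<in> inverse_op (opB P j) (s j)"
      if "i < n" "j \<in> J i" for i j
    proof -
      have j: "j \<in> {1..m}" using J_sub that by blast
      have "NP j 0 = 0" using metric_onD(4)[OF NP[OF j] K(1)[OF j]] .
      then show ?thesis using s(2)[OF j] snd_x[OF j] by (simp add: algebra_simps)
    qed
  qed
  from tree_sweep_unique[OF x this] have "tree_T n m pa J Jc Q M N \<theta> \<zeta> P x = x"
    unfolding tree_fixed_iff[OF x] using snd_x n by auto
  with x that show thesis by blast
qed

end

lemma (in tree) tree_fixed_point_encoding:
  "fixed_point_encoding n m p (lifted_space (n - 1) m id)
     (tree_T n m pa J Jc Q M N \<theta> \<zeta>) (tree_S n pa J M)"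
  unfolding fixed_point_encoding_def
proof (intro allI impI)
  fix P :: "'u problem" assume "problem_instance n m p P"
  then interpret tree_problem n m p pa J Jc Q M N \<theta> \<zeta> P by unfold_locales
  let ?T = "tree_T n m pa J Jc Q M N \<theta> \<zeta> P"
  have S: "solves n m p P (tree_S n pa J M P x)" if "x \<in> X" "?T x = x" for x
    unfolding tree_S_eq using that by (rule fixed_point_solves)
  moreover have "?T \<in> X \<rightarrow> X" using tree_T_in by blast
  moreover have "tree_S n pa J M P \<in> X \<rightarrow> spH P"
    unfolding tree_S_eq[abs_def] using tree_u_in n by auto
  moreover have "(\<exists>x\<in>X. ?T x = x) \<longleftrightarrow> (\<exists>u. solves n m p P u)"
    using S solution_fixed_point by metis
  ultimately show "?T \<in> X \<rightarrow> X \<and> tree_S n pa J M P \<in> X \<rightarrow> spH P \<and>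
    ((\<exists>x\<in>X. ?T x = x) \<longleftrightarrow> (\<exists>u. solves n m p P u)) \<and>
    (\<forall>x\<in>X. ?T x = x \<longrightarrow> solves n m p P (tree_S n pa J M P x))"
    by blast
qed

section \<open>Straight-line programs\<close>

lemma run_snoc: "run P x vs (cs @ [c]) = run P x vs cs @ [exec_instr P x (run P x vs cs) c]"
  by (induction cs arbitrary: vs) auto

lemma length_run [simp]: "length (run P x vs cs) = length vs + length cs"
  by (induction cs arbitrary: vs) auto

lemma prog_sorts_snoc:
  "prog_sorts n m p d f \<sigma> ss (cs @ [c]) ss' \<longleftrightarrow>
     (\<exists>ss1 \<tau>. prog_sorts n m p d f \<sigma> ss cs ss1 \<and> instr_sort n m p d f \<sigma> ss1 c \<tau> \<and> ss' = ss1 @ [\<tau>])"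
  by (induction cs arbitrary: ss) auto

lemma prog_sorts_length: "prog_sorts n m p d f \<sigma> ss cs ss' \<Longrightarrow> length ss' = length ss + length cs"
  by (induction cs arbitrary: ss) auto

type_synonym 'u sorted_map = "space_sort \<times> ('u problem \<Rightarrow> 'u point \<Rightarrow> 'u)"

context
  fixes n m p d f :: nat and \<sigma> :: "nat \<Rightarrow> nat"
begin

definition computed :: "'u::{real_inner,complete_space} instr list \<Rightarrow> space_sort list \<Rightarrow> 'u sorted_map \<Rightarrow> nat \<Rightarrow> bool" where
  "computed cs ss g r \<longleftrightarrow> at_sort ss r (fst g) \<and>
     (\<forall>P. problem_instance n m p P \<longrightarrow> (\<forall>x\<in>lifted_space d f \<sigma> P. run P x [] cs ! r = snd g P x))"

text \<open>Hides all positions: a program is known only through the functions available in it and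
  through how often it evaluates each operator, and in this form programs can be extended without
  index bookkeeping.\<close>

definition programmable :: "(nat \<Rightarrow> nat) \<Rightarrow> (nat \<Rightarrow> nat) \<Rightarrow> 'u::{real_inner,complete_space} sorted_map set \<Rightarrow> bool" where
  "programmable a b \<Gamma> \<longleftrightarrow> (\<exists>cs ss. prog_sorts n m p d f \<sigma> [] cs ss \<and>
     (\<forall>i. length (filter (evaluates_A i) cs) = a i) \<and>
     (\<forall>j. length (filter (evaluates_B j) cs) = b j) \<and>
     (\<forall>g\<in>\<Gamma>. \<exists>r. computed cs ss g r))"

lemma programmable_empty: "programmable (\<lambda>_. 0) (\<lambda>_. 0) {}"
  unfolding programmable_def by (intro exI[of _ "[]"]) auto

lemma programmable_mono: "programmable a b \<Gamma> \<Longrightarrow> \<Delta> \<subseteq> \<Gamma> \<Longrightarrow> programmable a b \<Delta>"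
  unfolding programmable_def by blast

lemma programmable_extend:
  fixes \<Gamma> :: "'u::{real_inner,complete_space} sorted_map set"
  assumes \<Gamma>: "programmable a b \<Gamma>"
    and step: "\<And>cs ss. prog_sorts n m p d f \<sigma> [] cs ss \<Longrightarrow> \<forall>g\<in>\<Gamma>. \<exists>r. computed cs ss g r \<Longrightarrow>
      \<exists>c. instr_sort n m p d f \<sigma> ss c (fst h) \<and>
        (\<forall>i. (if evaluates_A i c then a i + 1 else a i) = a' i) \<and>
        (\<forall>j. (if evaluates_B j c then b j + 1 else b j) = b' j) \<and>
        (\<forall>P. problem_instance n m p P \<longrightarrow> (\<forall>x\<in>lifted_space d f \<sigma> P.
          exec_instr P x (run P x [] cs) c = snd h P x))"
  shows "programmable a' b' (insert h \<Gamma>)"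
proof -
  obtain cs ss where cs: "prog_sorts n m p d f \<sigma> [] cs ss"
     "\<forall>i. length (filter (evaluates_A i) cs) = a i" "\<forall>j. length (filter (evaluates_B j) cs) = b j"
     "\<forall>g\<in>\<Gamma>. \<exists>r. computed cs ss g r"
    using \<Gamma> unfolding programmable_def by blast
  obtain c where c: "instr_sort n m p d f \<sigma> ss c (fst h)"
        "\<forall>i. (if evaluates_A i c then a i + 1 else a i) = a' i"
        "\<forall>j. (if evaluates_B j c then b j + 1 else b j) = b' j"
        "\<forall>P. problem_instance n m p P \<longrightarrow> (\<forall>x\<in>lifted_space d f \<sigma> P.
          exec_instr P x (run P x [] cs) c = snd h P x)"
    using step[OF cs(1,4)] by blast
  let ?cs = "cs @ [c]" and ?ss = "ss @ [fst h]"
  have len: "length ss = length cs" using prog_sorts_length[OF cs(1)] by simp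
  have "prog_sorts n m p d f \<sigma> [] ?cs ?ss" using cs(1) c(1) by (auto simp: prog_sorts_snoc)
  moreover have "length (filter (evaluates_A i) ?cs) = a' i" for i using cs(2) c(2) by (auto split: if_splits)
  moreover have "length (filter (evaluates_B j) ?cs) = b' j" for j using cs(3) c(3) by (auto split: if_splits)
  moreover have "computed ?cs ?ss g r" if "computed cs ss g r" for g r
    using that len unfolding computed_def at_sort_def by (auto simp: run_snoc nth_append)
  moreover have "computed ?cs ?ss h (length cs)"
    using len c(4) unfolding computed_def at_sort_def by (auto simp: run_snoc nth_append)
  ultimately show ?thesis using cs(4) unfolding programmable_def by (intro exI[of _ ?cs] exI[of _ ?ss]) blast
qed

text \<open>Resolvents are left out here because their evaluations are counted.\<close>

inductive_set elementary :: "'u::{real_inner,complete_space} sorted_map set \<Rightarrow> 'u sorted_map set" for \<Gamma> where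
  base: "g \<in> \<Gamma> \<Longrightarrow> g \<in> elementary \<Gamma>"
| inputH: "k \<in> {1..d} \<Longrightarrow> (SortH, \<lambda>P x. fst x k) \<in> elementary \<Gamma>"
| inputK: "k \<in> {1..f} \<Longrightarrow> (SortK (\<sigma> k), \<lambda>P x. snd x k) \<in> elementary \<Gamma>"
| constA: "(SortH, \<lambda>P x. vec_a P) \<in> elementary \<Gamma>"
| constB: "j \<in> {1..m} \<Longrightarrow> (SortK j, \<lambda>P x. vec_b P j) \<in> elementary \<Gamma>"
| add: "(\<tau>, g) \<in> elementary \<Gamma> \<Longrightarrow> (\<tau>, h) \<in> elementary \<Gamma> \<Longrightarrow> (\<tau>, \<lambda>P x. g P x + h P x) \<in> elementary \<Gamma>"
| scale: "(\<tau>, g) \<in> elementary \<Gamma> \<Longrightarrow> (\<tau>, \<lambda>P x. c *\<^sub>R g P x) \<in> elementary \<Gamma>"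
| metric: "(\<tau>, g) \<in> elementary \<Gamma> \<Longrightarrow> metric_family m \<tau> G \<Longrightarrow>
    (\<tau>, \<lambda>P x. G (spaces_of P) (g P x)) \<in> elementary \<Gamma>"
| applyL: "j \<in> {1..m} \<Longrightarrow> (SortH, g) \<in> elementary \<Gamma> \<Longrightarrow> (SortK j, \<lambda>P x. opL P j (g P x)) \<in> elementary \<Gamma>"
| applyLadj: "j \<in> {1..m} \<Longrightarrow> (SortK j, g) \<in> elementary \<Gamma> \<Longrightarrow> (SortH, \<lambda>P x. Ladj P j (g P x)) \<in> elementary \<Gamma>"
| applyC: "l \<in> {1..p} \<Longrightarrow> (SortH, g) \<in> elementary \<Gamma> \<Longrightarrow> (SortH, \<lambda>P x. opC P l (g P x)) \<in> elementary \<Gamma>"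
| applyDinv: "j \<in> {1..m} \<Longrightarrow> (SortK j, g) \<in> elementary \<Gamma> \<Longrightarrow> (SortK j, \<lambda>P x. Dinv P j (g P x)) \<in> elementary \<Gamma>"

lemma elementary_diff:
  assumes "(\<tau>, g) \<in> elementary \<Gamma>" "(\<tau>, h) \<in> elementary \<Gamma>"
  shows "(\<tau>, \<lambda>P x. g P x - h P x) \<in> elementary \<Gamma>"
  using add[OF assms(1) scale[OF assms(2), of "-1"]] by simp

lemma elementary_sum:
  assumes "finite S" "\<And>c. c \<in> S \<Longrightarrow> (SortH, g c) \<in> elementary \<Gamma>"
  shows "(SortH, \<lambda>P x. \<Sum>c\<in>S. g c P x) \<in> elementary \<Gamma>"
  using assms
proof (induction S rule: finite_induct)
  case empty
  show ?case using scale[OF constA, of 0] by simp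
next
  case (insert c S)
  then show ?case using add[of SortH "g c" \<Gamma> "\<lambda>P x. \<Sum>c\<in>S. g c P x"] by simp
qed

lemma computed_sort: "computed cs ss (\<tau>, g) r \<Longrightarrow> at_sort ss r \<tau>"
  by (simp add: computed_def)

lemma computed_value:
  "computed cs ss (\<tau>, g) r \<Longrightarrow> problem_instance n m p P \<Longrightarrow> x \<in> lifted_space d f \<sigma> P \<Longrightarrow> run P x [] cs ! r = g P x"
  by (simp add: computed_def)

lemma programmable_nullary:
  assumes "programmable a b \<Delta>"
    and "\<And>ss. instr_sort n m p d f \<sigma> ss c (fst h)"
    and "\<And>i. \<not> evaluates_A i c" "\<And>j. \<not> evaluates_B j c"
    and "\<And>P x vs. exec_instr P x vs c = snd h P x"
  shows "programmable a b (insert h \<Delta>)"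
  by (rule programmable_extend[OF assms(1)]) (use assms(2-5) in \<open>auto intro!: exI[of _ c]\<close>)

lemma programmable_unary:
  assumes "programmable a b (insert (\<tau>, g) \<Delta>)"
    and "\<And>ss r. at_sort ss r \<tau> \<Longrightarrow> instr_sort n m p d f \<sigma> ss (c r) (fst h)"
    and "\<And>r i. \<not> evaluates_A i (c r)" "\<And>r j. \<not> evaluates_B j (c r)"
    and "\<And>P x vs r. problem_instance n m p P \<Longrightarrow> x \<in> lifted_space d f \<sigma> P \<Longrightarrow> vs ! r = g P x \<Longrightarrow>
      exec_instr P x vs (c r) = snd h P x"
  shows "programmable a b (insert h \<Delta>)"
proof -
  have "programmable a b (insert h (insert (\<tau>, g) \<Delta>))"
  proof (rule programmable_extend[OF assms(1)])
    fix cs ss assume "\<forall>g\<in>insert (\<tau>, g) \<Delta>. \<exists>r. computed cs ss g r"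
    then obtain r where r: "computed cs ss (\<tau>, g) r" by blast
    show "\<exists>c. instr_sort n m p d f \<sigma> ss c (fst h) \<and>
      (\<forall>i. (if evaluates_A i c then a i + 1 else a i) = a i) \<and>
      (\<forall>j. (if evaluates_B j c then b j + 1 else b j) = b j) \<and>
      (\<forall>P. problem_instance n m p P \<longrightarrow> (\<forall>x\<in>lifted_space d f \<sigma> P.
        exec_instr P x (run P x [] cs) c = snd h P x))"
      using assms(2)[OF computed_sort[OF r]] assms(3-5) computed_value[OF r]
      by (intro exI[of _ "c r"]) auto
  qed
  then show ?thesis by (rule programmable_mono) blast
qed

text \<open>The induction leaves \<open>\<Delta>\<close> arbitrary because the two arguments of a
  sum are added one after the other. Shared subterms may be computed repeatedly; this is harmless,
  as elementary steps contain no counted instruction.\<close>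

lemma programmable_elementary:
  assumes "h \<in> elementary \<Gamma>" "programmable a b \<Delta>" "\<Gamma> \<subseteq> \<Delta>"
  shows "programmable a b (insert h \<Delta>)"
  using assms
proof (induction arbitrary: \<Delta> rule: elementary.induct)
  case (base g)
  then show ?case by (simp add: insert_absorb subsetD)
next
  case (inputH k)
  show ?case
    by (rule programmable_nullary[where c = "InputH k"])
      (use inputH in \<open>auto simp: evaluates_A_def evaluates_B_def\<close>)
next
  case (inputK k)
  show ?case
    by (rule programmable_nullary[where c = "InputK k"])
      (use inputK in \<open>auto simp: evaluates_A_def evaluates_B_def\<close>)
next
  case constA
  show ?case
    by (rule programmable_nullary[where c = "ConstA"])
      (use constA in \<open>auto simp: evaluates_A_def evaluates_B_def\<close>)
next
  case (constB j)
  show ?case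
    by (rule programmable_nullary[where c = "ConstB j"])
      (use constB in \<open>auto simp: evaluates_A_def evaluates_B_def\<close>)
next
  case (add \<tau> g h)
  have "programmable a b (insert (\<tau>, g) (insert (\<tau>, h) \<Delta>))"
    using add by blast
  then have "programmable a b (insert (\<tau>, \<lambda>P x. g P x + h P x) (insert (\<tau>, g) (insert (\<tau>, h) \<Delta>)))"
  proof (rule programmable_extend)
    fix cs ss assume "\<forall>g\<in>insert (\<tau>, g) (insert (\<tau>, h) \<Delta>). \<exists>r. computed cs ss g r"
    then obtain q r where qr: "computed cs ss (\<tau>, g) q" "computed cs ss (\<tau>, h) r" by blast
    show "\<exists>c. instr_sort n m p d f \<sigma> ss c (fst (\<tau>, \<lambda>P x. g P x + h P x)) \<and>
        (\<forall>i. (if evaluates_A i c then a i + 1 else a i) = a i) \<and>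
        (\<forall>j. (if evaluates_B j c then b j + 1 else b j) = b j) \<and>
        (\<forall>P. problem_instance n m p P \<longrightarrow> (\<forall>x\<in>lifted_space d f \<sigma> P.
          exec_instr P x (run P x [] cs) c = snd (\<tau>, \<lambda>P x. g P x + h P x) P x))"
      using computed_sort[OF qr(1)] computed_sort[OF qr(2)] computed_value[OF qr(1)] computed_value[OF qr(2)]
      by (intro exI[of _ "Add q r"]) (auto simp: evaluates_A_def evaluates_B_def)
  qed
  then show ?case by (rule programmable_mono) blast
next
  case (scale \<tau> g c)
  show ?case
    by (rule programmable_unary[where c = "Scale c" and g = g and \<tau> = \<tau>])
      (use scale in \<open>auto simp: evaluates_A_def evaluates_B_def\<close>)
next
  case (metric \<tau> g G)
  show ?case
    by (rule programmable_unary[where c = "Metric \<tau> G" and g = g and \<tau> = \<tau>])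
      (use metric in \<open>auto simp: evaluates_A_def evaluates_B_def\<close>)
next
  case (applyL j g)
  show ?case
    by (rule programmable_unary[where c = "ApplyL j" and g = g and \<tau> = SortH])
      (use applyL in \<open>auto simp: evaluates_A_def evaluates_B_def\<close>)
next
  case (applyLadj j g)
  show ?case
    by (rule programmable_unary[where c = "ApplyLadj j" and g = g and \<tau> = "SortK j"])
      (use applyLadj in \<open>auto simp: evaluates_A_def evaluates_B_def\<close>)
next
  case (applyC l g)
  show ?case
    by (rule programmable_unary[where c = "ApplyC l" and g = g and \<tau> = SortH])
      (use applyC in \<open>auto simp: evaluates_A_def evaluates_B_def\<close>)
next
  case (applyDinv j g)
  show ?case
    by (rule programmable_unary[where c = "ApplyDinv j" and g = g and \<tau> = "SortK j"])
      (use applyDinv in \<open>auto simp: evaluates_A_def evaluates_B_def\<close>)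
qed

lemma programmable_resolventA:
  assumes \<Gamma>: "programmable a b \<Gamma>" and g: "(SortH, g) \<in> elementary \<Gamma>"
    and i: "i < n" and G: "metric_family m SortH G"
  shows "programmable (a(i := a i + 1)) b
    (insert (SortH, \<lambda>P x. param_resolvent (G (spaces_of P)) (opA P i) (g P x)) \<Gamma>)"
proof -
  have "programmable a b (insert (SortH, g) \<Gamma>)" using programmable_elementary[OF g \<Gamma>] by blast
  then have "programmable (a(i := a i + 1)) b
    (insert (SortH, \<lambda>P x. param_resolvent (G (spaces_of P)) (opA P i) (g P x)) (insert (SortH, g) \<Gamma>))"
    (is "programmable ?a b (insert ?h _)")
  proof (rule programmable_extend)
    fix cs ss assume "\<forall>g\<in>insert (SortH, g) \<Gamma>. \<exists>r. computed cs ss g r"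
    then obtain r where r: "computed cs ss (SortH, g) r" by blast
    show "\<exists>c. instr_sort n m p d f \<sigma> ss c (fst ?h) \<and>
        (\<forall>i. (if evaluates_A i c then a i + 1 else a i) = ?a i) \<and>
        (\<forall>j. (if evaluates_B j c then b j + 1 else b j) = b j) \<and>
        (\<forall>P. problem_instance n m p P \<longrightarrow> (\<forall>x\<in>lifted_space d f \<sigma> P.
          exec_instr P x (run P x [] cs) c = snd ?h P x))"
      using computed_sort[OF r] computed_value[OF r] i G
      by (intro exI[of _ "ResolventA i G r"]) (auto simp: evaluates_A_def evaluates_B_def)
  qed
  then show ?thesis by (rule programmable_mono) blast
qed

lemma programmable_resolventBinv:
  assumes \<Gamma>: "programmable a b \<Gamma>" and g: "(SortK j, g) \<in> elementary \<Gamma>"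
    and j: "j \<in> {1..m}" and G: "metric_family m (SortK j) G"
  shows "programmable a (b(j := b j + 1))
    (insert (SortK j, \<lambda>P x. param_resolvent (G (spaces_of P)) (inverse_op (opB P j)) (g P x)) \<Gamma>)"
proof -
  have "programmable a b (insert (SortK j, g) \<Gamma>)" using programmable_elementary[OF g \<Gamma>] by blast
  then have "programmable a (b(j := b j + 1))
    (insert (SortK j, \<lambda>P x. param_resolvent (G (spaces_of P)) (inverse_op (opB P j)) (g P x))
      (insert (SortK j, g) \<Gamma>))"
    (is "programmable a ?b (insert ?h _)")
  proof (rule programmable_extend)
    fix cs ss assume "\<forall>g\<in>insert (SortK j, g) \<Gamma>. \<exists>r. computed cs ss g r"
    then obtain r where r: "computed cs ss (SortK j, g) r" by blast
    show "\<exists>c. instr_sort n m p d f \<sigma> ss c (fst ?h) \<and>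
        (\<forall>i. (if evaluates_A i c then a i + 1 else a i) = a i) \<and>
        (\<forall>j. (if evaluates_B j c then b j + 1 else b j) = ?b j) \<and>
        (\<forall>P. problem_instance n m p P \<longrightarrow> (\<forall>x\<in>lifted_space d f \<sigma> P.
          exec_instr P x (run P x [] cs) c = snd ?h P x))"
      using computed_sort[OF r] computed_value[OF r] j G
      by (intro exI[of _ "ResolventBinv j G r"]) (auto simp: evaluates_A_def evaluates_B_def)
  qed
  then show ?thesis by (rule programmable_mono) blast
qed

lemma programmable_frugal:
  fixes T :: "'u::{real_inner,complete_space} problem \<Rightarrow> 'u point \<Rightarrow> 'u point"
  assumes \<Gamma>: "programmable a b \<Gamma>"
    and a: "\<And>i. i < n \<Longrightarrow> a i = 1" and b: "\<And>j. j \<in> {1..m} \<Longrightarrow> b j = 1"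
    and z: "\<And>k. k \<in> {1..d} \<Longrightarrow> (SortH, z k) \<in> \<Gamma>"
    and s: "\<And>k. k \<in> {1..f} \<Longrightarrow> (SortK (\<sigma> k), s k) \<in> \<Gamma>"
    and u: "(SortH, u) \<in> \<Gamma>"
    and T: "\<And>P x. problem_instance n m p P \<Longrightarrow> x \<in> lifted_space d f \<sigma> P \<Longrightarrow>
      T P x = (\<lambda>k\<in>{1..d}. z k P x, \<lambda>k\<in>{1..f}. s k P x)"
    and S: "\<And>P x. problem_instance n m p P \<Longrightarrow> x \<in> lifted_space d f \<sigma> P \<Longrightarrow> S P x = u P x"
  shows "\<exists>cs oz os ou. frugal_procedure n m p d f \<sigma> T S cs oz os ou"
proof -
  obtain cs ss where cs: "prog_sorts n m p d f \<sigma> [] cs ss"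
     "\<forall>i. length (filter (evaluates_A i) cs) = a i" "\<forall>j. length (filter (evaluates_B j) cs) = b j"
     and g: "\<forall>g\<in>\<Gamma>. \<exists>r. computed cs ss g r"
    using \<Gamma> unfolding programmable_def by blast
  from bchoice[OF g] obtain R where R: "\<And>g. g \<in> \<Gamma> \<Longrightarrow> computed cs ss g (R g)" by blast
  define oz where "oz = (\<lambda>k. R (SortH, z k))"
  define os where "os = (\<lambda>k. R (SortK (\<sigma> k), s k))"
  define ou where "ou = R (SortH, u)"
  have oz: "computed cs ss (SortH, z k) (oz k)" if "k \<in> {1..d}" for k
    unfolding oz_def using R z[OF that] .
  have os: "computed cs ss (SortK (\<sigma> k), s k) (os k)" if "k \<in> {1..f}" for k
    unfolding os_def using R s[OF that] .
  have ou: "computed cs ss (SortH, u) ou"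
    unfolding ou_def using R u .
  have "T P x = (\<lambda>k\<in>{1..d}. run P x [] cs ! oz k, \<lambda>k\<in>{1..f}. run P x [] cs ! os k)"
    if "problem_instance n m p P" "x \<in> lifted_space d f \<sigma> P" for P x
    unfolding T[OF that] using computed_value[OF oz that] computed_value[OF os that]
    by (auto intro!: restrict_ext)
  moreover have "S P x = run P x [] cs ! ou"
    if "problem_instance n m p P" "x \<in> lifted_space d f \<sigma> P" for P x
    unfolding S[OF that] using computed_value[OF ou that] by simp
  ultimately have "frugal_procedure n m p d f \<sigma> T S cs oz os ou"
    unfolding frugal_procedure_def
    using cs a b computed_sort[OF oz] computed_sort[OF os] computed_sort[OF ou] by auto
  then show ?thesis by blast
qed

end

section \<open>A frugal program for the sweep\<close>

context tree
begin

definition node_maps :: "nat set \<Rightarrow> 'u sorted_map set" where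
  "node_maps I = (\<lambda>i. (SortH, \<lambda>P x. tree_u P x i)) ` I
     \<union> (\<lambda>j. (SortK j, \<lambda>P x. tree_st P x j)) ` (\<Union>i\<in>I. J i)"

abbreviation "prg \<equiv> programmable n m p (n - 1) m id"
abbreviation "elem \<equiv> elementary m p (n - 1) m id"

lemma tree_u_rec: "i < n \<Longrightarrow> tree_u P x i = tree_node P x i (tree_u P x (pa i))"
  using node_values_tree_u by (simp add: node_values_def)

lemma elem_z: "i \<in> {1..n-1} \<Longrightarrow> (SortH, \<lambda>P x. fst x i) \<in> elem \<Gamma>"
  by (rule elementary.inputH)

lemma elem_s: "j \<in> {1..m} \<Longrightarrow> (SortK j, \<lambda>P x. snd x j) \<in> elem \<Gamma>"
  using elementary.inputK[where \<sigma> = id] by simp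

text \<open>Once the parent has been processed, its value and the dual values it owns are available,
  and the latter include those in the correction terms of node \<open>i\<close>.\<close>

lemma elem_node_rhs:
  assumes i: "i < n" and pa: "i \<noteq> 0 \<Longrightarrow> pa i \<in> I"
  shows "(SortH, \<lambda>P x. node_rhs P x i (tree_u P x (pa i))) \<in> elem (node_maps I)"
proof -
  let ?E = "elem (node_maps I)"
  have "(SortH, \<lambda>P x. M c (spaces_of P) (fst x c)) \<in> ?E" if "c \<in> children i" for c
  proof -
    have "c \<in> {1..n-1}" using that children(1) by blast
    then show ?thesis by (intro elementary.metric[OF elem_z M])
  qed
  then have "(SortH, \<lambda>P x. \<Sum>c\<in>children i. M c (spaces_of P) (fst x c)) \<in> ?E"
    by (rule elementary_sum[OF children(2)])
  moreover have "(SortH, \<lambda>P x. Ladj P j (snd x j)) \<in> ?E" if "j \<in> J i" for j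
  proof -
    have "j \<in> {1..m}" using that J_sub[OF i] by blast
    then show ?thesis by (intro elementary.applyLadj[OF _ elem_s])
  qed
  then have "(SortH, \<lambda>P x. \<Sum>j\<in>J i. Ladj P j (snd x j)) \<in> ?E"
    by (rule elementary_sum[OF finite_subset[OF J_sub[OF i] finite_atLeastAtMost]])
  ultimately have common: "(SortH, \<lambda>P x. (\<Sum>c\<in>children i. M c (spaces_of P) (fst x c))
      - (\<Sum>j\<in>J i. Ladj P j (snd x j))) \<in> ?E"
    by (rule elementary_diff)
  show ?thesis
  proof (cases "i = 0")
    case True
    with common elementary.add[OF common elementary.constA] show ?thesis by (simp add: node_rhs_def)
  next
    case False
    then have i': "i \<in> {1..n-1}" using i by auto
    have v: "(SortH, \<lambda>P x. tree_u P x (pa i)) \<in> ?E"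
      using pa[OF False] by (intro elementary.base) (auto simp: node_maps_def)
    have "(SortH, \<lambda>P x. 2 *\<^sub>R tree_u P x (pa i) - fst x i) \<in> ?E"
      by (rule elementary_diff[OF elementary.scale[OF v] elem_z[OF i']])
    then have 1: "(SortH, \<lambda>P x. M i (spaces_of P) (2 *\<^sub>R tree_u P x (pa i) - fst x i)) \<in> ?E"
      by (rule elementary.metric[OF _ M[OF i']])
    have "(SortH, \<lambda>P x. opC P l (tree_u P x (pa i))) \<in> ?E" if "l \<in> Q i" for l
    proof -
      have "l \<in> {1..p}" using that Q_sub[OF i] by blast
      then show ?thesis by (rule elementary.applyC[OF _ v])
    qed
    then have 2: "(SortH, \<lambda>P x. \<Sum>l\<in>Q i. opC P l (tree_u P x (pa i))) \<in> ?E"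
      by (rule elementary_sum[OF finite_subset[OF Q_sub[OF i] finite_atLeastAtMost]])
    have "(SortH, \<lambda>P x. Ladj P j (tree_dual P x j (tree_u P x (pa i)) - snd x j)) \<in> ?E" if j: "j \<in> Jc i" for j
    proof -
      have jJ: "j \<in> J (pa i)" using j Jc_sub[OF i'] by blast
      then have jm: "j \<in> {1..m}" using J_sub[OF pa_less[OF i']] by blast
      \<comment> \<open>Computing this \<open>tree_dual\<close> afresh would evaluate a second
        resolvent of \<open>B j\<close>; it is the value already stored when the parent was
        processed.\<close>
      have "(SortK j, \<lambda>P x. tree_st P x j) \<in> ?E"
        using pa[OF False] jJ by (intro elementary.base) (auto simp: node_maps_def)
      then have "(SortK j, \<lambda>P x. tree_dual P x j (tree_u P x (pa i))) \<in> ?E"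
        unfolding tree_st_eq[OF pa_less[OF i'] jJ] .
      then show ?thesis by (rule elementary.applyLadj[OF jm elementary_diff[OF _ elem_s[OF jm]]])
    qed
    then have 3: "(SortH, \<lambda>P x. \<Sum>j\<in>Jc i. Ladj P j (tree_dual P x j (tree_u P x (pa i)) - snd x j)) \<in> ?E"
      by (rule elementary_sum[OF finite_subset[OF subset_trans[OF Jc_sub[OF i'] J_sub[OF pa_less[OF i']]]
            finite_atLeastAtMost]])
    from elementary.add[OF common elementary_diff[OF elementary_diff[OF 1 2] 3]] False
    show ?thesis by (simp add: node_rhs_def)
  qed
qed

lemma prg_dual:
  assumes i: "i < n" and prg: "prg a b \<Gamma>" and u: "(SortH, \<lambda>P x. tree_u P x i) \<in> \<Gamma>" and j: "j \<in> J i"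
  shows "prg a (b(j := b j + 1)) (insert (SortK j, \<lambda>P x. tree_st P x j) \<Gamma>)"
proof -
  have jm: "j \<in> {1..m}" using J_sub[OF i] j by blast
  have Nj: "metric_family m (SortK j) (N j)" using N[OF jm] .
  have "(SortK j, \<lambda>P x. N j (spaces_of P) (snd x j) - Dinv P j (snd x j) + opL P j (tree_u P x i) - vec_b P j)
      \<in> elem \<Gamma>"
    by (rule elementary_diff[OF elementary.add[OF elementary_diff[OF
            elementary.metric[OF elem_s[OF jm] Nj] elementary.applyDinv[OF jm elem_s[OF jm]]]
          elementary.applyL[OF jm elementary.base[OF u]]] elementary.constB[OF jm]])
  from programmable_resolventBinv[OF prg this jm Nj] show ?thesis
    unfolding tree_st_eq[OF i j] tree_dual_def .
qed

lemma prg_duals: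
  assumes i: "i < n" and prg: "prg a b \<Gamma>" and u: "(SortH, \<lambda>P x. tree_u P x i) \<in> \<Gamma>"
    and F: "F \<subseteq> J i" "finite F"
  shows "prg a (\<lambda>j. b j + (if j \<in> F then 1 else 0)) (\<Gamma> \<union> (\<lambda>j. (SortK j, \<lambda>P x. tree_st P x j)) ` F)"
  using F(2,1)
proof (induction F rule: finite_induct)
  case empty
  then show ?case using prg by (simp add: id_def)
next
  case (insert j F)
  let ?b = "\<lambda>j. b j + (if j \<in> F then 1 else 0)"
  have "prg a (?b(j := ?b j + 1)) (insert (SortK j, \<lambda>P x. tree_st P x j)
      (\<Gamma> \<union> (\<lambda>j. (SortK j, \<lambda>P x. tree_st P x j)) ` F))"
    using insert u by (intro prg_dual[OF i]) (auto simp: id_def)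
  moreover have "?b(j := ?b j + 1) = (\<lambda>k. b k + (if k \<in> insert j F then 1 else 0))"
    using insert by (auto simp: fun_eq_iff)
  ultimately show ?case by (simp add: id_def)
qed

text \<open>The induction removes a node of greatest depth. Such a node is nobody's parent within
  the set, so the smaller set still contains the parents of its nonroot members.\<close>

lemma prg_nodes:
  assumes "finite I" "I \<subseteq> {..<n}" "\<And>i. i \<in> I \<Longrightarrow> i \<noteq> 0 \<Longrightarrow> pa i \<in> I"
  shows "prg (\<lambda>i. if i \<in> I then 1 else 0) (\<lambda>j. if j \<in> (\<Union>i\<in>I. J i) then 1 else 0) (node_maps I)"
  using assms
proof (induction I rule: finite_ranking_induct[where f = depth])
  case empty
  show ?case using programmable_empty by (simp add: node_maps_def)
next
  case (insert i I)
  show ?case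
  proof (cases "i \<in> I")
    case True
    then show ?thesis using insert by (simp add: insert_absorb)
  next
    case False
    have pa_I: "pa k \<in> I" if "k \<in> insert i I" "k \<noteq> 0" for k
    proof -
      have "k \<in> {1..n-1}" using that insert.prems(1) by auto
      then have "depth (pa k) < depth k" by (rule depth_pa)
      moreover have "depth k \<le> depth i" using that insert.hyps(2) by auto
      ultimately have "pa k \<noteq> i" by auto
      then show ?thesis using insert.prems(2)[OF that] by auto
    qed
    have i: "i < n" using insert.prems by auto
    let ?a = "\<lambda>k. if k \<in> I then 1 else (0::nat)"
      and ?b = "\<lambda>j. if j \<in> (\<Union>i\<in>I. J i) then 1 else (0::nat)"
    let ?u = "(SortH, \<lambda>P x. tree_u P x i)"
    have "prg ?a ?b (node_maps I)" using insert.IH insert.prems(1) pa_I by (auto simp: id_def)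
    from programmable_resolventA[OF this elem_node_rhs[OF i] i node_metric[OF i]] pa_I
    have "prg (?a(i := ?a i + 1)) ?b (insert ?u (node_maps I))"
      unfolding tree_u_rec[OF i] tree_node_def[symmetric] by simp
    then have "prg (?a(i := ?a i + 1)) (\<lambda>j. ?b j + (if j \<in> J i then 1 else 0))
      (insert ?u (node_maps I) \<union> (\<lambda>j. (SortK j, \<lambda>P x. tree_st P x j)) ` J i)"
      by (rule prg_duals[OF i]) (use finite_subset[OF J_sub[OF i]] in auto)
    moreover have "?a(i := ?a i + 1) = (\<lambda>k. if k \<in> insert i I then 1 else 0)"
      using False by (auto simp: fun_eq_iff)
    \<comment> \<open>Disjointness of the cells \<open>J i\<close> keeps the number of evaluations
      of every \<open>B j\<close> at one.\<close>
    moreover have "j \<notin> (\<Union>i\<in>I. J i)" if j: "j \<in> J i" for j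
    proof
      assume "j \<in> (\<Union>i\<in>I. J i)"
      then obtain k where k: "k \<in> I" "j \<in> J k" by blast
      have "j \<in> {1..m}" using J_sub[OF i] j by blast
      then have "k = i" using J_owner i j k insert.prems(1) by blast
      then show False using k False by simp
    qed
    then have "(\<lambda>j. ?b j + (if j \<in> J i then 1 else 0)) = (\<lambda>j. if j \<in> (\<Union>i\<in>insert i I. J i) then 1 else 0)"
      by (auto simp: fun_eq_iff)
    moreover have "insert ?u (node_maps I) \<union> (\<lambda>j. (SortK j, \<lambda>P x. tree_st P x j)) ` J i = node_maps (insert i I)"
      by (auto simp: node_maps_def)
    ultimately show ?thesis by (simp add: id_def)
  qed
qed

lemma tree_frugal:
  "\<exists>cs oz os ou. frugal_procedure n m p (n - 1) m id
     (tree_T n m pa J Jc Q M N \<theta> \<zeta>) (tree_S n pa J M) cs oz os ou"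
proof -
  let ?\<Gamma> = "node_maps {..<n}"
  let ?a = "\<lambda>i. if i \<in> {..<n} then 1 else (0::nat)"
    and ?b = "\<lambda>j. if j \<in> (\<Union>i\<in>{..<n}. J i) then 1 else (0::nat)"
  let ?z = "\<lambda>i. (SortH, \<lambda>P x. fst x i + \<theta> i *\<^sub>R (tree_u P x i - tree_u P x (pa i)))"
  let ?s = "\<lambda>j. (SortK j, \<lambda>P x. snd x j + \<zeta> j *\<^sub>R (tree_st P x j - snd x j))"
  have J_all: "(\<Union>i\<in>{..<n}. J i) = {1..m}" using tree by (simp add: tree_data_def indexed_partition_def)
  have u: "(SortH, \<lambda>P x. tree_u P x i) \<in> elem ?\<Gamma>" if "i < n" for i
    using that by (intro elementary.base) (auto simp: node_maps_def)
  have st: "(SortK j, \<lambda>P x. tree_st P x j) \<in> elem ?\<Gamma>" if "j \<in> {1..m}" for j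
    using that unfolding J_all[symmetric] by (intro elementary.base) (auto simp: node_maps_def)
  have z: "?z i \<in> elem ?\<Gamma>" if "i \<in> {1..n-1}" for i
    using that pa_less[OF that] by (intro elementary.add elementary.scale elementary_diff elem_z u) auto
  have s: "?s j \<in> elem ?\<Gamma>" if "j \<in> {1..m}" for j
    using that by (intro elementary.add elementary.scale elementary_diff elem_s st)
  have "prg ?a ?b ?\<Gamma>"
  proof (rule prg_nodes)
    show "pa i \<in> {..<n}" if "i \<in> {..<n}" "i \<noteq> 0" for i using that pa_less[of i] by auto
  qed auto
  moreover have all: "prg ?a ?b (?\<Gamma> \<union> F)" if "finite F" "F \<subseteq> elem ?\<Gamma>" "prg ?a ?b ?\<Gamma>" for F
    using that
  proof (induction F rule: finite_induct)
    case (insert h F)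
    then have "prg ?a ?b (?\<Gamma> \<union> F)" by blast
    then show ?case using programmable_elementary[of h m p "n-1" m id ?\<Gamma> n ?a ?b "?\<Gamma> \<union> F"] insert
      by (simp add: id_def)
  qed simp
  ultimately have "prg ?a ?b (?\<Gamma> \<union> (?z ` {1..n-1} \<union> ?s ` {1..m}))"
    using z s by (intro all) auto
  then show ?thesis
  proof (rule programmable_frugal[where u = "\<lambda>P x. tree_u P x 0"
        and z = "\<lambda>k P x. fst x k + \<theta> k *\<^sub>R (tree_u P x k - tree_u P x (pa k))"
        and s = "\<lambda>k P x. snd x k + \<zeta> k *\<^sub>R (tree_st P x k - snd x k)"])
    show "(SortH, \<lambda>P x. tree_u P x 0) \<in> ?\<Gamma> \<union> (?z ` {1..n-1} \<union> ?s ` {1..m})"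
      using n by (auto simp: node_maps_def)
    show "(SortH, \<lambda>P x. fst x k + \<theta> k *\<^sub>R (tree_u P x k - tree_u P x (pa k)))
        \<in> ?\<Gamma> \<union> (?z ` {1..n-1} \<union> ?s ` {1..m})" if "k \<in> {1..n-1}" for k
      using that by blast
    show "(SortK (id k), \<lambda>P x. snd x k + \<zeta> k *\<^sub>R (tree_st P x k - snd x k))
        \<in> ?\<Gamma> \<union> (?z ` {1..n-1} \<union> ?s ` {1..m})" if "k \<in> {1..m}" for k
      using that by (simp only: id_apply) blast
    fix P :: "'u problem" and x assume P: "problem_instance n m p P" and x: "x \<in> lifted_space (n - 1) m id P"
    from P interpret tree_problem n m p pa J Jc Q M N \<theta> \<zeta> P by unfold_locales
    show "tree_T n m pa J Jc Q M N \<theta> \<zeta> P x =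
      (\<lambda>k\<in>{1..n-1}. fst x k + \<theta> k *\<^sub>R (tree_u P x k - tree_u P x (pa k)),
       \<lambda>k\<in>{1..m}. snd x k + \<zeta> k *\<^sub>R (tree_st P x k - snd x k))"
      using x by (rule tree_T_eq)
    show "tree_S n pa J M P x = tree_u P x 0" by (rule tree_S_eq)
  qed (use J_all in auto)
qed

lemma tree_frugal_splitting:
  "frugal_splitting n m p (n - 1) m id (tree_T n m pa J Jc Q M N \<theta> \<zeta>) (tree_S n pa J M)"
  unfolding frugal_splitting_def using tree_fixed_point_encoding tree_frugal by auto

end

section \<open>Values of well-sorted programs\<close>

lemma take_run: "take k (run P x [] cs) = run P x [] (take k cs)"
proof (induction cs rule: rev_induct)
  case (snoc c cs)
  then show ?case by (cases "k \<le> length cs") (auto simp: run_snoc)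
qed simp

lemma run_nth:
  assumes "k < length cs"
  shows "run P x [] cs ! k = exec_instr P x (take k (run P x [] cs)) (cs ! k)"
proof -
  have "run P x [] cs ! k = take (Suc k) (run P x [] cs) ! k" by simp
  also have "\<dots> = run P x [] (take k cs @ [cs ! k]) ! k"
    unfolding take_run using assms by (simp add: take_Suc_conv_app_nth)
  also have "\<dots> = exec_instr P x (take k (run P x [] cs)) (cs ! k)"
    unfolding run_snoc take_run using assms by (simp add: nth_append)
  finally show ?thesis .
qed

lemma prog_sorts_nth:
  assumes "prog_sorts n m p d f \<sigma> [] cs ss" "k < length cs"
  shows "instr_sort n m p d f \<sigma> (take k ss) (cs ! k) (ss ! k)"
  using assms
proof (induction cs arbitrary: ss rule: rev_induct)
  case (snoc c cs)
  then obtain ss1 \<tau> where ss1: "prog_sorts n m p d f \<sigma> [] cs ss1" "instr_sort n m p d f \<sigma> ss1 c \<tau>"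
    "ss = ss1 @ [\<tau>]"
    unfolding prog_sorts_snoc by blast
  have "length ss1 = length cs" using prog_sorts_length[OF ss1(1)] by simp
  then show ?case
    using snoc.IH[OF ss1(1)] snoc.prems(2) ss1(2,3) by (cases "k < length cs") (auto simp: nth_append less_Suc_eq)
qed simp

text \<open>Type soundness of one instruction: \<open>the_elem\<close> in resolvents and
  \<open>inv_into\<close> in inverse metrics have their intended meaning only on arguments from the
  right space. The bound on the sorts is carried along because a space with an index outside
  \<open>{1..m}\<close> need not be a subspace.\<close>

lemma (in problem) exec_in_space:
  assumes \<sigma>: "\<sigma> \<in> {1..f} \<rightarrow> {1..m}" and x: "x \<in> lifted_space d f \<sigma> P"
    and vs: "\<And>r \<tau>. at_sort ss r \<tau> \<Longrightarrow> vs ! r \<in> space_of (spaces_of P) \<tau> \<and> \<tau> \<in> insert SortH (SortK ` {1..m})"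
    and c: "instr_sort n m p d f \<sigma> ss c \<tau>"
  shows "exec_instr P x vs c \<in> space_of (spaces_of P) \<tau> \<and> \<tau> \<in> insert SortH (SortK ` {1..m})"
proof -
  have sp: "fst (spaces_of P) = spH P" "snd (spaces_of P) = spK P"
    by (simp_all add: spaces_of_def)
  have vsH: "vs ! r \<in> spH P" if "at_sort ss r SortH" for r using vs[OF that] sp by simp
  have vsK: "vs ! r \<in> spK P j" if "at_sort ss r (SortK j)" for r j using vs[OF that] sp by simp
  show ?thesis
  proof (cases c)
    case (InputH k)
    then show ?thesis using c x by (auto simp: lifted_space_def sp)
  next
    case (InputK k)
    then show ?thesis using c x \<sigma> by (auto simp: lifted_space_def sp PiE_iff)
  next
    case ConstA
    then show ?thesis using c vec_a_in by (auto simp: sp)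
  next
    case (ConstB j)
    then show ?thesis using c vec_b_in by (auto simp: sp)
  next
    case (Add q r)
    then show ?thesis using c vs[of q \<tau>] vs[of r \<tau>] space_of_subspace(1)[OF hilbert, of \<tau>]
      by (auto simp: subspace_add)
  next
    case (Scale a r)
    then show ?thesis using c vs[of r \<tau>] space_of_subspace(1)[OF hilbert, of \<tau>]
      by (auto simp: subspace_scale)
  next
    case (Metric \<tau>' G r)
    then have "at_sort ss r \<tau>" "metric_family m \<tau> G" using c by auto
    then have r: "at_sort ss r \<tau>" "metric_on (space_of (spaces_of P) \<tau>) (G (spaces_of P))"
      using hilbert unfolding metric_family_def by blast+
    then show ?thesis using Metric vs[OF r(1)] metric_onD(1)[OF r(2)] by simp
  next
    case (MetricInv \<tau>' G r)
    then have "\<tau>' = \<tau>" "at_sort ss r \<tau>" "metric_family m \<tau> G" using c by auto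
    then have r: "\<tau>' = \<tau>" "at_sort ss r \<tau>" "metric_on (space_of (spaces_of P) \<tau>) (G (spaces_of P))"
      using hilbert unfolding metric_family_def by blast+
    have v: "vs ! r \<in> space_of (spaces_of P) \<tau>" "\<tau> \<in> insert SortH (SortK ` {1..m})"
      using vs[OF r(2)] by auto
    have "vs ! r \<in> G (spaces_of P) ` space_of (spaces_of P) \<tau>"
      using metric_on_surj[OF space_of_subspace[OF hilbert v(2)] r(3) v(1)] by (metis imageI)
    then show ?thesis using MetricInv v(2) r(1) by (simp add: inv_into_into)
  next
    case (ApplyL j r)
    then show ?thesis using c opL_in vsH by (auto simp: sp)
  next
    case (ApplyLadj j r)
    then show ?thesis using c Ladj_in by (auto simp: sp)
  next
    case (ApplyC l r)
    then show ?thesis using c opC_in vsH by (auto simp: sp)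
  next
    case (ApplyDinv j r)
    then show ?thesis using c Dinv_in vsK by (auto simp: sp)
  next
    case (ResolventA i G r)
    then show ?thesis using c param_resolvent_in[OF H opA_max metric_H vsH] by (auto simp: sp)
  next
    case (ResolventB j G r)
    then have "j \<in> {1..m}" "at_sort ss r (SortK j)" "\<tau> = SortK j" "metric_family m (SortK j) G"
      using c by auto
    then show ?thesis using ResolventB param_resolvent_in[OF K opB_max metric_K vsK] by (simp add: sp)
  next
    case (ResolventBinv j G r)
    then have "j \<in> {1..m}" "at_sort ss r (SortK j)" "\<tau> = SortK j" "metric_family m (SortK j) G"
      using c by auto
    then show ?thesis using ResolventBinv
        param_resolvent_in[OF K maximally_monotone_on_inverse_op[OF opB_max] metric_K vsK] by (simp add: sp)
  qed
qed

lemma (in problem) run_in_space: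
  assumes \<sigma>: "\<sigma> \<in> {1..f} \<rightarrow> {1..m}" and x: "x \<in> lifted_space d f \<sigma> P"
    and cs: "prog_sorts n m p d f \<sigma> [] cs ss" and k: "k < length cs"
  shows "run P x [] cs ! k \<in> space_of (spaces_of P) (ss ! k) \<and> ss ! k \<in> insert SortH (SortK ` {1..m})"
  using k
proof (induction k rule: less_induct)
  case (less k)
  show ?case unfolding run_nth[OF less.prems]
  proof (rule exec_in_space[OF \<sigma> x _ prog_sorts_nth[OF cs less.prems]])
    show "take k (run P x [] cs) ! r \<in> space_of (spaces_of P) \<tau> \<and> \<tau> \<in> insert SortH (SortK ` {1..m})"
      if "at_sort (take k ss) r \<tau>" for r \<tau>
      using that less.IH[of r] less.prems by (auto simp: at_sort_def)
  qed
qed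

text \<open>By induction on positions, all arguments stay the same: the spaces, hence the metrics,
  are untouched, and the resolvent of the normal cone of \<open>{u i}\<close> returns
  \<open>u i\<close>, the value it replaces. Frugality is what allows \<open>pos\<close> to be met,
  as two evaluations of \<open>A i\<close> could return different values.\<close>

lemma (in problem) run_point_cones:
  assumes \<sigma>: "\<sigma> \<in> {1..f} \<rightarrow> {1..m}" and x: "x \<in> lifted_space d f \<sigma> P"
    and cs: "prog_sorts n m p d f \<sigma> [] cs ss"
    and pos: "\<And>i k G r. i < n \<Longrightarrow> k < length cs \<Longrightarrow> cs ! k = ResolventA i G r \<Longrightarrow> u i = run P x [] cs ! k"
  shows "run (P\<lparr>opA := \<lambda>i. point_cone (spH P) (u i)\<rparr>) x [] cs = run P x [] cs"
    (is "run ?P x [] cs = _")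
proof -
  have *: "spaces_of ?P = spaces_of P" "Ladj ?P = Ladj P" "Dinv ?P = Dinv P"
    by (simp_all add: spaces_of_def Ladj_def Dinv_def fun_eq_iff)
  have "run ?P x [] cs ! k = run P x [] cs ! k" if "k < length cs" for k
    using that
  proof (induction k rule: less_induct)
    case (less k)
    have eq: "take k (run ?P x [] cs) = take k (run P x [] cs)"
      by (rule nth_equalityI) (use less in auto)
    let ?vs = "take k (run P x [] cs)"
    have sort: "instr_sort n m p d f \<sigma> (take k ss) (cs ! k) (ss ! k)"
      by (rule prog_sorts_nth[OF cs less.prems])
    have "exec_instr ?P x ?vs (cs ! k) = exec_instr P x ?vs (cs ! k)"
    proof (cases "cs ! k")
      case (ResolventA i G r)
      with sort have i: "i < n" and r: "r < k" "r < length ss" "ss ! r = SortH" and G: "metric_family m SortH G"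
        and k: "ss ! k = SortH"
        by (auto simp: at_sort_def)
      have "run P x [] cs ! r \<in> spH P" "run P x [] cs ! k \<in> spH P"
        using run_in_space[OF \<sigma> x cs, of r] run_in_space[OF \<sigma> x cs, of k] r k less.prems
        by (auto simp: spaces_of_def)
      then have v: "?vs ! r \<in> spH P" and u: "u i \<in> spH P"
        using r pos[OF i less.prems ResolventA] by auto
      have "param_resolvent (G (spaces_of P)) (point_cone (spH P) (u i)) (?vs ! r) = u i"
        using v metric_onD(1)[OF metric_H[OF G] u] H(1) u
        by (intro param_resolvent_eqI[OF H(1) maximally_monotone_on_point_cone[OF H(1) u] metric_H[OF G]])
          (simp add: point_cone_def subspace_diff)
      then show ?thesis
        using run_nth[OF less.prems, of P x] pos[OF i less.prems ResolventA] ResolventA by (simp add: *)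
    qed (simp_all add: *)
    then show ?case using run_nth[OF less.prems] eq by metis
  qed
  then show ?thesis by (intro nth_equalityI) auto
qed

section \<open>Minimality of the lifting\<close>

text \<open>Primal and dual parts are decoupled by \<open>L = 0\<close>. The inverses of the normal
  cones of \<open>{0}\<close> have only the value \<open>0\<close>, so a dual variable for
  \<open>j\<close> exists exactly when \<open>b j = 0\<close>.\<close>

definition test_problem ::
    "'u set \<Rightarrow> (nat \<Rightarrow> 'u set) \<Rightarrow> (nat \<Rightarrow> 'u \<Rightarrow> 'u set) \<Rightarrow> (nat \<Rightarrow> 'u) \<Rightarrow> 'u::{real_inner,complete_space} problem" where
  "test_problem V K A b = \<lparr>spH = V, spK = K, opA = A, opB = (\<lambda>j. point_cone (K j) 0),
     opD = (\<lambda>j. point_cone (K j) 0), nu = (\<lambda>_. 1), opC = (\<lambda>_ _. 0), beta = (\<lambda>_. 1),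
     opL = (\<lambda>_ _. 0), vec_a = 0, vec_b = b\<rparr>"

lemma test_problem_instance:
  assumes V: "subspace V" "closed V" and K: "\<And>j. subspace (K j)" "\<And>j. closed (K j)"
    and A: "\<And>i. i < n \<Longrightarrow> maximally_monotone_on V (A i)" and b: "\<And>j. b j \<in> K j"
  shows "problem_instance n m p (test_problem V K A b)"
  using assms maximally_monotone_on_point_cone[OF K(1) subspace_0[OF K(1)]]
  by (auto simp: problem_instance_def test_problem_def hilbert_spaces_def spaces_of_def
      strongly_monotone_op_def point_cone_def bounded_linear_on_def cocoercive_on_def subspace_0
      split: if_splits intro!: exI[of _ 0])

lemma Ladj_test_problem:
  assumes "subspace V"
  shows "Ladj (test_problem V K A b) j y = 0"
  unfolding Ladj_def adjoint_on_def test_problem_def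
  by (rule the_equality) (use subspace_0[OF assms] in \<open>auto dest: bspec\<close>)

lemma Dinv_test_problem: "y \<in> K j \<Longrightarrow> Dinv (test_problem V K A b) j y = 0"
proof -
  assume "y \<in> K j"
  then have "inverse_op (point_cone (K j) 0) y = {0}"
    by (auto simp: inverse_op_def point_cone_def split: if_splits)
  then show ?thesis by (simp add: Dinv_def test_problem_def)
qed

lemma solves_test_problem:
  assumes inst: "problem_instance n m p (test_problem V K A b)"
  shows "solves n m p (test_problem V K A b) u \<longleftrightarrow>
    u \<in> V \<and> (\<forall>j\<in>{1..m}. b j = 0) \<and> (\<exists>\<alpha>. (\<forall>i<n. \<alpha> i \<in> A i u) \<and> (\<Sum>i<n. \<alpha> i) = 0)"
proof -
  let ?P = "test_problem V K A b"
  interpret problem n m p ?P using inst by unfold_locales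
  have sel: "spH ?P = V" "spK ?P = K" "opA ?P = A" "opB ?P = (\<lambda>j. point_cone (K j) 0)"
    "opC ?P = (\<lambda>_ _. 0)" "opL ?P = (\<lambda>_ _. 0)" "vec_a ?P = 0" "vec_b ?P = b"
    by (simp_all add: test_problem_def)
  have V: "subspace V" using H(1) by (simp add: sel)
  have K0: "0 \<in> K j" if "j \<in> {1..m}" for j using K(1)[OF that] by (simp add: sel subspace_0)
  have dual: "s \<in> K j \<and> 0 - b j - Dinv ?P j s \<in> inverse_op (point_cone (K j) 0) s \<longleftrightarrow> s \<in> K j \<and> b j = 0" for j s
    using Dinv_test_problem[of s K j V A b] by (auto simp: inverse_op_def point_cone_def split: if_splits)
  show ?thesis
    unfolding solves_iff unfolding sel dual Ladj_test_problem[OF V]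
  proof (intro conj_cong refl iffI)
    assume "\<exists>\<alpha> s. (\<forall>i<n. \<alpha> i \<in> A i u) \<and> (\<forall>j\<in>{1..m}. s j \<in> K j \<and> b j = 0) \<and>
      0 = sum \<alpha> {..<n} + (\<Sum>j = 1..m. 0) + (\<Sum>l = 1..p. 0)"
    then show "(\<forall>j\<in>{1..m}. b j = 0) \<and> (\<exists>\<alpha>. (\<forall>i<n. \<alpha> i \<in> A i u) \<and> sum \<alpha> {..<n} = 0)" by force
  next
    assume "(\<forall>j\<in>{1..m}. b j = 0) \<and> (\<exists>\<alpha>. (\<forall>i<n. \<alpha> i \<in> A i u) \<and> sum \<alpha> {..<n} = 0)"
    then obtain \<alpha> where "\<forall>j\<in>{1..m}. b j = 0" "\<forall>i<n. \<alpha> i \<in> A i u" "sum \<alpha> {..<n} = 0" by blast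
    then show "\<exists>\<alpha> s. (\<forall>i<n. \<alpha> i \<in> A i u) \<and> (\<forall>j\<in>{1..m}. s j \<in> K j \<and> b j = 0) \<and>
      0 = sum \<alpha> {..<n} + (\<Sum>j = 1..m. 0) + (\<Sum>l = 1..p. 0)"
      using K0 by (intro exI[of _ \<alpha>] exI[of _ "\<lambda>_. 0"]) simp
  qed
qed

section \<open>The dual bound\<close>

lemma dual_lifting_minimal:
  fixes T :: "'u::{real_inner,complete_space} problem \<Rightarrow> 'u point \<Rightarrow> 'u point"
  assumes e: "(e::'u) \<noteq> 0" and fs: "frugal_splitting n m p d f \<sigma> T S"
  shows "m \<le> f"
proof -
  have "j \<in> \<sigma> ` {1..f}" if j: "j \<in> {1..m}" for j
  proof (rule ccontr)
    assume nj: "j \<notin> \<sigma> ` {1..f}"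
    \<comment> \<open>Every factor of the lifted space is \<open>{0}\<close>, because
      \<open>K j\<close> is not among them, while \<open>b j = e \<noteq> 0\<close> rules out a
      solution.\<close>
    define P where "P = test_problem {0::'u} (\<lambda>k. if k = j then UNIV else {0})
      (\<lambda>_. point_cone {0} 0) (\<lambda>k. if k = j then e else 0)"
    have inst: "problem_instance n m p P"
      unfolding P_def
      by (rule test_problem_instance) (auto intro!: maximally_monotone_on_point_cone)
    have single: "lifted_space d f \<sigma> P = {(\<lambda>k\<in>{1..d}. 0, \<lambda>k\<in>{1..f}. 0)}"
    proof -
      have "{1..d} \<rightarrow>\<^sub>E spH P = {\<lambda>k\<in>{1..d}. 0}"
        by (simp add: P_def test_problem_def PiE_singleton flip: restrict_def)
      moreover have "(\<Pi>\<^sub>E k\<in>{1..f}. spK P (\<sigma> k)) = (\<Pi>\<^sub>E k\<in>{1..f}. {(\<lambda>k\<in>{1..f}. 0) k})"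
        using nj by (intro PiE_cong) (auto simp: P_def test_problem_def)
      moreover have "\<dots> = {\<lambda>k\<in>{1..f}. 0}" by (rule PiE_singleton[OF restrict_extensional])
      ultimately show ?thesis by (simp add: lifted_space_def)
    qed
    have enc: "T P \<in> lifted_space d f \<sigma> P \<rightarrow> lifted_space d f \<sigma> P"
      "(\<exists>x\<in>lifted_space d f \<sigma> P. T P x = x) \<longleftrightarrow> (\<exists>u. solves n m p P u)"
      using fs inst unfolding frugal_splitting_def fixed_point_encoding_def by blast+
    then have "\<exists>u. solves n m p P u" unfolding single by auto
    then have "\<forall>k\<in>{1..m}. (if k = j then e else 0) = 0"
      using solves_test_problem[OF inst[unfolded P_def]] unfolding P_def by blast
    from bspec[OF this j] show False using e by simp
  qed
  then have "{1..m} \<subseteq> \<sigma> ` {1..f}" by blast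
  then have "card {1..m} \<le> card (\<sigma> ` {1..f})" by (intro card_mono) auto
  also have "\<dots> \<le> f" using card_image_le[of "{1..f}" \<sigma>] by simp
  finally show ?thesis by simp
qed

section \<open>The primal bound\<close>

lemma homogeneous_system_solution:
  fixes \<beta> :: "'i \<Rightarrow> 'k \<Rightarrow> real"
  assumes "finite L" "finite I" "card L < card I"
  shows "\<exists>c. (\<exists>i\<in>I. c i \<noteq> 0) \<and> (\<forall>k\<in>L. (\<Sum>i\<in>I. c i * \<beta> i k) = 0)"
  using assms
proof (induction L arbitrary: I \<beta> rule: finite_induct)
  case empty
  then have "I \<noteq> {}" by auto
  then show ?case by (intro exI[of _ "\<lambda>_. 1"]) auto
next
  case (insert k L)
  show ?case
  proof (cases "\<forall>i\<in>I. \<beta> i k = 0")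
    case True
    obtain c where "\<exists>i\<in>I. c i \<noteq> 0" "\<forall>k\<in>L. (\<Sum>i\<in>I. c i * \<beta> i k) = 0"
      using insert.IH[OF insert.prems(1), of \<beta>] insert.prems(2) insert.hyps by auto
    then show ?thesis using True by (intro exI[of _ c]) auto
  next
    case False
    then obtain i0 where i0: "i0 \<in> I" "\<beta> i0 k \<noteq> 0" by blast
    let ?I = "I - {i0}"
    \<comment> \<open>Gaussian elimination: the coefficients left after equation \<open>k\<close>
      has been used to remove the unknown \<open>i0\<close>.\<close>
    define \<gamma> where "\<gamma> = (\<lambda>i l. \<beta> i l - \<beta> i k / \<beta> i0 k * \<beta> i0 l)"
    have "card L < card ?I" using insert.prems insert.hyps i0 by simp
    then obtain c where c: "\<exists>i\<in>?I. c i \<noteq> 0" "\<forall>l\<in>L. (\<Sum>i\<in>?I. c i * \<gamma> i l) = 0"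
      using insert.IH[of ?I \<gamma>] insert.prems(1) by auto
    \<comment> \<open>The value of the eliminated unknown, read off from equation
      \<open>k\<close>.\<close>
    define c0 where "c0 = - (\<Sum>i\<in>?I. c i * (\<beta> i k / \<beta> i0 k))"
    define c' where "c' = c(i0 := c0)"
    have sum: "(\<Sum>i\<in>I. c' i * \<beta> i l) = c0 * \<beta> i0 l + (\<Sum>i\<in>?I. c i * \<beta> i l)" for l
    proof -
      have "(\<Sum>i\<in>?I. c' i * \<beta> i l) = (\<Sum>i\<in>?I. c i * \<beta> i l)" by (intro sum.cong) (auto simp: c'_def)
      then show ?thesis using sum.remove[OF insert.prems(1) i0(1), of "\<lambda>i. c' i * \<beta> i l"]
        by (simp add: c'_def)
    qed
    have gamma: "(\<Sum>i\<in>?I. c i * \<gamma> i l) = (\<Sum>i\<in>?I. c i * \<beta> i l) + c0 * \<beta> i0 l" for l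
      unfolding \<gamma>_def c0_def
      by (simp add: right_diff_distrib sum_subtractf sum_distrib_right mult.assoc)
    have "(\<Sum>i\<in>I. c' i * \<beta> i l) = (\<Sum>i\<in>?I. c i * \<gamma> i l)" for l
      unfolding sum gamma by simp
    moreover have "(\<Sum>i\<in>?I. c i * \<gamma> i k) = 0" using i0(2) by (simp add: \<gamma>_def)
    moreover have "\<exists>i\<in>I. c' i \<noteq> 0" using c(1) by (auto simp: c'_def)
    ultimately show ?thesis using c(2) by (intro exI[of _ c']) auto
  qed
qed

definition line :: "'u::real_inner \<Rightarrow> 'u set" where
  "line e = range (\<lambda>r. r *\<^sub>R e)"

lemma subspace_line: "subspace (line e)"
proof -
  have "line e = span {e}" by (simp add: line_def span_singleton)
  then show ?thesis by simp
qed

lemma closed_line: "closed (line (e::'u::real_inner))"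
proof (cases "e = 0")
  case False
  \<comment> \<open>The line is the set of points equal to their orthogonal projection onto it, an
    equation between continuous maps.\<close>
  have "line e = {x. x = (inner x e / inner e e) *\<^sub>R e}"
    using False by (auto simp: line_def)
  then show ?thesis using False by (auto intro!: closed_Collect_eq continuous_intros)
qed (simp add: line_def)

lemma metric_on_line:
  fixes e :: "'u::{real_inner,complete_space}"
  assumes G: "metric_on (line e) G" and e: "e \<noteq> 0"
  obtains g where "g \<noteq> 0" "\<And>x. x \<in> line e \<Longrightarrow> G x = g *\<^sub>R x"
proof -
  have e_in: "e \<in> line e" by (auto simp: line_def intro: range_eqI[of _ _ 1])
  then have "G e \<in> line e" using metric_onD(1)[OF G] by blast
  then obtain g where g: "G e = g *\<^sub>R e" by (auto simp: line_def)
  have lin: "G x = g *\<^sub>R x" if x: "x \<in> line e" for x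
  proof -
    obtain r where r: "x = r *\<^sub>R e" using x unfolding line_def by blast
    show ?thesis using metric_onD(3)[OF G e_in, of r] g by (simp add: r mult.commute)
  qed
  moreover have "g \<noteq> 0"
  proof
    assume "g = 0"
    then have "G e = G 0" using g metric_onD(4)[OF G subspace_line] by simp
    then show False using metric_on_inj[OF subspace_line G] e e_in subspace_0[OF subspace_line]
      by (metis inj_onD)
  qed
  ultimately show thesis using that by blast
qed

text \<open>The coefficients are the same for all points of \<open>X\<close>. Dual inputs do not
  occur because the dual spaces will be \<open>{0}\<close>, and real coefficients suffice on a
  line.\<close>

definition linear_in_input :: "nat \<Rightarrow> 'u point set \<Rightarrow> ('u point \<Rightarrow> 'u::real_vector) \<Rightarrow> bool" where
  "linear_in_input d X g \<longleftrightarrow> (\<exists>\<beta>. \<forall>x\<in>X. g x = (\<Sum>q=1..d. \<beta> q *\<^sub>R fst x q))"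

lemma linear_in_input_zero: "(\<And>x. x \<in> X \<Longrightarrow> g x = 0) \<Longrightarrow> linear_in_input d X g"
  unfolding linear_in_input_def by (intro exI[of _ "\<lambda>_. 0"]) auto

lemma linear_in_input_add:
  assumes "linear_in_input d X g" "linear_in_input d X h"
  shows "linear_in_input d X (\<lambda>x. g x + h x)"
proof -
  obtain \<beta> \<gamma> where "\<forall>x\<in>X. g x = (\<Sum>q=1..d. \<beta> q *\<^sub>R fst x q)" "\<forall>x\<in>X. h x = (\<Sum>q=1..d. \<gamma> q *\<^sub>R fst x q)"
    using assms unfolding linear_in_input_def by blast
  then show ?thesis unfolding linear_in_input_def
    by (intro exI[of _ "\<lambda>q. \<beta> q + \<gamma> q"]) (simp add: scaleR_add_left sum.distrib)
qed

lemma linear_in_input_scale: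
  assumes "linear_in_input d X g" "\<And>x. x \<in> X \<Longrightarrow> h x = c *\<^sub>R g x"
  shows "linear_in_input d X h"
proof -
  obtain \<beta> where "\<forall>x\<in>X. g x = (\<Sum>q=1..d. \<beta> q *\<^sub>R fst x q)"
    using assms unfolding linear_in_input_def by blast
  then show ?thesis unfolding linear_in_input_def using assms(2)
    by (intro exI[of _ "\<lambda>q. c * \<beta> q"]) (simp add: scaleR_sum_right)
qed

lemma linear_in_input_component:
  fixes X :: "'u::real_vector point set"
  assumes "k \<in> {1..d}"
  shows "linear_in_input d X (\<lambda>x. fst x k)"
proof -
  have "(\<Sum>q=1..d. (if q = k then 1 else 0) *\<^sub>R fst x q) = fst x k" for x :: "'u point"
  proof -
    have "(\<Sum>q=1..d. (if q = k then 1 else 0) *\<^sub>R fst x q) = (\<Sum>q=1..d. if q = k then fst x q else 0)"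
      by (intro sum.cong) auto
    then show ?thesis using assms by simp
  qed
  then show ?thesis unfolding linear_in_input_def by (intro exI[of _ "\<lambda>q. if q = k then 1 else 0"]) simp
qed

text \<open>Every source of nonlinearity returns \<open>0\<close> here: the resolvents of the
  \<open>A i\<close>, the \<open>C l\<close>, and also the adjoints, which are the only way from a
  dual value back to \<open>H\<close>. What remains are sums, scalars and metrics, and on a line
  metrics and their inverses are scalars too.\<close>

lemma run_linear_in_input:
  fixes e :: "'u::{real_inner,complete_space}"
  assumes e: "e \<noteq> 0" and \<sigma>: "\<sigma> \<in> {1..f} \<rightarrow> {1..m}"
    and P: "P = test_problem (line e) (\<lambda>_. {0}) (\<lambda>_. point_cone (line e) 0) (\<lambda>_. 0)"
    and cs: "prog_sorts n m p d f \<sigma> [] cs ss" and k: "k < length cs" "ss ! k = SortH"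
  shows "linear_in_input d (lifted_space d f \<sigma> P) (\<lambda>x. run P x [] cs ! k)"
proof -
  let ?V = "line e"
  have inst: "problem_instance n m p P"
    unfolding P by (rule test_problem_instance)
      (auto intro!: maximally_monotone_on_point_cone subspace_line closed_line subspace_0)
  interpret problem n m p P using inst by unfold_locales
  have sel: "spH P = ?V" "opA P = (\<lambda>_. point_cone ?V 0)" "spK P = (\<lambda>_. {0})" "opC P = (\<lambda>_ _. 0)" "vec_a P = 0"
    by (simp_all add: P test_problem_def)
  have sp: "fst (spaces_of P) = ?V" by (simp add: spaces_of_def sel)
  have Ladj0: "Ladj P j y = 0" for j y unfolding P by (rule Ladj_test_problem[OF subspace_line])
  show ?thesis
    using k
  proof (induction k rule: less_induct)
    case (less k)
    let ?X = "lifted_space d f \<sigma> P"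
    have sort: "instr_sort n m p d f \<sigma> (take k ss) (cs ! k) SortH"
      using prog_sorts_nth[OF cs less.prems(1)] less.prems(2) by simp
    have IH: "linear_in_input d ?X (\<lambda>x. run P x [] cs ! r)" "r < k"
      "\<And>x. take k (run P x [] cs) ! r = run P x [] cs ! r"
      "\<And>x. x \<in> ?X \<Longrightarrow> run P x [] cs ! r \<in> ?V"
      if "at_sort (take k ss) r SortH" for r
      using that less.IH[of r] less.prems run_in_space[OF \<sigma> _ cs, of _ r] by (auto simp: at_sort_def sp)
    have metric: "\<exists>g. g \<noteq> 0 \<and> (\<forall>x\<in>?V. G (spaces_of P) x = g *\<^sub>R x)" if "metric_family m SortH G" for G
    proof -
      have "metric_on ?V (G (spaces_of P))" using metric_H[OF that] by (simp add: sel)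
      from metric_on_line[OF this e] show ?thesis by metis
    qed
    have "linear_in_input d ?X (\<lambda>x. exec_instr P x (take k (run P x [] cs)) (cs ! k))"
    proof (cases "cs ! k")
      case (InputH q)
      then show ?thesis using sort by (simp add: linear_in_input_component)
    next
      case (Add q r)
      with sort have qr: "at_sort (take k ss) q SortH" "at_sort (take k ss) r SortH" by auto
      show ?thesis using linear_in_input_add[OF IH(1)[OF qr(1)] IH(1)[OF qr(2)]]
        by (simp add: Add IH(3)[OF qr(1)] IH(3)[OF qr(2)])
    next
      case (Scale c r)
      with sort have r: "at_sort (take k ss) r SortH" by auto
      show ?thesis by (rule linear_in_input_scale[OF IH(1)[OF r], of _ c]) (simp add: Scale IH(3)[OF r])
    next
      case (Metric \<tau> G r)
      with sort have r: "at_sort (take k ss) r SortH" "metric_family m SortH G" by auto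
      then obtain g where "\<forall>x\<in>?V. G (spaces_of P) x = g *\<^sub>R x" using metric by blast
      then show ?thesis
        by (intro linear_in_input_scale[OF IH(1)[OF r(1)], of _ g])
          (simp add: Metric IH(3)[OF r(1)] IH(4)[OF r(1)])
    next
      case (MetricInv \<tau> G r)
      with sort have r: "at_sort (take k ss) r SortH" "metric_family m SortH G" "\<tau> = SortH" by auto
      obtain g where g: "g \<noteq> 0" "\<forall>x\<in>?V. G (spaces_of P) x = g *\<^sub>R x" using metric[OF r(2)] by blast
      have "inv_into ?V (G (spaces_of P)) y = (1 / g) *\<^sub>R y" if "y \<in> ?V" for y
      proof (rule inv_into_f_eq)
        show "inj_on (G (spaces_of P)) ?V"
          using metric_on_inj[OF subspace_line] metric_H[OF r(2)] by (simp add: sel)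
        show "(1 / g) *\<^sub>R y \<in> ?V" using that by (rule subspace_scale[OF subspace_line])
        then show "G (spaces_of P) ((1 / g) *\<^sub>R y) = y" using g by simp
      qed
      then show ?thesis
        by (intro linear_in_input_scale[OF IH(1)[OF r(1)], of _ "1 / g"])
          (simp add: MetricInv IH(3)[OF r(1)] IH(4)[OF r(1)] r(3) sp)
    next
      case (ResolventA i G r)
      with sort have r: "at_sort (take k ss) r SortH" "metric_family m SortH G" by auto
      have "param_resolvent (G (spaces_of P)) (point_cone ?V 0) y = 0" if "y \<in> ?V" for y
      proof (rule param_resolvent_eqI[OF subspace_line])
        show "maximally_monotone_on ?V (point_cone ?V 0)"
          by (intro maximally_monotone_on_point_cone subspace_line subspace_0)
        show G: "metric_on ?V (G (spaces_of P))" using metric_H[OF r(2)] by (simp add: sel)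
        show "y - G (spaces_of P) 0 \<in> point_cone ?V 0 0"
          using that metric_onD(4)[OF G subspace_line] by (simp add: point_cone_def)
      qed
      then show ?thesis
        by (intro linear_in_input_zero) (simp add: ResolventA IH(3)[OF r(1)] IH(4)[OF r(1)] sel)
    qed (use sort in \<open>auto intro!: linear_in_input_zero simp: sel Ladj0\<close>)
    then show ?case unfolding run_nth[OF less.prems(1)] .
  qed
qed

lemma primal_lifting_minimal:
  fixes T :: "'u::{real_inner,complete_space} problem \<Rightarrow> 'u point \<Rightarrow> 'u point"
  assumes e: "(e::'u) \<noteq> 0" and n: "n \<ge> 2" and fs: "frugal_splitting n m p d f \<sigma> T S"
  shows "n - 1 \<le> d"
proof (rule ccontr)
  assume "\<not> n - 1 \<le> d"
  then have d: "card {1..d} < card {1..n-1}" by simp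
  let ?V = "line e"
  obtain cs oz os ou where fp: "frugal_procedure n m p d f \<sigma> T S cs oz os ou"
    and \<sigma>: "\<sigma> \<in> {1..f} \<rightarrow> {1..m}" and enc: "fixed_point_encoding n m p (lifted_space d f \<sigma>) T S"
    using fs unfolding frugal_splitting_def by blast
  obtain ss where cs: "prog_sorts n m p d f \<sigma> [] cs ss"
    using fp unfolding frugal_procedure_def by blast
  have T: "T P x = (\<lambda>k\<in>{1..d}. run P x [] cs ! oz k, \<lambda>k\<in>{1..f}. run P x [] cs ! os k)"
    "S P x = run P x [] cs ! ou"
    if "problem_instance n m p P" "x \<in> lifted_space d f \<sigma> P" for P x
    using fp that unfolding frugal_procedure_def by blast+
  have "\<exists>k G r. k < length cs \<and> cs ! k = ResolventA i G r \<and>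
      (\<forall>k' G' r'. k' < length cs \<longrightarrow> cs ! k' = ResolventA i G' r' \<longrightarrow> k' = k)" if i: "i < n" for i
  proof -
    have "card {k. k < length cs \<and> evaluates_A i (cs ! k)} = 1"
      using fp i unfolding frugal_procedure_def length_filter_conv_card by blast
    then obtain k where k: "{k. k < length cs \<and> evaluates_A i (cs ! k)} = {k}"
      by (rule card_1_singletonE)
    then have "k < length cs" "evaluates_A i (cs ! k)" by auto
    moreover have "k' = k" if "k' < length cs" "evaluates_A i (cs ! k')" for k'
      using k that by blast
    ultimately show ?thesis unfolding evaluates_A_def by blast
  qed
  then obtain pos G r where pos: "\<And>i. i < n \<Longrightarrow> pos i < length cs"
    "\<And>i. i < n \<Longrightarrow> cs ! pos i = ResolventA i (G i) (r i)"
    "\<And>i k G' r'. i < n \<Longrightarrow> k < length cs \<Longrightarrow> cs ! k = ResolventA i G' r' \<Longrightarrow> k = pos i"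
    by metis
  have r: "r i < pos i" "ss ! r i = SortH" "metric_family m SortH (G i)" if "i < n" for i
    using prog_sorts_nth[OF cs pos(1)[OF that]] pos(2)[OF that] by (auto simp: at_sort_def)
  \<comment> \<open>The instance that the modified one below turns out to be. Naming it before
    \<open>w\<close> makes \<open>\<beta>\<close> independent of \<open>w\<close>.\<close>
  define P0 where "P0 = test_problem ?V (\<lambda>_. {0}) (\<lambda>_. point_cone ?V 0) (\<lambda>_. 0)"
  have "linear_in_input d (lifted_space d f \<sigma> P0) (\<lambda>x. run P0 x [] cs ! r i)" if "i < n" for i
    by (rule run_linear_in_input[OF e \<sigma> P0_def cs])
      (use r[OF that] pos(1)[OF that] in auto)
  then have "\<forall>i. \<exists>\<beta>. i < n \<longrightarrow> (\<forall>x\<in>lifted_space d f \<sigma> P0. run P0 x [] cs ! r i = (\<Sum>q=1..d. \<beta> q *\<^sub>R fst x q))"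
    unfolding linear_in_input_def by blast
  from choice[OF this] obtain \<beta> where \<beta>: "\<And>i x. i < n \<Longrightarrow> x \<in> lifted_space d f \<sigma> P0 \<Longrightarrow>
      run P0 x [] cs ! r i = (\<Sum>q=1..d. \<beta> i q *\<^sub>R fst x q)"
    by blast
  obtain c where c: "\<exists>i\<in>{1..n-1}. c i \<noteq> 0" "\<forall>q\<in>{1..d}. (\<Sum>i=1..n-1. c i * \<beta> i q) = 0"
    using homogeneous_system_solution[OF _ _ d, of \<beta>] by auto
  \<comment> \<open>Components \<open>1..n-1\<close> repeat the dependence \<open>c\<close>, so
    pairing \<open>w\<close> with \<open>c\<close> gives
    \<open>(\<Sum>i=1..n-1. (c i)\<^sup>2) *\<^sub>R e\<close>, while linearity in fewer than
    \<open>n - 1\<close> inputs forces that pairing to vanish. Component \<open>0\<close> only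
    restores the sum zero.\<close>
  define w where "w = (\<lambda>i. (if i = 0 then - (\<Sum>k=1..n-1. c k) else c i) *\<^sub>R e)"
  have w_in: "w i \<in> ?V" for i unfolding w_def line_def by (rule rangeI)
  have n_eq: "{..<n} = insert 0 {1..n-1}" using n by auto
  have w_sum: "(\<Sum>i<n. w i) = 0"
  proof -
    have "(\<Sum>i=1..n-1. w i) = (\<Sum>i=1..n-1. c i *\<^sub>R e)" by (intro sum.cong) (auto simp: w_def)
    then show ?thesis unfolding n_eq by (simp add: w_def scaleR_sum_left)
  qed
  define P where "P = test_problem ?V (\<lambda>_. {0}) (\<lambda>i x. if x \<in> ?V then {1 *\<^sub>R x + w i} else {}) (\<lambda>_. 0)"
  have inst: "problem_instance n m p P"
    unfolding P_def by (rule test_problem_instance)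
      (use w_in in \<open>auto intro!: maximally_monotone_on_affine[where c = 1, simplified] subspace_line closed_line\<close>)
  interpret problem n m p P using inst by unfold_locales
  have zero_in: "0 \<in> ?V" by (rule subspace_0[OF subspace_line])
  have sol: "solves n m p P u \<longleftrightarrow> u = 0" for u
  proof -
    have "u \<in> ?V \<Longrightarrow> (\<exists>\<alpha>. (\<forall>i<n. \<alpha> i \<in> (if u \<in> ?V then {1 *\<^sub>R u + w i} else {})) \<and> (\<Sum>i<n. \<alpha> i) = 0)
      \<longleftrightarrow> (\<Sum>i<n. u + w i) = 0"
    proof
      assume u: "u \<in> ?V" and "\<exists>\<alpha>. (\<forall>i<n. \<alpha> i \<in> (if u \<in> ?V then {1 *\<^sub>R u + w i} else {})) \<and> (\<Sum>i<n. \<alpha> i) = 0"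
      then obtain \<alpha> where \<alpha>: "\<forall>i<n. \<alpha> i = u + w i" "(\<Sum>i<n. \<alpha> i) = 0" by auto
      have "(\<Sum>i<n. \<alpha> i) = (\<Sum>i<n. u + w i)" using \<alpha>(1) by (intro sum.cong) auto
      with \<alpha>(2) show "(\<Sum>i<n. u + w i) = 0" by simp
    qed (auto intro: exI[of _ "\<lambda>i. u + w i"])
    moreover have "(\<Sum>i<n. u + w i) = real n *\<^sub>R u" by (simp add: sum.distrib w_sum sum_constant_scaleR)
    ultimately show ?thesis
      unfolding P_def solves_test_problem[OF inst[unfolded P_def]] using zero_in n by auto
  qed
  then obtain x where x: "x \<in> lifted_space d f \<sigma> P" "T P x = x" and Sx: "solves n m p P (S P x)"
    using enc inst unfolding fixed_point_encoding_def by blast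
  have S0: "S P x = 0" using Sx sol by blast
  \<comment> \<open>The default \<open>0\<close> beyond the nodes makes \<open>u\<close> the zero
    function later on, so that \<open>P' = P0\<close> holds literally.\<close>
  define u where "u = (\<lambda>i. if i < n then run P x [] cs ! pos i else 0)"
  have spH: "spH P = ?V" by (simp add: P_def test_problem_def)
  have u_in: "u i \<in> ?V" for i
  proof (cases "i < n")
    case True
    have "ss ! pos i = SortH" using prog_sorts_nth[OF cs pos(1)[OF True]] pos(2)[OF True] by simp
    then show ?thesis using run_in_space[OF \<sigma> x(1) cs pos(1)[OF True]] True
      by (simp add: u_def spaces_of_def spH)
  qed (simp add: u_def zero_in)
  define P' where "P' = P\<lparr>opA := \<lambda>i. point_cone (spH P) (u i)\<rparr>"
  have P'_eq: "P' = test_problem ?V (\<lambda>_. {0}) (\<lambda>i. point_cone ?V (u i)) (\<lambda>_. 0)"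
    by (simp add: P'_def P_def test_problem_def)
  have run_eq: "run P' x [] cs = run P x [] cs"
    unfolding P'_def by (rule run_point_cones[OF \<sigma> x(1) cs]) (use pos(3) in \<open>auto simp: u_def\<close>)
  have inst': "problem_instance n m p P'"
    unfolding P'_eq by (rule test_problem_instance)
      (auto intro!: maximally_monotone_on_point_cone subspace_line closed_line u_in)
  have x': "x \<in> lifted_space d f \<sigma> P'" using x(1) by (simp add: P'_def lifted_space_def)
  have "T P' x = x" using T(1)[OF inst' x'] T(1)[OF inst x(1)] x(2) run_eq by simp
  then have "solves n m p P' (S P' x)"
    using enc inst' x' unfolding fixed_point_encoding_def by blast
  moreover have "S P' x = 0" using T(2)[OF inst' x'] T(2)[OF inst x(1)] S0 run_eq by simp
  ultimately have "solves n m p P' 0" by simp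
  \<comment> \<open>\<open>x\<close> is still a fixed point with output \<open>0\<close>, so
    \<open>0\<close> must lie in the domain \<open>{u i}\<close> of each normal cone.\<close>
  then have "\<forall>i<n. point_cone ?V (u i) 0 \<noteq> {}"
    unfolding P'_eq solves_test_problem[OF inst'[unfolded P'_eq]] by auto
  then have "\<forall>i<n. u i = 0" by (auto simp: point_cone_def split: if_splits)
  then have u0: "u = (\<lambda>_. 0)" by (auto simp: u_def fun_eq_iff)
  then have "P' = P0" by (simp add: P'_eq P0_def)
  have w_eq: "w i = (\<Sum>q=1..d. \<beta> i q *\<^sub>R fst x q)" if i: "i < n" for i
  proof -
    let ?y = "run P x [] cs ! r i"
    have G: "metric_on (spH P) (G i (spaces_of P))" using metric_H r(3)[OF i] by blast
    have y: "?y \<in> spH P"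
      using run_in_space[OF \<sigma> x(1) cs, of "r i"] r(1,2)[OF i] pos(1)[OF i] by (simp add: spaces_of_def)
    have "0 = run P x [] cs ! pos i" using fun_cong[OF u0, of i] i by (simp add: u_def)
    also have "\<dots> = param_resolvent (G i (spaces_of P)) (opA P i) ?y"
      using run_nth[OF pos(1)[OF i], of P x] pos(2)[OF i] r(1)[OF i] by simp
    \<comment> \<open>Back in \<open>P\<close>, where \<open>A i 0 = {w i}\<close>: a resolvent
      value \<open>0\<close> reveals its argument. Its linear form comes from \<open>P0\<close>,
      which has the same run at \<open>x\<close>.\<close>
    finally have "?y - G i (spaces_of P) 0 \<in> opA P i 0"
      unfolding param_resolvent_iff[OF H opA_max[OF i] G y] .
    then have "?y = w i"
      using metric_onD(4)[OF G H(1)] zero_in by (simp add: P_def test_problem_def)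
    moreover have "?y = (\<Sum>q=1..d. \<beta> i q *\<^sub>R fst x q)"
      using \<beta>[OF i, of x] x' run_eq \<open>P' = P0\<close> by simp
    ultimately show ?thesis by simp
  qed
  have "(\<Sum>i=1..n-1. c i *\<^sub>R w i) = (\<Sum>i=1..n-1. \<Sum>q=1..d. (c i * \<beta> i q) *\<^sub>R fst x q)"
  proof (rule sum.cong[OF refl])
    fix i assume "i \<in> {1..n-1}"
    then have "i < n" by auto
    from w_eq[OF this] show "c i *\<^sub>R w i = (\<Sum>q=1..d. (c i * \<beta> i q) *\<^sub>R fst x q)"
      by (simp add: scaleR_sum_right)
  qed
  also have "\<dots> = (\<Sum>q=1..d. (\<Sum>i=1..n-1. c i * \<beta> i q) *\<^sub>R fst x q)"
    unfolding scaleR_sum_left by (rule sum.swap)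
  also have "\<dots> = 0" using c(2) by (intro sum.neutral) auto
  also have "(\<Sum>i=1..n-1. c i *\<^sub>R w i) = (\<Sum>i=1..n-1. (c i)\<^sup>2) *\<^sub>R e"
    unfolding scaleR_sum_left by (intro sum.cong) (auto simp: w_def power2_eq_square)
  finally have "(\<Sum>i=1..n-1. (c i)\<^sup>2) = 0" using e by simp
  then have "\<forall>i\<in>{1..n-1}. (c i)\<^sup>2 = 0" by (subst (asm) sum_nonneg_eq_0_iff) auto
  then show False using c(1) by auto
qed

theorem theorem3p4:
  fixes n m p :: nat
    and pa :: "nat \<Rightarrow> nat"
    and J Jc Q :: "nat \<Rightarrow> nat set"
    and M N :: "nat \<Rightarrow> 'u::{real_inner,complete_space} metric"
    and \<theta> \<zeta> :: "nat \<Rightarrow> real"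
  assumes universe: "\<exists>v::'u. v \<noteq> 0"
    and n: "n \<ge> 2"
    and tree: "tree_data n m p pa J Jc Q"
    and M: "\<forall>i\<in>{1..n-1}. metric_family m SortH (M i)"
    and N: "\<forall>j\<in>{1..m}. metric_family m (SortK j) (N j)"
    and \<theta>: "\<forall>i\<in>{1..n-1}. \<theta> i \<noteq> 0"
    and \<zeta>: "\<forall>j\<in>{1..m}. \<zeta> j \<noteq> 0"
  shows "fixed_point_encoding n m p (lifted_space (n - 1) m id)
           (tree_T n m pa J Jc Q M N \<theta> \<zeta>) (tree_S n pa J M)
         \<and> frugal_splitting n m p (n - 1) m id
           (tree_T n m pa J Jc Q M N \<theta> \<zeta>) (tree_S n pa J M)
         \<and> minimal_lifting TYPE('u) n m p (n - 1) m"
proof -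
  interpret tree n m p pa J Jc Q M N \<theta> \<zeta>
    using assms by unfold_locales blast+
  obtain e :: 'u where e: "e \<noteq> 0" using universe by blast
  have "minimal_lifting TYPE('u) n m p (n - 1) m"
    unfolding minimal_lifting_def using primal_lifting_minimal[OF e n] dual_lifting_minimal[OF e] by blast
  then show ?thesis using tree_fixed_point_encoding tree_frugal_splitting by blast
qed

end
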